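(* Let $Q:=q^7$. Then $$\frac{(1,0,14)-(3,2,5)}{(2,0,7)+(3,2,5)}=q\frac{E^2(Q^4)E^2(q^2)}{E^2(Q^2)E^2(q^4)}.$$
   Context: $|q|<1$, $E(q)=(q;q)_\infty=\prod_{k\ge1}(1-q^k)$, and $E^2(x)$ means $E(x)^2$. For integers $a,b,c$ with $a,c>0$, $b^2-4ac<0$, $(a,b,c)$ denotes $\sum_{n,m=-\infty}^{\infty}q^{an^2+bnm+cm^2}$. *)

theory Defs
  imports "HOL-Analysis.Analysis"
begin

definition euler_E :: "complex \<Rightarrow> complex" where
  "euler_E q = (\<Prod>k. 1 - q ^ Suc k)"

(* The series written (a,b,c). It is meant for a, c > 0 and b^2 - 4ac < 0: the exponents are then
   nonnegative and the double series converges absolutely for |q| < 1. *)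
definition form_theta :: "int \<Rightarrow> int \<Rightarrow> int \<Rightarrow> complex \<Rightarrow> complex" where
  "form_theta a b c q = (\<Sum>\<^sub>\<infinity>(n, m)\<in>UNIV. q powi (a * n\<^sup>2 + b * n * m + c * m\<^sup>2))"

end

theory Submission
  imports Defs "HOL-Complex_Analysis.Complex_Analysis"
begin

text \<open>
  Write \<open>C = (3,2,5)\<close>. Splitting products of two copies of the lattice of \<open>C\<close> into sum and difference vectors,
  and evaluating two sign-twisted cosets of it by the pentagonal number theorem, gives
  \<open>C(-q^2) (C(q) - C(q^2)) = 2 q^3 (E(q^8)^2 E(q^28)^2 + q^2 E(q^4)^2 E(q^56)^2)\<close>.
  Together with \<open>C(0) = 1\<close> this recursion determines \<open>C\<close> near \<open>0\<close>. It is solved explicitly: all eta quotients in sight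
  are algebraic over \<open>t = 2 q^2 psi(q^2) psi(q^14) / (phi(q^2) phi(q^14))\<close> because of the degree seven identity
  \<open>phi(q) phi(q^7) = 2 q psi(q) psi(q^7) + phi(-q^2) phi(-q^14)\<close>, so that both the recursion for the candidate
  solution and the claimed quotient become polynomial identities; square and cube roots are pinned down by
  their leading terms. The result near \<open>0\<close> extends to the unit disc by analytic continuation.
\<close>

section \<open>Double series and the Jacobi triple product\<close>

text \<open>The obstacle is that \<open>(3,2,5)\<close>, unlike \<open>(1,0,14)\<close> and
  \<open>(2,0,7)\<close>, is not equivalent to a diagonal form, so its series is not a product of
  two values of \<open>phi\<close>. It has a self-similarity instead: the vectors of even value form
  a copy of the lattice scaled by 2. Hence \<open>C(q) - C(q^2)\<close> is the odd part of
  \<open>C\<close>, and the recursion expresses \<open>C(q)\<close> by values at \<open>q^2\<close>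
  and \<open>-q^2\<close>, which lie closer to \<open>0\<close>. The candidate for \<open>C\<close>
  is what the claim forces. Write \<open>A\<close>, \<open>B\<close> for the two diagonal series and
  \<open>h\<close> for the right side; then \<open>C = (A - h B) / (1 + h)\<close>, and an algebraic
  expression for \<open>h\<close> turns this into a fraction with denominator \<open>A - B\<close>.
  The parameters live on \<open>r^2 = t (2 - 3 t + 2 t^2)\<close>, a curve of genus one, with two
  further square roots \<open>s\<close> and \<open>D = A - B\<close>. The right side of the
  recursion is a sum of two eta quotients that becomes algebraic in \<open>t\<close> and
  \<open>r\<close> only after squaring, because the ratio of the summands enters symmetrically. This
  is why branches have to be chosen, and why the argument stays near the origin, where leading terms
  decide them and divisors do not vanish.\<close>

lemma geometric_abs_summable_int:
  fixes c :: real
  assumes "0 \<le> c" "c < 1"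
  shows "(\<lambda>j::int. c ^ nat \<bar>j\<bar>) summable_on UNIV"
proof -
  have g: "(\<lambda>n::nat. c ^ n) summable_on UNIV"
    using assms by (intro norm_summable_imp_summable_on) (auto simp: norm_power intro!: summable_geometric)
  have 1: "(\<lambda>j::int. c ^ nat \<bar>j\<bar>) summable_on {0..}"
    using g by (subst summable_on_reindex_bij_witness[where i = int and j = nat and T = UNIV]) auto
  have 2: "(\<lambda>j::int. c ^ nat \<bar>j\<bar>) summable_on {..0}"
    using g by (subst summable_on_reindex_bij_witness[where i = "\<lambda>n. - int n" and j = "\<lambda>j. nat (- j)" and T = UNIV]) auto
  have "{..0::int} \<union> {0..} = UNIV" by auto
  then show ?thesis using summable_on_union[OF 2 1] by metis
qed

lemma summable_on_Times_mult:
  fixes f :: "'a \<Rightarrow> complex" and g :: "'b \<Rightarrow> complex"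
  assumes "f summable_on A" "g summable_on B"
  shows "(\<lambda>(x, y). f x * g y) summable_on A \<times> B"
proof -
  have f: "(\<lambda>x. norm (f x)) summable_on A" and g: "(\<lambda>x. norm (g x)) summable_on B"
    using assms by (auto simp: summable_on_iff_abs_summable_on_complex)
  have "(\<lambda>z. norm ((\<lambda>(x, y). f x * g y) z)) summable_on A \<times> B"
  proof (rule summable_on_SigmaI)
    show "((\<lambda>y. norm (case (x, y) of (x, y) \<Rightarrow> f x * g y)) has_sum (norm (f x) * (\<Sum>\<^sub>\<infinity>y\<in>B. norm (g y)))) B" for x
      using has_sum_cmult_right[OF has_sum_infsum[OF g]] by (simp add: norm_mult)
    show "(\<lambda>x. norm (f x) * (\<Sum>\<^sub>\<infinity>y\<in>B. norm (g y))) summable_on A"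
      using f by (rule summable_on_cmult_left)
  qed auto
  then show ?thesis by (simp add: summable_on_iff_abs_summable_on_complex)
qed

lemma has_sum_Times_mult:
  fixes f :: "'a \<Rightarrow> complex" and g :: "'b \<Rightarrow> complex"
  assumes "(f has_sum a) A" "(g has_sum b) B"
  shows "((\<lambda>(x, y). f x * g y) has_sum a * b) (A \<times> B)"
proof (rule has_sum_SigmaI)
  show "((\<lambda>y. case (x, y) of (x, y) \<Rightarrow> f x * g y) has_sum f x * b) B" for x
    using has_sum_cmult_right[OF assms(2)] by simp
  show "((\<lambda>x. f x * b) has_sum a * b) A"
    using assms(1) by (rule has_sum_cmult_left)
  show "(\<lambda>(x, y). f x * g y) summable_on A \<times> B"
    using assms by (intro summable_on_Times_mult) (auto dest: has_sum_imp_summable)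
qed

text \<open>Tannery's theorem for unordered sums over the integers: \<open>int_decode\<close>
  enumerates the indices, so that the sequential version applies. It carries the finite triple
  product to its limit.\<close>

lemma has_sum_dominated_limit:
  fixes f :: "nat \<Rightarrow> int \<Rightarrow> complex"
  assumes "\<And>n. (f n has_sum S n) UNIV"
    and "\<And>i. (\<lambda>n. f n i) \<longlonglongrightarrow> g i"
    and "\<And>n i. norm (f n i) \<le> M i"
    and "M summable_on UNIV" and "g summable_on UNIV"
  shows "S \<longlonglongrightarrow> infsum g UNIV"
proof -
  have tr: "(\<lambda>k. h (int_decode k)) sums s" if "(h has_sum s) UNIV" for h :: "int \<Rightarrow> 'a :: {topological_comm_monoid_add, t2_space}" and s
    using that has_sum_reindex_bij_betw[OF bij_int_decode, of h s] has_sum_imp_sums by blast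
  have "summable (\<lambda>k. M (int_decode k))"
    using assms(4) tr has_sum_infsum sums_summable by blast
  then have "(\<lambda>n. suminf (\<lambda>k. f n (int_decode k))) \<longlonglongrightarrow> suminf (\<lambda>k. g (int_decode k))"
    using assms(2,3) by (intro tannerys_theorem[where M = "\<lambda>k. M (int_decode k)", THEN conjunct2, THEN conjunct2])
      (auto intro: always_eventually)
  moreover have "suminf (\<lambda>k. f n (int_decode k)) = S n" for n
    using tr[OF assms(1)] sums_unique by metis
  moreover have "suminf (\<lambda>k. g (int_decode k)) = infsum g UNIV"
    using tr[OF has_sum_infsum[OF assms(5)]] sums_unique by metis
  ultimately show ?thesis by simp
qed

section \<open>Finite q-products, Gaussian coefficients and the triple product\<close>

definition qpoch :: "complex \<Rightarrow> nat \<Rightarrow> complex" where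
  "qpoch q n = (\<Prod>k<n. 1 - q ^ Suc k)"

lemma qpoch_Suc: "qpoch q (Suc n) = qpoch q n * (1 - q ^ Suc n)"
  by (simp add: qpoch_def)

lemma one_minus_power_nonzero:
  fixes q :: complex
  assumes "norm q < 1"
  shows "1 - q ^ Suc k \<noteq> 0"
proof
  assume "1 - q ^ Suc k = 0"
  then have "norm (q ^ Suc k) = 1" by (metis eq_iff_diff_eq_0 norm_one)
  moreover have "norm (q ^ Suc k) < 1"
    using assms by (metis norm_power power_Suc_less_one norm_ge_zero power_0_left zero_less_Suc power_less_one_iff linorder_not_less less_le zero_less_one)
  ultimately show False by simp
qed

lemma qpoch_nonzero: "norm q < 1 \<Longrightarrow> qpoch q n \<noteq> 0"
  using one_minus_power_nonzero by (auto simp: qpoch_def)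

lemma euler_E_convergent:
  fixes q :: complex
  assumes "norm q < 1"
  shows "convergent_prod (\<lambda>k. 1 - q ^ Suc k)"
proof -
  have "summable (\<lambda>k. norm (1 - q ^ Suc k - 1))"
    using assms summable_mult[OF summable_geometric, of "norm q" "norm q"] by (simp add: norm_power norm_mult)
  then show ?thesis
    by (intro abs_convergent_prod_imp_convergent_prod) (simp add: abs_convergent_prod_conv_summable)
qed

lemma qpoch_tendsto:
  assumes "norm q < 1"
  shows "qpoch q \<longlonglongrightarrow> euler_E q"
proof -
  have "(\<lambda>n. \<Prod>k\<le>n. 1 - q ^ Suc k) \<longlonglongrightarrow> euler_E q"
    unfolding euler_E_def using euler_E_convergent[OF assms] by (rule convergent_prod_LIMSEQ)
  then have "(\<lambda>n. qpoch q (Suc n)) \<longlonglongrightarrow> euler_E q"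
    by (simp add: qpoch_def lessThan_Suc_atMost)
  then show ?thesis by (rule LIMSEQ_imp_Suc)
qed

lemma euler_E_nonzero:
  assumes "norm q < 1"
  shows "euler_E q \<noteq> 0"
  unfolding euler_E_def using euler_E_convergent[OF assms] one_minus_power_nonzero[OF assms]
  by (intro prodinf_nonzero) auto

text \<open>Ramanujan's \<open>f(a, b)\<close> as a bilateral series; this form of the triple product needs no fractional powers.\<close>

definition theta_term :: "complex \<Rightarrow> complex \<Rightarrow> int \<Rightarrow> complex" where
  "theta_term a b j = a powi (j * (j + 1) div 2) * b powi (j * (j - 1) div 2)"

lemma theta_term_Suc:
  assumes "a \<noteq> 0" "b \<noteq> 0"
  shows "theta_term a b (j + 1) = theta_term a b j * a * (a * b) powi j"
proof -
  have 1: "(j + 1) * (j + 1 + 1) div 2 = j * (j + 1) div 2 + j + 1"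
  proof -
    have "(j + 1) * (j + 1 + 1) = j * (j + 1) + 2 * (j + 1)" by (simp add: algebra_simps)
    then show ?thesis by simp
  qed
  have 2: "(j + 1) * (j + 1 - 1) div 2 = j * (j - 1) div 2 + j"
  proof -
    have "(j + 1) * (j + 1 - 1) = j * (j - 1) + 2 * j" by (simp add: algebra_simps)
    then show ?thesis by simp
  qed
  show ?thesis
    unfolding theta_term_def 1 2 using assms by (simp add: power_int_add power_int_mult_distrib)
qed

text \<open>The Gaussian binomial coefficient \<open>2 n\<close> over \<open>n + j\<close>, extended
  by zero so that sums can run over all integers \<open>j\<close>.\<close>

definition jtp_coeff :: "complex \<Rightarrow> nat \<Rightarrow> int \<Rightarrow> complex" where
  "jtp_coeff q n j = (if \<bar>j\<bar> \<le> int n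
     then qpoch q (2 * n) / (qpoch q (nat (int n - j)) * qpoch q (nat (int n + j))) else 0)"

text \<open>Two applications of the q-Pascal rule in one. With \<open>q = a b\<close> it compares
  coefficients when the finite product is multiplied by
  \<open>(1 + a q^n) (1 + b q^n)\<close>.\<close>

lemma jtp_coeff_rec:
  assumes q: "norm q < 1" and j: "\<bar>j\<bar> \<le> int n + 1"
  shows "jtp_coeff q (Suc n) j = (1 + q ^ (2 * n + 1)) * jtp_coeff q n j
    + q powi (int n - j + 1) * jtp_coeff q n (j - 1) + q powi (int n + j + 1) * jtp_coeff q n (j + 1)"
proof -
  \<comment> \<open>\<open>k\<close> and \<open>l\<close> index the denominator of the new
    coefficient and are also the exponents in the recurrence; \<open>k = 0\<close> and
    \<open>l = 0\<close> are the two ends of the range of \<open>j\<close>.\<close>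
  define k where "k = nat (int n + 1 - j)"
  define l where "l = nat (int n + 1 + j)"
  have kl: "int k = int n + 1 - j" "int l = int n + 1 + j" "k + l = 2 * n + 2"
    using j by (auto simp: k_def l_def)
  have nz: "qpoch q m \<noteq> 0" for m using qpoch_nonzero[OF q] .
  have nz1: "1 - q ^ Suc m \<noteq> 0" for m using one_minus_power_nonzero[OF q] .
  have *: "jtp_coeff q (Suc n) j = qpoch q (2 * n) * (1 - q ^ (2 * n + 1)) * (1 - q ^ (2 * n + 2)) / (qpoch q k * qpoch q l)"
    using j by (simp add: jtp_coeff_def k_def l_def qpoch_Suc algebra_simps)
  have e: "q powi (int n - j + 1) = q ^ k" "q powi (int n + j + 1) = q ^ l"
  proof -
    have "int n - j + 1 = int k" "int n + j + 1 = int l" using kl by simp_all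
    then show "q powi (int n - j + 1) = q ^ k" "q powi (int n + j + 1) = q ^ l" by (simp_all only: power_int_of_nat)
  qed
  consider "k = 0" | "l = 0" | k' l' where "k = Suc k'" "l = Suc l'" 
    by (cases k; cases l) auto
  then show ?thesis
  proof cases
    case 1
    then have j': "j = int n + 1" and l: "l = 2 * n + 2" using kl by auto
    have "nat (int n + int n) = 2 * n" by simp
    then have "jtp_coeff q n j = 0" "jtp_coeff q n (j + 1) = 0" "jtp_coeff q n (j - 1) = 1"
      using nz[of "2*n"] nz[of 0] by (simp_all add: jtp_coeff_def j') (simp add: qpoch_def)
    then show ?thesis unfolding e * using 1 l nz[of "2*n"] nz1[of "2*n"] nz1[of "2*n+1"]
      by (simp add: qpoch_Suc) (simp add: qpoch_def)
  next
    case 2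
    then have j': "j = - int n - 1" and l: "k = 2 * n + 2" using kl by auto
    have "nat (int n + int n) = 2 * n" by simp
    then have "jtp_coeff q n j = 0" "jtp_coeff q n (j - 1) = 0" "jtp_coeff q n (j + 1) = 1"
      using nz[of "2*n"] nz[of 0] by (simp_all add: jtp_coeff_def j') (simp add: qpoch_def)
    then show ?thesis unfolding e * using 2 l nz[of "2*n"] nz1[of "2*n"] nz1[of "2*n+1"]
      by (simp add: qpoch_Suc) (simp add: qpoch_def)
  next
    case 3
    have n: "2 * n = k' + l'" using kl 3 by simp
    have a: "jtp_coeff q n j = qpoch q (2*n) / (qpoch q k' * qpoch q l')"
    proof -
      have "nat (int n - j) = k'" "nat (int n + j) = l'" "\<bar>j\<bar> \<le> int n" using kl 3 by auto
      then show ?thesis by (simp add: jtp_coeff_def)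
    qed
    \<comment> \<open>For \<open>l' = 0\<close> the index \<open>j - 1\<close> is
      \<open>- n - 1\<close>, and the zero default of \<open>jtp_coeff\<close> agrees with the
      vanishing factor \<open>1 - q ^ 0\<close>. The case \<open>k' = 0\<close> of the next claim is
      its mirror image.\<close>
    have b: "jtp_coeff q n (j - 1) = qpoch q (2*n) * (1 - q ^ l') / (qpoch q k * qpoch q l')"
    proof (cases l')
      case 0
      then show ?thesis using 3 kl by (simp add: jtp_coeff_def)
    next
      case (Suc l'')
      have "nat (int n - (j - 1)) = k" "nat (int n + (j - 1)) = l''" "\<bar>j - 1\<bar> \<le> int n" using kl 3 Suc by auto
      then show ?thesis using nz1[of l''] by (simp add: jtp_coeff_def Suc qpoch_Suc)
    qed
    have c: "jtp_coeff q n (j + 1) = qpoch q (2*n) * (1 - q ^ k') / (qpoch q k' * qpoch q l)"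
    proof (cases k')
      case 0
      then show ?thesis using 3 kl by (simp add: jtp_coeff_def)
    next
      case (Suc k'')
      have "nat (int n - (j + 1)) = k''" "nat (int n + (j + 1)) = l" "\<bar>j + 1\<bar> \<le> int n" using kl 3 Suc by auto
      then show ?thesis using nz1[of k''] by (simp add: jtp_coeff_def Suc qpoch_Suc)
    qed
    \<comment> \<open>With denominators cleared, the recurrence is this polynomial identity in
      \<open>q\<close>, \<open>q ^ k'\<close> and \<open>q ^ l'\<close>.\<close>
    have "(1 - q ^ (2 * n + 1)) * (1 - q ^ (2 * n + 2)) = (1 + q ^ (2 * n + 1)) * (1 - q ^ k) * (1 - q ^ l)
       + q ^ k * (1 - q ^ l') * (1 - q ^ l) + q ^ l * (1 - q ^ k') * (1 - q ^ k)"
      unfolding n 3 by (simp add: power_add algebra_simps)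
    then have "qpoch q (2 * n) * ((1 - q ^ (2 * n + 1)) * (1 - q ^ (2 * n + 2))) / (qpoch q k * qpoch q l) = 
       qpoch q (2 * n) * ((1 + q ^ (2 * n + 1)) * (1 - q ^ k) * (1 - q ^ l)
       + q ^ k * (1 - q ^ l') * (1 - q ^ l) + q ^ l * (1 - q ^ k') * (1 - q ^ k)) / (qpoch q k * qpoch q l)"
      by simp
    also have "\<dots> = (1 + q ^ (2 * n + 1)) * (qpoch q (2*n) / (qpoch q k' * qpoch q l'))
       + q ^ k * (qpoch q (2*n) * (1 - q ^ l') / (qpoch q k * qpoch q l'))
       + q ^ l * (qpoch q (2*n) * (1 - q ^ k') / (qpoch q k' * qpoch q l))"
    proof -
      have "N * (m * u * v + x * A * v + y * B * u) / (X * u * (Y * v)) =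
          m * (N / (X * Y)) + x * (N * A / (X * u * Y)) + y * (N * B / (X * (Y * v)))"
        if "X \<noteq> 0" "Y \<noteq> 0" "u \<noteq> 0" "v \<noteq> 0" for N m u v x y A B X Y :: complex
        using that by (simp add: field_simps)
      from this[OF nz[of k'] nz[of l'] nz1[of k'] nz1[of l']] show ?thesis unfolding 3 qpoch_Suc by blast
    qed
    finally show ?thesis unfolding e * a b c by (simp add: mult.assoc)
  qed
qed

lemma has_sum_shift_int:
  fixes f :: "int \<Rightarrow> complex"
  shows "((\<lambda>j. f (j + k)) has_sum s) UNIV \<longleftrightarrow> (f has_sum s) UNIV"
  by (rule has_sum_reindex_bij_witness[where i = "\<lambda>j. j - k" and j = "\<lambda>j. j + k"]) auto

text \<open>MacMahon's finite form of the triple product. The induction step multiplies by two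
  factors whose linear terms shift \<open>j\<close> by one in either direction; the shift rule for
  \<open>theta_term\<close> turns the result into the three terms of
  \<open>jtp_coeff_rec\<close>.\<close>

lemma finite_jacobi_triple_product:
  assumes q: "norm (a * b) < 1" and ab: "a \<noteq> 0" "b \<noteq> 0"
  shows "((\<lambda>j. jtp_coeff (a * b) n j * theta_term a b j) has_sum
           (\<Prod>k<n. (1 + a * (a * b) ^ k) * (1 + b * (a * b) ^ k))) UNIV"
proof (induction n)
  case 0
  have "((\<lambda>j. jtp_coeff (a * b) 0 j * theta_term a b j) has_sum
     (\<Sum>j\<in>{0}. jtp_coeff (a * b) 0 j * theta_term a b j)) UNIV"
    by (rule has_sum_finite_neutralI[where B = "{0}"]) (auto simp: jtp_coeff_def)
  then show ?case by (simp add: jtp_coeff_def theta_term_def qpoch_def)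
next
  case (Suc n)
  define Q where "Q = a * b"
  have Q0: "Q \<noteq> 0" using ab by (simp add: Q_def)
  define f where "f = (\<lambda>j. jtp_coeff Q n j * theta_term a b j)"
  define G where "G = (\<Prod>k<n. (1 + a * Q ^ k) * (1 + b * Q ^ k))"
  have f: "(f has_sum G) UNIV" using Suc by (simp add: f_def G_def Q_def)
  have tt: "theta_term a b (j + 1) = theta_term a b j * a * Q powi j" for j
    using theta_term_Suc[OF ab] by (simp add: Q_def)
  have tm: "b * theta_term a b j = Q powi j * theta_term a b (j - 1)" for j
  proof -
    have "theta_term a b j = theta_term a b (j - 1) * a * Q powi (j - 1)" using tt[of "j - 1"] by simp
    then show ?thesis using Q0 ab by (simp add: power_int_diff Q_def field_simps)
  qed
  have 1: "((\<lambda>j. (1 + Q ^ (2 * n + 1)) * f j) has_sum (1 + Q ^ (2 * n + 1)) * G) UNIV"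
    using f by (rule has_sum_cmult_right)
  have "((\<lambda>j. a * Q ^ n * f j) has_sum a * Q ^ n * G) UNIV"
    using f by (rule has_sum_cmult_right)
  then have 2: "((\<lambda>j. a * Q ^ n * f (j - 1)) has_sum a * Q ^ n * G) UNIV"
    using has_sum_shift_int[of "\<lambda>j. a * Q ^ n * f j" "-1"] by simp
  have "((\<lambda>j. b * Q ^ n * f j) has_sum b * Q ^ n * G) UNIV"
    using f by (rule has_sum_cmult_right)
  then have 3: "((\<lambda>j. b * Q ^ n * f (j + 1)) has_sum b * Q ^ n * G) UNIV"
    using has_sum_shift_int[of "\<lambda>j. b * Q ^ n * f j" "1"] by simp
  have "jtp_coeff Q (Suc n) j * theta_term a b j
      = (1 + Q ^ (2 * n + 1)) * f j + a * Q ^ n * f (j - 1) + b * Q ^ n * f (j + 1)" for j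
  proof (cases "\<bar>j\<bar> \<le> int n + 1")
    case True
    have A: "a * Q ^ n * f (j - 1) = Q powi (int n - j + 1) * jtp_coeff Q n (j - 1) * theta_term a b j"
      unfolding f_def using tt[of "j - 1"] Q0 by (simp add: power_int_diff power_int_add field_simps)
    have B: "b * Q ^ n * f (j + 1) = Q powi (int n + j + 1) * jtp_coeff Q n (j + 1) * theta_term a b j"
      unfolding f_def using tm[of "j + 1"] Q0 by (simp add: power_int_add field_simps)
    show ?thesis unfolding A B using jtp_coeff_rec[OF q True] by (simp add: f_def Q_def algebra_simps)
  next
    case False
    then have "\<not> \<bar>j\<bar> \<le> int n" "\<not> \<bar>j - 1\<bar> \<le> int n" "\<not> \<bar>j + 1\<bar> \<le> int n" by linarith+
    with False show ?thesis by (simp add: f_def jtp_coeff_def)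
  qed
  then have "((\<lambda>j. jtp_coeff Q (Suc n) j * theta_term a b j) has_sum
       (1 + Q ^ (2 * n + 1)) * G + a * Q ^ n * G + b * Q ^ n * G) UNIV"
    using has_sum_add[OF has_sum_add[OF 1 2] 3] by simp
  moreover have "(1 + Q ^ (2 * n + 1)) * G + a * Q ^ n * G + b * Q ^ n * G = G * ((1 + a * Q ^ n) * (1 + b * Q ^ n))"
  proof -
    have "(1 + Q ^ (2 * n + 1)) = 1 + (a * Q ^ n) * (b * Q ^ n)" by (simp add: mult_2 power_add Q_def)
    then show ?thesis by (simp only:) (simp add: algebra_simps)
  qed
  ultimately show ?case by (simp add: Q_def G_def)
qed

lemma jtp_coeff_tendsto:
  assumes q: "norm q < 1"
  shows "(\<lambda>n. jtp_coeff q n j) \<longlonglongrightarrow> 1 / euler_E q"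
proof -
  have *: "(\<lambda>n. qpoch q (nat (int n + i))) \<longlonglongrightarrow> euler_E q" for i
  proof -
    have "filterlim (\<lambda>n. nat (int n + i)) at_top at_top"
      unfolding filterlim_at_top
    proof safe
      fix Z :: nat
      show "\<forall>\<^sub>F n in sequentially. Z \<le> nat (int n + i)"
        using eventually_ge_at_top[of "Z + nat (- i)"] by eventually_elim linarith
    qed
    then show ?thesis by (rule filterlim_compose[OF qpoch_tendsto[OF q]])
  qed
  have "filterlim (\<lambda>n::nat. 2 * n) at_top at_top"
    by (intro filterlim_subseq strict_monoI) auto
  from filterlim_compose[OF qpoch_tendsto[OF q] this]
  have "(\<lambda>n. qpoch q (2 * n) / (qpoch q (nat (int n - j)) * qpoch q (nat (int n + j)))) \<longlonglongrightarrow> euler_E q / (euler_E q * euler_E q)"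
    using *[of j] *[of "-j"] euler_E_nonzero[OF q] by (intro tendsto_divide tendsto_mult) auto
  moreover have "\<forall>\<^sub>F n in sequentially. qpoch q (2 * n) / (qpoch q (nat (int n - j)) * qpoch q (nat (int n + j))) = jtp_coeff q n j"
    using eventually_ge_at_top[of "nat \<bar>j\<bar>"] by eventually_elim (auto simp: jtp_coeff_def)
  ultimately show ?thesis using euler_E_nonzero[OF q] by (auto dest: Lim_transform_eventually)
qed

text \<open>\<open>qpoch q n\<close> and its inverse both converge, since \<open>euler_E q\<close>
  is nonzero, and so are bounded. A bound free of \<open>n\<close> and \<open>j\<close> is what
  domination requires.\<close>

lemma jtp_coeff_bounded:
  assumes q: "norm q < 1"
  obtains M where "\<And>n j. norm (jtp_coeff q n j) \<le> M"
proof -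
  have "Bseq (qpoch q)" using qpoch_tendsto[OF q] by (intro convergent_imp_Bseq convergentI)
  then obtain K where K: "\<And>n. norm (qpoch q n) \<le> K" "K > 0" by (auto simp: Bseq_def)
  have "(\<lambda>n. inverse (qpoch q n)) \<longlonglongrightarrow> inverse (euler_E q)"
    using qpoch_tendsto[OF q] euler_E_nonzero[OF q] by (rule tendsto_inverse)
  then have "Bseq (\<lambda>n. inverse (qpoch q n))" by (intro convergent_imp_Bseq convergentI)
  then obtain L where L: "\<And>n. norm (inverse (qpoch q n)) \<le> L" "L > 0" by (auto simp: Bseq_def)
  have "norm (jtp_coeff q n j) \<le> K * (L * L)" for n j
  proof -
    have "norm (qpoch q (2 * n) * (inverse (qpoch q (nat (int n - j))) * inverse (qpoch q (nat (int n + j))))) \<le> K * (L * L)"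
      unfolding norm_mult using K L by (intro mult_mono mult_nonneg_nonneg) (auto intro: less_imp_le)
    then show ?thesis using K L by (auto simp: jtp_coeff_def divide_simps norm_mult norm_divide norm_inverse)
  qed
  then show ?thesis by (rule that)
qed

text \<open>The two exponents add up to \<open>j^2\<close>, which is at least \<open>|j|\<close>, so
  a geometric majorant is enough.\<close>

lemma theta_term_bound:
  assumes "a \<noteq> 0" "norm a < 1" "b \<noteq> 0" "norm b < 1"
  shows "norm (theta_term a b j) \<le> (max (norm a) (norm b)) ^ nat \<bar>j\<bar>"
proof -
  define c where "c = max (norm a) (norm b)"
  have c: "0 < c" "c < 1" "norm a \<le> c" "norm b \<le> c" using assms by (auto simp: c_def less_max_iff_disj)
  have nn: "0 \<le> j * (j + 1) div 2" "0 \<le> j * (j - 1) div 2"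
    by (cases "j \<ge> 0"; cases "j \<ge> 1"; simp add: zero_le_mult_iff)+
  have pow: "norm (x powi k) \<le> c powi k" if "0 \<le> k" "norm x \<le> c" for x :: complex and k
    using that by (metis norm_power_int power_int_mono norm_ge_zero)
  have s: "j * (j + 1) div 2 + j * (j - 1) div 2 = j * j"
  proof -
    have "even (j * (j + 1))" "even (j * (j - 1))" by auto
    then obtain x y where "j * (j + 1) = 2 * x" "j * (j - 1) = 2 * y" by (meson evenE)
    then show ?thesis by (simp add: algebra_simps)
  qed
  have "norm (theta_term a b j) \<le> c powi (j * (j + 1) div 2) * c powi (j * (j - 1) div 2)"
    unfolding theta_term_def norm_mult using nn c by (intro mult_mono pow) auto
  also have "\<dots> = c powi (j * j)" using c by (simp flip: power_int_add add: s)
  also have "\<dots> \<le> c powi \<bar>j\<bar>"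
  proof (rule power_int_decreasing)
    show "\<bar>j\<bar> \<le> j * j"
    proof (cases "j = 0")
      case False
      then have "\<bar>j\<bar> * 1 \<le> \<bar>j\<bar> * \<bar>j\<bar>" by (intro mult_left_mono) auto
      then show ?thesis by simp
    qed simp
  qed (use c in auto)
  finally show ?thesis by (simp add: c_def power_int_def)
qed

text \<open>Every Gaussian coefficient tends to \<open>1 / euler_E (a * b)\<close>. The product side
  is kept as a limit of partial products because its uses regroup the finite products before passing
  to the limit.\<close>

theorem jacobi_triple_product:
  assumes "a \<noteq> 0" "norm a < 1" "b \<noteq> 0" "norm b < 1"
  shows "(\<lambda>n. (\<Prod>k<n. (1 + a * (a * b) ^ k) * (1 + b * (a * b) ^ k))) \<longlonglongrightarrow>
     (\<Sum>\<^sub>\<infinity>j. theta_term a b j) / euler_E (a * b)" and "theta_term a b summable_on UNIV"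
proof -
  have q: "norm (a * b) < 1" using assms mult_strict_mono[of "norm a" 1 "norm b" 1] by (simp add: norm_mult)
  define c where "c = max (norm a) (norm b)"
  have c: "0 \<le> c" "c < 1" using assms by (auto simp: c_def le_max_iff_disj)
  have bnd: "norm (theta_term a b j) \<le> c ^ nat \<bar>j\<bar>" for j
    unfolding c_def by (rule theta_term_bound[OF assms])
  have "(\<lambda>j. norm (theta_term a b j)) summable_on UNIV"
    using geometric_abs_summable_int[OF c] by (rule Infinite_Sum.abs_summable_on_comparison_test') (rule bnd)
  then show s: "theta_term a b summable_on UNIV" by (simp add: summable_on_iff_abs_summable_on_complex)
  obtain M where M: "\<And>n j. norm (jtp_coeff (a * b) n j) \<le> M" using jtp_coeff_bounded[OF q] by blast
  have "(\<lambda>n. (\<Prod>k<n. (1 + a * (a * b) ^ k) * (1 + b * (a * b) ^ k))) \<longlonglongrightarrow>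
     (\<Sum>\<^sub>\<infinity>j. 1 / euler_E (a * b) * theta_term a b j)"
  proof (rule has_sum_dominated_limit[OF finite_jacobi_triple_product[OF q assms(1,3)]])
    show "(\<lambda>n. jtp_coeff (a * b) n i * theta_term a b i) \<longlonglongrightarrow> 1 / euler_E (a * b) * theta_term a b i" for i
      by (intro tendsto_mult jtp_coeff_tendsto q tendsto_const)
    show "norm (jtp_coeff (a * b) n i * theta_term a b i) \<le> M * c ^ nat \<bar>i\<bar>" for n i
      unfolding norm_mult using M bnd order_trans[OF norm_ge_zero M] by (intro mult_mono) auto
    show "(\<lambda>i. M * c ^ nat \<bar>i\<bar>) summable_on UNIV"
      using geometric_abs_summable_int[OF c] by (rule summable_on_cmult_right)
    show "(\<lambda>i. 1 / euler_E (a * b) * theta_term a b i) summable_on UNIV"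
      using s by (rule summable_on_cmult_right)
  qed
  then show "(\<lambda>n. (\<Prod>k<n. (1 + a * (a * b) ^ k) * (1 + b * (a * b) ^ k))) \<longlonglongrightarrow>
     (\<Sum>\<^sub>\<infinity>j. theta_term a b j) / euler_E (a * b)" 
    unfolding infsum_cmult_right' by simp
qed

section \<open>Theta series\<close>

lemma norm_powi_le_geometric:
  fixes q :: complex
  assumes "norm q \<le> c" "0 < c" "c < 1" "0 \<le> e" "d \<le> e + K"
  shows "norm (q powi e) \<le> c powi d * c powi (- K)"
proof -
  have "norm (q powi e) \<le> c powi e"
    using assms by (metis norm_power_int power_int_mono norm_ge_zero)
  also have "\<dots> \<le> c powi (d - K)"
    using assms by (intro power_int_decreasing) auto
  also have "\<dots> = c powi d * c powi (- K)"
    using assms by (simp add: power_int_diff power_int_minus divide_inverse)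
  finally show ?thesis .
qed

lemma theta_summable_1:
  fixes q :: complex
  assumes q: "norm q < 1" and e: "\<And>n. 0 \<le> e n" "\<And>n. \<bar>n\<bar> \<le> e n + K" and s: "\<And>n. norm (s n) \<le> 1"
  shows "(\<lambda>n::int. s n * q powi e n) summable_on UNIV"
proof -
  \<comment> \<open>The maximum with \<open>1/2\<close> keeps the ratio positive at
    \<open>q = 0\<close>; a negative power of it absorbs the slack \<open>K\<close>.\<close>
  define c where "c = max (norm q) (1/2)"
  have c: "norm q \<le> c" "0 < c" "c < 1" "0 \<le> c" using q by (auto simp: c_def)
  have "(\<lambda>n. c ^ nat \<bar>n\<bar> * c powi (- K)) summable_on UNIV"
    using geometric_abs_summable_int[OF c(4,3)] by (rule summable_on_cmult_left)
  then have "(\<lambda>n. norm (s n * q powi e n)) summable_on UNIV"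
  proof (rule Infinite_Sum.abs_summable_on_comparison_test')
    fix n :: int
    have "norm (s n) * norm (q powi e n) \<le> 1 * (c powi \<bar>n\<bar> * c powi (- K))"
      using norm_powi_le_geometric[OF c(1-3) e(1)[of n] e(2)[of n]] s by (intro mult_mono) auto
    then show "norm (s n * q powi e n) \<le> c ^ nat \<bar>n\<bar> * c powi (- K)"
      by (simp add: norm_mult power_int_def)
  qed
  then show ?thesis by (simp add: summable_on_iff_abs_summable_on_complex)
qed

lemma theta_summable_2:
  fixes q :: complex
  assumes q: "norm q < 1" and e: "\<And>x y. 0 \<le> e x y" "\<And>x y. \<bar>x\<bar> + \<bar>y\<bar> \<le> e x y + K"
    and s: "\<And>x y. norm (s x y) \<le> 1"
  shows "(\<lambda>(x::int, y::int). s x y * q powi e x y) summable_on A"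
proof -
  define c where "c = max (norm q) (1/2)"
  have c: "norm q \<le> c" "0 < c" "c < 1" "0 \<le> c" using q by (auto simp: c_def)
  have g: "(\<lambda>n::int. complex_of_real (c ^ nat \<bar>n\<bar>)) summable_on UNIV"
    using geometric_abs_summable_int[OF c(4,3)] by (subst summable_on_iff_abs_summable_on_complex) (simp add: norm_power c)
  have "(\<lambda>(x, y). complex_of_real (c ^ nat \<bar>x\<bar>) * complex_of_real (c ^ nat \<bar>y\<bar>)) summable_on (UNIV \<times> UNIV)"
    by (rule summable_on_Times_mult[OF g g])
  then have "(\<lambda>z. norm ((\<lambda>(x::int, y::int). complex_of_real (c ^ nat \<bar>x\<bar>) * complex_of_real (c ^ nat \<bar>y\<bar>)) z)) summable_on UNIV"
    by (simp add: summable_on_iff_abs_summable_on_complex)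
  then have "(\<lambda>z. norm ((\<lambda>(x::int, y::int). complex_of_real (c ^ nat \<bar>x\<bar>) * complex_of_real (c ^ nat \<bar>y\<bar>)) z) * c powi (- K)) summable_on UNIV"
    by (rule summable_on_cmult_left)
  then have "(\<lambda>z. norm ((\<lambda>(x, y). s x y * q powi e x y) z)) summable_on UNIV"
  proof (rule Infinite_Sum.abs_summable_on_comparison_test', clarify)
    fix x y :: int
    have "norm (s x y) * norm (q powi e x y) \<le> 1 * (c powi (\<bar>x\<bar> + \<bar>y\<bar>) * c powi (- K))"
      using norm_powi_le_geometric[OF c(1-3) e(1)[of x y] e(2)[of x y]] s by (intro mult_mono) auto
    then show "norm (s x y * q powi e x y) \<le> norm (complex_of_real (c ^ nat \<bar>x\<bar>) * complex_of_real (c ^ nat \<bar>y\<bar>)) * c powi (- K)"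
      using c by (simp add: norm_mult norm_power power_int_def nat_add_distrib power_add)
  qed
  then have "(\<lambda>(x, y). s x y * q powi e x y) summable_on UNIV" by (simp add: summable_on_iff_abs_summable_on_complex)
  then show ?thesis by (rule summable_on_subset_banach) auto
qed

text \<open>Collecting the indices with equal exponent turns the series into a power series. The
  level sets of \<open>e\<close> may be infinite, so the existence of each coefficient has to be
  extracted from the summability assumption.\<close>

lemma theta_holomorphic:
  fixes e :: "'i \<Rightarrow> int" and s :: "'i \<Rightarrow> complex"
  assumes e: "\<And>i. 0 \<le> e i"
    and sm: "\<And>q. norm q < 1 \<Longrightarrow> (\<lambda>i. s i * q powi e i) summable_on UNIV"
  shows "(\<lambda>q. \<Sum>\<^sub>\<infinity>i. s i * q powi e i) holomorphic_on ball 0 1"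
proof (rule power_series_holomorphic)
  fix q :: complex
  assume "q \<in> ball 0 1"
  then have q: "norm q < 1" by simp
  define F where "F n = {i. e i = int n}" for n
  define a where "a n = (\<Sum>\<^sub>\<infinity>i\<in>F n. s i)" for n
  have hs: "((\<lambda>i. s i * q powi e i) has_sum (\<Sum>\<^sub>\<infinity>i. s i * q powi e i)) UNIV"
    using sm[OF q] by (rule has_sum_infsum)
  have "((\<lambda>(n, i). s i * q powi e i) has_sum (\<Sum>\<^sub>\<infinity>i. s i * q powi e i)) (Sigma UNIV F)"
    by (rule iffD1[OF has_sum_reindex_bij_witness[where S = UNIV and j = "\<lambda>i. (nat (e i), i)" and i = snd] hs])
      (auto simp: F_def e)
  moreover have "((\<lambda>i. case (n, i) of (n, i) \<Rightarrow> s i * q powi e i) has_sum a n * q ^ n) (F n)" for n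
  proof -
    \<comment> \<open>On a level set \<open>q powi e i\<close> is constant, so summability at the
      nonzero point \<open>1/2\<close> gives summability of \<open>s\<close> itself.\<close>
    have "(\<lambda>i. s i * (1/2) powi e i) summable_on F n"
      using sm[of "1/2"] by (rule summable_on_subset_banach) (auto)
    then have "(\<lambda>i. s i * (1/2) ^ n) summable_on F n"
      by (rule summable_on_cong[THEN iffD1, rotated]) (auto simp: F_def power_int_def)
    then have "(\<lambda>i. s i * (1/2) ^ n * 2 ^ n) summable_on F n" by (rule summable_on_cmult_left)
    then have "s summable_on F n" by (simp add: power_one_over)
    then have "((\<lambda>i. s i * q ^ n) has_sum a n * q ^ n) (F n)"
      unfolding a_def by (intro has_sum_cmult_left has_sum_infsum)
    then show ?thesis
      by (rule has_sum_cong[THEN iffD1, rotated]) (auto simp: F_def power_int_def)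
  qed
  ultimately have "((\<lambda>n. a n * q ^ n) has_sum (\<Sum>\<^sub>\<infinity>i. s i * q powi e i)) UNIV"
    by (rule has_sum_SigmaD) 
  then have "(\<lambda>n. a n * q ^ n) sums (\<Sum>\<^sub>\<infinity>i. s i * q powi e i)"
    by (rule has_sum_imp_sums)
  then show "(\<lambda>n. (\<Sum>\<^sub>\<infinity>i\<in>{i. e i = int n}. s i) * (q - 0) ^ n) sums (\<Sum>\<^sub>\<infinity>i. s i * q powi e i)"
    by (simp add: a_def F_def)
qed

definition phi :: "complex \<Rightarrow> complex" where
  "phi q = (\<Sum>\<^sub>\<infinity>n. q powi n\<^sup>2)"

text \<open>Each triangular number is \<open>n (2 n + 1)\<close> for exactly one integer
  \<open>n\<close>, so this is Ramanujan's sum of \<open>q^(k (k + 1) / 2)\<close> over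
  \<open>k \<ge> 0\<close>, written without halves.\<close>

definition psi :: "complex \<Rightarrow> complex" where
  "psi q = (\<Sum>\<^sub>\<infinity>n. q powi (n * (2 * n + 1)))"

lemma int_abs_le_square: "\<bar>n\<bar> \<le> (n::int)\<^sup>2"
proof (cases "n = 0")
  case False
  then have "\<bar>n\<bar> * 1 \<le> \<bar>n\<bar> * \<bar>n\<bar>" by (intro mult_left_mono) auto
  then show ?thesis by (simp add: power2_eq_square)
qed simp

lemma psi_exponent_bound: "\<bar>n\<bar> \<le> n * (2 * n + 1 :: int)"
  using int_abs_le_square[of n] by (simp add: algebra_simps power2_eq_square)

lemma phi_summable: "norm q < 1 \<Longrightarrow> (\<lambda>n. q powi n\<^sup>2 :: complex) summable_on UNIV"
  using theta_summable_1[of q "\<lambda>n. n\<^sup>2" 0 "\<lambda>_. 1"] int_abs_le_square by simp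

lemma psi_summable: "norm q < 1 \<Longrightarrow> (\<lambda>n. q powi (n * (2 * n + 1)) :: complex) summable_on UNIV"
  using theta_summable_1[of q "\<lambda>n. n * (2 * n + 1)" 0 "\<lambda>_. 1"] psi_exponent_bound order_trans[OF abs_ge_zero psi_exponent_bound] by simp

lemma phi_holomorphic: "phi holomorphic_on ball 0 1"
  using theta_holomorphic[of "\<lambda>n::int. n\<^sup>2" "\<lambda>_. 1"] phi_summable by (simp add: phi_def[abs_def])

lemma psi_holomorphic: "psi holomorphic_on ball 0 1"
  using theta_holomorphic[of "\<lambda>n::int. n * (2 * n + 1)" "\<lambda>_. 1"] psi_summable order_trans[OF abs_ge_zero psi_exponent_bound] by (simp add: psi_def[abs_def])

lemma infsum_single_nonzero:
  assumes "\<And>i. i \<noteq> a \<Longrightarrow> f i = (0::complex)"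
  shows "infsum f UNIV = f a"
proof -
  have "infsum f UNIV = infsum f {a}" using assms by (intro infsum_cong_neutral) auto
  then show ?thesis by simp
qed

lemma phi_0: "phi 0 = 1"
  unfolding phi_def by (subst infsum_single_nonzero[of 0]) auto

lemma psi_0: "psi 0 = 1"
proof -
  have "2 * n + 1 \<noteq> (0::int)" for n by presburger
  then show ?thesis unfolding psi_def by (subst infsum_single_nonzero[of 0]) auto
qed

lemma infsum_split:
  fixes f :: "'a \<Rightarrow> complex"
  assumes "f summable_on UNIV"
  shows "infsum f UNIV = infsum f {x. P x} + infsum f {x. \<not> P x}"
proof -
  have "UNIV = {x. P x} \<union> {x. \<not> P x}" by auto
  then show ?thesis
    using assms by (metis (no_types, lifting) infsum_Un_disjoint summable_on_subset_banach subset_UNIV disjoint_iff mem_Collect_eq)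
qed

lemma infsum_even_odd:
  fixes f :: "int \<Rightarrow> complex"
  assumes "f summable_on UNIV"
  shows "infsum f UNIV = (\<Sum>\<^sub>\<infinity>n. f (2 * n)) + (\<Sum>\<^sub>\<infinity>n. f (2 * n + 1))"
proof -
  have "infsum f {n. even n} = (\<Sum>\<^sub>\<infinity>n. f (2 * n))"
    by (rule infsum_reindex_bij_witness[where j = "\<lambda>n. n div 2" and i = "\<lambda>n. 2 * n"]) auto
  moreover have "infsum f {n. odd n} = (\<Sum>\<^sub>\<infinity>n. f (2 * n + 1))"
    by (rule infsum_reindex_bij_witness[where j = "\<lambda>n. n div 2" and i = "\<lambda>n. 2 * n + 1"]) auto
  ultimately show ?thesis using infsum_split[OF assms, of even] by simp
qed

lemma norm_power_lt_one: "norm (q::complex) < 1 \<Longrightarrow> 0 < n \<Longrightarrow> norm (q ^ n) < 1"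
  by (simp add: norm_power power_less_one_iff)

lemma powi_of_power: "(q ^ k) powi n = (q::complex) powi (int k * n)"
  by (metis power_int_mult power_int_of_nat)

lemma odd_square_summable:
  assumes "norm (q::complex) < 1"
  shows "(\<lambda>n. q powi (2 * n * (n + 1))) summable_on UNIV"
proof -
  have "0 \<le> 2 * n * (n + 1)" "\<bar>n\<bar> \<le> 2 * n * (n + 1) + 2" for n :: int
  proof -
    have "0 \<le> n * (n + 1)" by (cases "n \<ge> 0") (auto intro: mult_nonpos_nonpos)
    then show "0 \<le> 2 * n * (n + 1)" by simp
    show "\<bar>n\<bar> \<le> 2 * n * (n + 1) + 2"
      using int_abs_le_square[of n] int_abs_le_square[of "n + 1"] by (simp add: algebra_simps power2_eq_square)
  qed
  then show ?thesis using theta_summable_1[of q "\<lambda>n. 2 * n * (n + 1)" 2 "\<lambda>_. 1"] assms by simp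
qed

text \<open>The exponent is four times a triangular number and is invariant under
  \<open>n \<mapsto> - n - 1\<close>, so every term of \<open>psi (q ^ 4)\<close> occurs
  twice.\<close>

lemma sum_odd_square: 
  assumes "norm (q::complex) < 1" "q \<noteq> 0"
  shows "(\<Sum>\<^sub>\<infinity>n. q powi (2 * n * (n + 1))) = 2 * psi (q ^ 4)"
proof -
  note sm = odd_square_summable[OF assms(1)]
  have a: "(\<Sum>\<^sub>\<infinity>n. q powi (2 * (2 * n) * (2 * n + 1))) = psi (q ^ 4)"
    unfolding psi_def powi_of_power by (rule infsum_cong) (simp add: algebra_simps)
  have "(\<Sum>\<^sub>\<infinity>n. q powi (2 * (2 * n + 1) * (2 * n + 1 + 1))) = psi (q ^ 4)"
    unfolding psi_def powi_of_power
    by (rule infsum_reindex_bij_witness[where j = "\<lambda>n. - n - 1" and i = "\<lambda>n. - n - 1"]) (auto simp: algebra_simps)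
  with a show ?thesis using infsum_even_odd[OF sm] by simp
qed

lemma phi_dissection:
  assumes "norm q < 1" "q \<noteq> 0"
  shows "phi q = phi (q ^ 4) + 2 * q * psi (q ^ 8)"
proof -
  have "(\<Sum>\<^sub>\<infinity>n. q powi (2 * n)\<^sup>2) = phi (q ^ 4)"
    unfolding phi_def powi_of_power by (rule infsum_cong) (simp add: power_mult_distrib)
  moreover have "(\<Sum>\<^sub>\<infinity>n. q powi (2 * n + 1)\<^sup>2) = q * (\<Sum>\<^sub>\<infinity>n. (q ^ 2) powi (2 * n * (n + 1)))"
    unfolding infsum_cmult_right'[symmetric] powi_of_power
  proof (rule infsum_cong)
    fix n :: int
    have "(2 * n + 1)\<^sup>2 = 1 + int 2 * (2 * n * (n + 1))" by (simp add: power2_eq_square algebra_simps)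
    then show "q powi (2 * n + 1)\<^sup>2 = q * q powi (int 2 * (2 * n * (n + 1)))"
      using assms by (simp only: power_int_add power_int_1_right simp_thms)
  qed
  ultimately show ?thesis
    using infsum_even_odd[OF phi_summable[OF assms(1)]] sum_odd_square[of "q\<^sup>2"] assms norm_power_lt_one[of q 2]
    by (simp add: phi_def flip: power_mult)
qed

section \<open>Quadratic and septic theta identities\<close>

lemma infsum_Times_mult:
  fixes f :: "'a \<Rightarrow> complex" and g :: "'b \<Rightarrow> complex"
  assumes "f summable_on UNIV" "g summable_on UNIV"
  shows "infsum f UNIV * infsum g UNIV = (\<Sum>\<^sub>\<infinity>(x, y). f x * g y)"
    and "(\<lambda>(x, y). f x * g y) summable_on UNIV"
  using has_sum_Times_mult[OF has_sum_infsum[OF assms(1)] has_sum_infsum[OF assms(2)]]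
  by (auto simp: infsumI dest: has_sum_imp_summable)

lemma infsum_parity:
  fixes f :: "int \<times> int \<Rightarrow> complex"
  assumes "f summable_on UNIV"
  shows "infsum f UNIV = (\<Sum>\<^sub>\<infinity>(a, b). f (a + b, a - b)) + (\<Sum>\<^sub>\<infinity>(a, b). f (a + b + 1, a - b))"
proof -
  have "infsum f {(x, y). even (x + y)} = (\<Sum>\<^sub>\<infinity>(a, b). f (a + b, a - b))"
    by (rule sym, rule infsum_reindex_bij_witness[where j = "\<lambda>(a, b). (a + b, a - b)" and i = "\<lambda>(x, y). ((x + y) div 2, (x - y) div 2)"])
      (auto, presburger+)
  moreover have "infsum f {(x, y). odd (x + y)} = (\<Sum>\<^sub>\<infinity>(a, b). f (a + b + 1, a - b))"
    by (rule sym, rule infsum_reindex_bij_witness[where j = "\<lambda>(a, b). (a + b + 1, a - b)" and i = "\<lambda>(x, y). ((x + y - 1) div 2, (x - y - 1) div 2)"])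
      (auto, presburger+)
  ultimately show ?thesis using infsum_split[OF assms, of "\<lambda>(x, y). even (x + y)"] by (simp add: case_prod_unfold)
qed

text \<open>Rotate the square lattice: \<open>(a + b)^2 + (a - b)^2 = 2 a^2 + 2 b^2\<close> on pairs
  of even sum, and \<open>1 + 2 a (a + 1) + 2 b (b + 1)\<close> on the other coset.\<close>

lemma phi_square:
  assumes "norm q < 1" "q \<noteq> 0"
  shows "(phi q)\<^sup>2 = (phi (q\<^sup>2))\<^sup>2 + 4 * q * (psi (q ^ 4))\<^sup>2"
proof -
  note ph = phi_summable[OF assms(1)]
  have q2: "norm (q\<^sup>2) < 1" using norm_power_lt_one[OF assms(1), of 2] by simp
  note os = odd_square_summable[OF assms(1)]
  have "(phi q)\<^sup>2 = (\<Sum>\<^sub>\<infinity>(x, y). q powi x\<^sup>2 * q powi y\<^sup>2)"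
    using infsum_Times_mult(1)[OF ph ph] by (simp add: phi_def power2_eq_square)
  also have "\<dots> = (\<Sum>\<^sub>\<infinity>(a, b). q powi (a + b)\<^sup>2 * q powi (a - b)\<^sup>2)
      + (\<Sum>\<^sub>\<infinity>(a, b). q powi (a + b + 1)\<^sup>2 * q powi (a - b)\<^sup>2)"
    using infsum_parity[OF infsum_Times_mult(2)[OF ph ph]] by simp
  also have "(\<Sum>\<^sub>\<infinity>(a, b). q powi (a + b)\<^sup>2 * q powi (a - b)\<^sup>2) = (\<Sum>\<^sub>\<infinity>(a, b). (q\<^sup>2) powi a\<^sup>2 * (q\<^sup>2) powi b\<^sup>2)"
    unfolding powi_of_power by (rule infsum_cong) (auto simp: assms power2_eq_square algebra_simps simp flip: power_int_add)
  also have "\<dots> = (phi (q\<^sup>2))\<^sup>2"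
    using infsum_Times_mult(1)[OF phi_summable[OF q2] phi_summable[OF q2]] by (simp add: phi_def power2_eq_square)
  also have "(\<Sum>\<^sub>\<infinity>(a, b). q powi (a + b + 1)\<^sup>2 * q powi (a - b)\<^sup>2) = (\<Sum>\<^sub>\<infinity>(a, b). q powi 1 * (q powi (2 * a * (a + 1)) * q powi (2 * b * (b + 1))))"
    by (rule infsum_cong) (auto simp: assms power2_eq_square algebra_simps simp del: power_int_1_right simp flip: power_int_add)
  also have "\<dots> = q * (\<Sum>\<^sub>\<infinity>(a, b). q powi (2 * a * (a + 1)) * q powi (2 * b * (b + 1)))"
    by (simp add: case_prod_unfold infsum_cmult_right')
  also have "\<dots> = q * (2 * psi (q ^ 4))\<^sup>2"
    using infsum_Times_mult(1)[OF os os] sum_odd_square[OF assms] by (simp add: power2_eq_square)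
  finally show ?thesis by (simp add: power2_eq_square)
qed

text \<open>Both sides equal \<open>phi (q^4)^2 - 4 q^2 psi (q^8)^2\<close>: one by dissecting the
  factors, the other by \<open>phi_square\<close> at \<open>- q^2\<close>.\<close>

lemma phi_mult_phi_minus:
  assumes "norm q < 1" "q \<noteq> 0"
  shows "phi q * phi (- q) = (phi (- (q\<^sup>2)))\<^sup>2"
proof -
  have "phi (- q) = phi (q ^ 4) - 2 * q * psi (q ^ 8)" using phi_dissection[of "- q"] assms by simp
  moreover have "(phi (- (q\<^sup>2)))\<^sup>2 = (phi (q ^ 4))\<^sup>2 - 4 * q\<^sup>2 * (psi (q ^ 8))\<^sup>2"
    using phi_square[of "- (q\<^sup>2)"] assms norm_power_lt_one[OF assms(1), of 2] by (simp flip: power_mult)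
  ultimately show ?thesis using phi_dissection[OF assms] by algebra
qed

text \<open>After the sum and difference substitution one variable carries twice the exponent of
  \<open>psi\<close> and the other carries a square, \<open>(2 b)^2\<close> on one coset and
  \<open>(2 b + 1)^2\<close> on the other. Together the cosets supply all squares, that is,
  \<open>phi q\<close>.\<close>

lemma psi_square:
  assumes "norm q < 1" "q \<noteq> 0"
  shows "(psi q)\<^sup>2 = phi q * psi (q\<^sup>2)"
proof -
  have q2: "norm (q\<^sup>2) < 1" using norm_power_lt_one[OF assms(1), of 2] by simp
  note ps = psi_summable[OF assms(1)] and ps2 = psi_summable[OF q2] and ph = phi_summable[OF assms(1)]
  let ?e = "\<lambda>n. n * (2 * n + 1) :: int"
  let ?g = "\<lambda>(k, l). q powi k\<^sup>2 * (q\<^sup>2) powi ?e l"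
  have "(psi q)\<^sup>2 = (\<Sum>\<^sub>\<infinity>(x, y). q powi ?e x * q powi ?e y)"
    using infsum_Times_mult(1)[OF ps ps] by (simp add: psi_def power2_eq_square)
  also have "\<dots> = (\<Sum>\<^sub>\<infinity>(a, b). q powi ?e (a + b) * q powi ?e (a - b))
      + (\<Sum>\<^sub>\<infinity>(a, b). q powi ?e (a + b + 1) * q powi ?e (a - b))"
    using infsum_parity[OF infsum_Times_mult(2)[OF ps ps]] by simp
  also have "(\<Sum>\<^sub>\<infinity>(a, b). q powi ?e (a + b) * q powi ?e (a - b)) = infsum ?g {(k, l). even k}"
    unfolding powi_of_power
    by (rule infsum_reindex_bij_witness[where j = "\<lambda>(a, b). (2 * b, a)" and i = "\<lambda>(k, l). (l, k div 2)"])
       (auto simp: assms power2_eq_square algebra_simps simp flip: power_int_add)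
  also have "(\<Sum>\<^sub>\<infinity>(a, b). q powi ?e (a + b + 1) * q powi ?e (a - b)) = infsum ?g {(k, l). odd k}"
    unfolding powi_of_power
    by (rule infsum_reindex_bij_witness[where j = "\<lambda>(a, b). (2 * b + 1, - a - 1)" and i = "\<lambda>(k, l). (- l - 1, k div 2)"])
       (auto simp: assms power2_eq_square algebra_simps simp flip: power_int_add, presburger?)
  also have "infsum ?g {(k, l). even k} + infsum ?g {(k, l). odd k} = infsum ?g UNIV"
    using infsum_split[OF infsum_Times_mult(2)[OF ph ps2], of "\<lambda>(k, l). even k"] by (simp add: case_prod_unfold)
  also have "\<dots> = phi q * psi (q\<^sup>2)"
    using infsum_Times_mult(1)[OF ph ps2] by (simp add: phi_def psi_def)
  finally show ?thesis .
qed

text \<open>The norm form of the ring of integers of \<open>Q(sqrt (-7))\<close>, in which \<open>2\<close> splits; all three terms of the degree seven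
  identity are combinations of \<open>theta7\<close> at \<open>q\<close>, \<open>q^2\<close> and \<open>q^4\<close>.\<close>

definition theta7 :: "complex \<Rightarrow> complex" where
  "theta7 q = (\<Sum>\<^sub>\<infinity>(x, y). q powi (x\<^sup>2 + x * y + 2 * y\<^sup>2))"

lemma theta7_exponent: "0 \<le> x\<^sup>2 + x * y + 2 * (y::int)\<^sup>2" "\<bar>x\<bar> + \<bar>y\<bar> \<le> x\<^sup>2 + x * y + 2 * y\<^sup>2 + (2::int)"
proof -
  have "4 * (x\<^sup>2 + x * y + 2 * y\<^sup>2) = (2 * x + y)\<^sup>2 + 7 * y\<^sup>2" by (simp add: power2_eq_square algebra_simps)
  then have "0 \<le> 4 * (x\<^sup>2 + x * y + 2 * y\<^sup>2)" by (simp only:) simp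
  then show "0 \<le> x\<^sup>2 + x * y + 2 * y\<^sup>2" by (simp only: zero_le_mult_iff) simp
  have "2 * (x\<^sup>2 + x * y + 2 * y\<^sup>2) = x\<^sup>2 + (x + y)\<^sup>2 + 3 * y\<^sup>2" by (simp add: power2_eq_square algebra_simps)
  moreover have "\<bar>x\<bar> \<le> x\<^sup>2" "\<bar>y\<bar> \<le> y\<^sup>2" "\<bar>x + y\<bar> \<le> (x + y)\<^sup>2" by (rule int_abs_le_square)+
  moreover have "\<bar>x\<bar> \<le> \<bar>x + y\<bar> + \<bar>y\<bar>" by linarith
  ultimately have "2 * (\<bar>x\<bar> + \<bar>y\<bar>) \<le> 2 * (x\<^sup>2 + x * y + 2 * y\<^sup>2 + 2)"
    by (smt (verit))
  then show "\<bar>x\<bar> + \<bar>y\<bar> \<le> x\<^sup>2 + x * y + 2 * y\<^sup>2 + 2" by simp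
qed

lemma theta7_summable: "norm q < 1 \<Longrightarrow> (\<lambda>(x, y). q powi (x\<^sup>2 + x * y + 2 * y\<^sup>2) :: complex) summable_on A"
  using theta_summable_2[of q "\<lambda>x y. x\<^sup>2 + x * y + 2 * y\<^sup>2" 2 "\<lambda>_ _. 1" A] theta7_exponent by simp

text \<open>The value \<open>x (x + y) + 2 y^2\<close> is even iff \<open>x\<close> or
  \<open>x + y\<close> is. These conditions cut out the two primes above 2; both are principal, so
  multiplication by a generator is a similarity that doubles the form. Their intersection is the
  multiples of 2.\<close>

lemma theta7_even_sublattice:
  assumes "norm q < 1" "q \<noteq> 0"
  shows "(\<Sum>\<^sub>\<infinity>(x, y)\<in>{(x, y). even x}. q powi (x\<^sup>2 + x * y + 2 * y\<^sup>2)) = theta7 (q\<^sup>2)"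
    and "(\<Sum>\<^sub>\<infinity>(x, y)\<in>{(x, y). even (x + y)}. q powi (x\<^sup>2 + x * y + 2 * y\<^sup>2)) = theta7 (q\<^sup>2)"
    and "(\<Sum>\<^sub>\<infinity>(x, y)\<in>{(x, y). even x \<and> even y}. q powi (x\<^sup>2 + x * y + 2 * y\<^sup>2)) = theta7 (q ^ 4)"
  unfolding theta7_def powi_of_power
  subgoal by (rule sym, rule infsum_reindex_bij_witness[where j = "\<lambda>(x, y). (2 * y, x)" and i = "\<lambda>(x, y). (y, x div 2)"])
    (auto simp: power2_eq_square algebra_simps)
  subgoal by (rule sym, rule infsum_reindex_bij_witness[where j = "\<lambda>(x, y). (x - y, - x - y)" and i = "\<lambda>(x, y). ((x - y) div 2, (- x - y) div 2)"])
    (auto simp: power2_eq_square algebra_simps, presburger+)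
  subgoal by (rule sym, rule infsum_reindex_bij_witness[where j = "\<lambda>(x, y). (2 * x, 2 * y)" and i = "\<lambda>(x, y). (x div 2, y div 2)"])
    (auto simp: power2_eq_square algebra_simps)
  done

text \<open>\<open>a^2 + 7 b^2\<close> is the norm form on the sublattice \<open>y\<close> even, and
  the sign for \<open>- q\<close> is the parity of \<open>x\<close>. So the two products are the sum
  and the difference of the classes (even, even) and (odd, even), and inclusion-exclusion over the
  even sublattices evaluates both.\<close>

lemma phi_phi7_theta7:
  assumes "norm q < 1" "q \<noteq> 0"
  shows "phi q * phi (q ^ 7) = theta7 q - 2 * theta7 (q\<^sup>2) + 2 * theta7 (q ^ 4)"
    and "phi (- q) * phi (- (q ^ 7)) = 2 * theta7 (q\<^sup>2) - theta7 q"
proof -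
  define F where "F = (\<lambda>(x, y). q powi (x\<^sup>2 + x * y + 2 * y\<^sup>2))"
  have sm: "F summable_on A" for A unfolding F_def by (rule theta7_summable[OF assms(1)])
  have un: "infsum F A + infsum F B = infsum F C" if "A \<inter> B = {}" "A \<union> B = C" for A B C
    using that sm infsum_Un_disjoint by metis
  define OE where "OE = infsum F {(x, y). odd x \<and> even y}"
  have E2: "infsum F {(x, y). even x} = theta7 (q\<^sup>2)" "infsum F {(x, y). even (x + y)} = theta7 (q\<^sup>2)"
      "infsum F {(x, y). even x \<and> even y} = theta7 (q ^ 4)"
    using theta7_even_sublattice[OF assms] by (simp_all add: F_def)
  have 1: "infsum F {(x, y). even x \<and> even y} + infsum F {(x, y). even x \<and> odd y} = infsum F {(x, y). even x}"
    by (rule un) auto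
  have 2: "infsum F {(x, y). even (x + y)} + infsum F {(x, y). odd (x + y)} = infsum F UNIV"
    by (rule un) auto
  have 3: "OE + infsum F {(x, y). even x \<and> odd y} = infsum F {(x, y). odd (x + y)}"
    unfolding OE_def by (rule un) auto
  have U: "infsum F UNIV = theta7 q" by (simp add: F_def theta7_def)
  have OE: "OE = theta7 q - 2 * theta7 (q\<^sup>2) + theta7 (q ^ 4)"
  proof -
    have "x = t - 2 * u + v" if "v + y = u" "u + z = t" "x + y = z" for t u v x y z :: complex
      unfolding that[symmetric] by simp
    from this[OF 1[unfolded E2] 2[unfolded E2 U] 3] show ?thesis .
  qed
  have q7: "norm (q ^ 7) < 1" using norm_power_lt_one[OF assms(1), of 7] by simp
  have "phi q * phi (q ^ 7) = (\<Sum>\<^sub>\<infinity>(a, b). q powi a\<^sup>2 * (q ^ 7) powi b\<^sup>2)"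
    unfolding phi_def by (rule infsum_Times_mult(1)[OF phi_summable[OF assms(1)] phi_summable[OF q7]])
  also have "\<dots> = infsum F {(x, y). even y}"
    unfolding powi_of_power F_def
    by (rule infsum_reindex_bij_witness[where j = "\<lambda>(a, b). (a - b, 2 * b)" and i = "\<lambda>(x, y). (x + y div 2, y div 2)"])
      (auto simp: assms power2_eq_square algebra_simps simp flip: power_int_add)
  also have "\<dots> = infsum F {(x, y). even x \<and> even y} + OE"
    unfolding OE_def by (rule un[symmetric]) auto
  finally show "phi q * phi (q ^ 7) = theta7 q - 2 * theta7 (q\<^sup>2) + 2 * theta7 (q ^ 4)"
    unfolding E2 OE by simp
  define s where "s = (\<lambda>(x::int, y::int). if even x then 1 else - 1 :: complex)"
  have "phi (- q) * phi (- (q ^ 7)) = (\<Sum>\<^sub>\<infinity>(a, b). (- q) powi a\<^sup>2 * (- (q ^ 7)) powi b\<^sup>2)"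
    unfolding phi_def by (rule infsum_Times_mult(1)) (use assms q7 in \<open>auto intro!: phi_summable\<close>)
  also have "\<dots> = (\<Sum>\<^sub>\<infinity>z\<in>{(x, y). even y}. s z * F z)"
    unfolding power_int_minus_left powi_of_power F_def s_def
    by (rule infsum_reindex_bij_witness[where j = "\<lambda>(a, b). (a - b, 2 * b)" and i = "\<lambda>(x, y). (x + y div 2, y div 2)"])
      (auto simp: assms power2_eq_square algebra_simps simp flip: power_int_add)
  also have "\<dots> = (\<Sum>\<^sub>\<infinity>z\<in>{(x, y). even x \<and> even y}. s z * F z) + (\<Sum>\<^sub>\<infinity>z\<in>{(x, y). odd x \<and> even y}. s z * F z)"
  proof -
    have "norm (s z * F z) = norm (F z)" for z by (cases z) (auto simp: s_def norm_mult)
    then have "(\<lambda>z. norm (s z * F z)) summable_on A" for A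
      using sm[of A] by (simp add: summable_on_iff_abs_summable_on_complex)
    then have "(\<lambda>z. s z * F z) summable_on A" for A by (simp add: summable_on_iff_abs_summable_on_complex)
    then show ?thesis by (subst infsum_Un_disjoint[symmetric]) (auto intro!: arg_cong[of _ _ "infsum _"])
  qed
  also have "(\<Sum>\<^sub>\<infinity>z\<in>{(x, y). even x \<and> even y}. s z * F z) = infsum F {(x, y). even x \<and> even y}"
    by (rule infsum_cong) (auto simp: s_def)
  also have "(\<Sum>\<^sub>\<infinity>z\<in>{(x, y). odd x \<and> even y}. s z * F z) = (\<Sum>\<^sub>\<infinity>z\<in>{(x, y). odd x \<and> even y}. - F z)"
    by (rule infsum_cong) (auto simp: s_def)
  also have "\<dots> = - OE" by (simp add: infsum_uminus OE_def)
  finally show "phi (- q) * phi (- (q ^ 7)) = 2 * theta7 (q\<^sup>2) - theta7 q"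
    unfolding E2 OE by simp
qed

text \<open>The exponents of \<open>q psi(q) psi(q^7)\<close> are the norms of the vectors with
  \<open>x + y\<close> congruent to 1 modulo 4. Negation gives the class of 3, and together they are
  the complement of a sublattice that is already evaluated.\<close>

lemma psi_psi7_theta7:
  assumes "norm q < 1" "q \<noteq> 0"
  shows "2 * q * psi q * psi (q ^ 7) = theta7 q - theta7 (q\<^sup>2)"
proof -
  define F where "F = (\<lambda>(x, y). q powi (x\<^sup>2 + x * y + 2 * y\<^sup>2))"
  have sm: "F summable_on A" for A unfolding F_def by (rule theta7_summable[OF assms(1)])
  have un: "infsum F A + infsum F B = infsum F C" if "A \<inter> B = {}" "A \<union> B = C" for A B C
    using that sm infsum_Un_disjoint by metis
  have q7: "norm (q ^ 7) < 1" using norm_power_lt_one[OF assms(1), of 7] by simp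
  have "q * (psi q * psi (q ^ 7)) = q * (\<Sum>\<^sub>\<infinity>(n, m). q powi (n * (2 * n + 1)) * (q ^ 7) powi (m * (2 * m + 1)))"
    unfolding psi_def by (subst infsum_Times_mult(1)[OF psi_summable[OF assms(1)] psi_summable[OF q7]]) simp
  also have "\<dots> = (\<Sum>\<^sub>\<infinity>(n, m). q powi 1 * (q powi (n * (2 * n + 1)) * (q ^ 7) powi (m * (2 * m + 1))))"
    by (simp add: case_prod_unfold infsum_cmult_right')
  also have "\<dots> = infsum F {(x, y). (x + y) mod 4 = 1}"
    unfolding powi_of_power F_def
    by (rule infsum_reindex_bij_witness[where j = "\<lambda>(n, m). (n + 3 * m + 1, m - n)" and i = "\<lambda>(x, y). ((x + y - 1) div 4 - y, (x + y - 1) div 4)"])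
      (auto simp: assms power2_eq_square algebra_simps simp del: power_int_1_right simp flip: power_int_add, presburger+)
  finally have 1: "q * (psi q * psi (q ^ 7)) = infsum F {(x, y). (x + y) mod 4 = 1}" .
  have 2: "infsum F {(x, y). (x + y) mod 4 = 1} = infsum F {(x, y). (x + y) mod 4 = 3}"
    unfolding F_def
    by (rule infsum_reindex_bij_witness[where j = "\<lambda>(x, y). (- x, - y)" and i = "\<lambda>(x, y). (- x, - y)"])
      (auto simp: power2_eq_square algebra_simps, presburger+)
  have 3: "infsum F {(x, y). (x + y) mod 4 = 1} + infsum F {(x, y). (x + y) mod 4 = 3} = infsum F {(x, y). odd (x + y)}"
    by (rule un) (auto, presburger+)
  have 4: "infsum F {(x, y). even (x + y)} + infsum F {(x, y). odd (x + y)} = infsum F UNIV"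
    by (rule un) auto
  have 5: "infsum F {(x, y). even (x + y)} = theta7 (q\<^sup>2)" "infsum F UNIV = theta7 q"
    using theta7_even_sublattice[OF assms] by (simp_all add: F_def theta7_def)
  have "2 * q * x * y = t - u" if "q * (x * y) = a" "a = b" "a + b = c" "u + c = t" for x y a b c t u
    unfolding that(3,4)[symmetric] that(2)[symmetric] that(1)[symmetric] by simp
  from this[OF 1 2 3 4[unfolded 5]] show ?thesis .
qed

text \<open>With \<open>T\<close> for \<open>theta7\<close>, the three products are
  \<open>T(q) - 2 T(q^2) + 2 T(q^4)\<close>, \<open>T(q) - T(q^2)\<close> and
  \<open>2 T(q^4) - T(q^2)\<close>, and the first is the sum of the others.\<close>

lemma degree_seven_identity:
  assumes "norm q < 1" "q \<noteq> 0"
  shows "phi q * phi (q ^ 7) = 2 * q * psi q * psi (q ^ 7) + phi (- (q\<^sup>2)) * phi (- (q ^ 14))"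
proof -
  have "norm (q\<^sup>2) < 1" using norm_power_lt_one[OF assms(1), of 2] by simp
  from phi_phi7_theta7(2)[OF this] phi_phi7_theta7(1)[OF assms] psi_psi7_theta7[OF assms]
  show ?thesis using assms by (simp flip: power_mult)
qed

section \<open>Euler products of theta series\<close>

lemma qpoch_even: "qpoch q (2 * n) = (\<Prod>k<n. 1 - q ^ (2 * k + 1)) * qpoch (q\<^sup>2) n"
proof (induction n)
  case (Suc n)
  have "qpoch q (2 * Suc n) = qpoch q (2 * n) * (1 - q ^ (2 * n + 1)) * (1 - q ^ (2 * n + 2))"
    by (simp add: qpoch_Suc)
  also have "q ^ (2 * n + 2) = (q\<^sup>2) ^ Suc n" by (simp add: power_add power_mult power2_eq_square)
  finally show ?case by (simp add: Suc qpoch_Suc)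
qed (simp add: qpoch_def)

lemma qpoch_triple: "qpoch q (3 * n) = (\<Prod>k<n. (1 - q ^ (3 * k + 1)) * (1 - q ^ (3 * k + 2))) * qpoch (q ^ 3) n"
proof (induction n)
  case (Suc n)
  have "qpoch q (3 * Suc n) = qpoch q (3 * n) * (1 - q ^ (3 * n + 1)) * (1 - q ^ (3 * n + 2)) * (1 - q ^ (3 * n + 3))"
    by (simp add: qpoch_Suc eval_nat_numeral)
  also have "q ^ (3 * n + 3) = (q ^ 3) ^ Suc n" by (simp add: power_mult[symmetric] power_add[symmetric] add.commute)
  finally show ?case by (simp add: Suc qpoch_Suc)
qed (simp add: qpoch_def)

lemma odd_factors_tendsto:
  assumes "norm q < 1"
  shows "(\<lambda>n. \<Prod>k<n. 1 - q ^ (2 * k + 1)) \<longlonglongrightarrow> euler_E q / euler_E (q\<^sup>2)"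
proof -
  have q2: "norm (q\<^sup>2) < 1" using norm_power_lt_one[OF assms, of 2] by simp
  have "filterlim (\<lambda>n::nat. 2 * n) at_top at_top"
    by (intro filterlim_subseq strict_monoI) auto
  from filterlim_compose[OF qpoch_tendsto[OF assms] this]
  have "(\<lambda>n. qpoch q (2 * n) / qpoch (q\<^sup>2) n) \<longlonglongrightarrow> euler_E q / euler_E (q\<^sup>2)"
    using qpoch_tendsto[OF q2] euler_E_nonzero[OF q2] by (intro tendsto_divide) auto
  then show ?thesis using qpoch_nonzero[OF q2] by (simp add: qpoch_even)
qed

lemma pentagonal_exponent: "n * (n + 1) div 2 * 2 + n * (n - 1) div 2 = n * (3 * n + 1) div (2::int)"
proof -
  have "even (n * (n + 1))" "even (n * (n - 1))" by auto
  then obtain x y where "n * (n + 1) = 2 * x" "n * (n - 1) = 2 * y" by (meson evenE)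
  moreover have "n * (3 * n + 1) = 2 * (n * (n + 1)) + n * (n - 1)" by (simp add: algebra_simps)
  ultimately show ?thesis by simp
qed

text \<open>The triple product at \<open>a = - q^2\<close>, \<open>b = - q\<close>: its factors are
  \<open>1 - q^m\<close> for \<open>m\<close> prime to 3, and \<open>euler_E (q ^ 3)\<close>
  supplies the multiples of 3.\<close>

theorem pentagonal_number_theorem:
  assumes "norm q < 1" "q \<noteq> 0"
  shows "(\<Sum>\<^sub>\<infinity>n. (-1) powi n * q powi (n * (3 * n + 1) div 2)) = euler_E q"
    and "(\<lambda>n. (-1) powi n * q powi (n * (3 * n + 1) div 2)) summable_on UNIV"
proof -
  have q2: "norm (q\<^sup>2) < 1" and q3: "norm (q ^ 3) < 1"
    using norm_power_lt_one[OF assms(1), of 2] norm_power_lt_one[OF assms(1), of 3] by simp_all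
  have tt: "theta_term (- (q\<^sup>2)) (- q) n = (-1) powi n * q powi (n * (3 * n + 1) div 2)" for n
  proof -
    have "even (n * (n + 1))" "even (n * (n - 1))" by auto
    then obtain x y where xy: "n * (n + 1) = 2 * x" "n * (n - 1) = 2 * y" by (meson evenE)
    have "x + y = n * n" using xy by (simp add: algebra_simps)
    then have par: "even (x + y) \<longleftrightarrow> even n" by simp
    have "theta_term (- (q\<^sup>2)) (- q) n = (if even (x + y) then 1 else -1) * q powi (x * 2 + y)"
      unfolding theta_term_def xy power_int_minus_left powi_of_power using assms by (auto simp: power_int_add mult.commute)
    also have "x * 2 + y = n * (3 * n + 1) div 2" using pentagonal_exponent[of n] unfolding xy by simp
    finally show ?thesis unfolding par by (simp add: power_int_minus_left)
  qed
  have a: "norm (- (q\<^sup>2)) < 1" "norm (- q) < 1" "- (q\<^sup>2) \<noteq> 0" "- q \<noteq> 0" using q2 assms by auto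
  have prd: "(- (q\<^sup>2)) * (- q) = q ^ 3" by (simp add: eval_nat_numeral)
  note jtp = jacobi_triple_product[OF a(3) a(1) a(4) a(2), unfolded prd tt]
  show "(\<lambda>n. (-1) powi n * q powi (n * (3 * n + 1) div 2)) summable_on UNIV"
    using jtp(2) by (simp add: tt[abs_def])
  have "(\<lambda>n. (\<Prod>k<n. (1 + - (q\<^sup>2) * (q ^ 3) ^ k) * (1 + - q * (q ^ 3) ^ k)) * qpoch (q ^ 3) n) \<longlonglongrightarrow>
     (\<Sum>\<^sub>\<infinity>n. (-1) powi n * q powi (n * (3 * n + 1) div 2)) / euler_E (q ^ 3) * euler_E (q ^ 3)"
    using tendsto_mult[OF jtp(1) qpoch_tendsto[OF q3]] by (simp add: tt)
  moreover have "(\<Prod>k<n. (1 + - (q\<^sup>2) * (q ^ 3) ^ k) * (1 + - q * (q ^ 3) ^ k)) * qpoch (q ^ 3) n = qpoch q (3 * n)" for n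
  proof -
    have e: "q ^ (3 * k + 1) = q * (q ^ 3) ^ k" "q ^ (3 * k + 2) = q\<^sup>2 * (q ^ 3) ^ k" for k
      by (simp_all add: power_add power_mult power2_eq_square)
    show ?thesis unfolding qpoch_triple e by (simp add: mult.commute)
  qed
  ultimately have 1: "(\<lambda>n. qpoch q (3 * n)) \<longlonglongrightarrow> (\<Sum>\<^sub>\<infinity>n. (-1) powi n * q powi (n * (3 * n + 1) div 2))"
    using euler_E_nonzero[OF q3] by simp
  have "filterlim (\<lambda>n::nat. 3 * n) at_top at_top"
    by (intro filterlim_subseq strict_monoI) auto
  from filterlim_compose[OF qpoch_tendsto[OF assms(1)] this] 1
  show "(\<Sum>\<^sub>\<infinity>n. (-1) powi n * q powi (n * (3 * n + 1) div 2)) = euler_E q"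
    using LIMSEQ_unique by blast
qed

text \<open>The triple product at \<open>a = b = - q\<close> yields the odd factors
  \<open>1 - q^(2 k + 1)\<close> twice, and their product is
  \<open>euler_E q / euler_E (q^2)\<close>.\<close>

lemma phi_minus_product:
  assumes "norm q < 1" "q \<noteq> 0"
  shows "phi (- q) * euler_E (q\<^sup>2) = (euler_E q)\<^sup>2"
proof -
  have q2: "norm (q\<^sup>2) < 1" using norm_power_lt_one[OF assms(1), of 2] by simp
  have tt: "theta_term (- q) (- q) n = (- q) powi n\<^sup>2" for n
  proof -
    have "even (n * (n + 1))" "even (n * (n - 1))" by auto
    then obtain x y where xy: "n * (n + 1) = 2 * x" "n * (n - 1) = 2 * y" by (meson evenE)
    have "x + y = n\<^sup>2" using xy by (simp add: algebra_simps power2_eq_square)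
    then show ?thesis unfolding theta_term_def xy using assms by (simp flip: power_int_add)
  qed
  have a: "norm (- q) < 1" "- q \<noteq> 0" using assms by auto
  have "(\<lambda>n. \<Prod>k<n. (1 + - q * (q\<^sup>2) ^ k) * (1 + - q * (q\<^sup>2) ^ k)) \<longlonglongrightarrow> phi (- q) / euler_E (q\<^sup>2)"
    using jacobi_triple_product(1)[OF a(2,1) a(2,1)] unfolding tt phi_def by (simp add: power2_eq_square)
  moreover have "(\<Prod>k<n. (1 + - q * (q\<^sup>2) ^ k) * (1 + - q * (q\<^sup>2) ^ k)) = (\<Prod>k<n. 1 - q ^ (2 * k + 1)) * (\<Prod>k<n. 1 - q ^ (2 * k + 1))" for n
    by (simp add: prod.distrib power_mult)
  ultimately have "(\<lambda>n. (\<Prod>k<n. 1 - q ^ (2 * k + 1)) * (\<Prod>k<n. 1 - q ^ (2 * k + 1))) \<longlonglongrightarrow> phi (- q) / euler_E (q\<^sup>2)"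
    by simp
  from LIMSEQ_unique[OF this tendsto_mult[OF odd_factors_tendsto odd_factors_tendsto, OF assms(1) assms(1)]]
  show ?thesis using euler_E_nonzero[OF q2] by (simp add: field_simps power2_eq_square)
qed

text \<open>At \<open>a = q^3\<close>, \<open>b = q\<close> the factors are \<open>1 + q^m\<close>
  for odd \<open>m\<close>. Multiplying by \<open>1 - q^m\<close> gives the odd factors of
  \<open>q^2\<close>, which are known as a quotient of Euler products.\<close>

lemma psi_product:
  assumes "norm q < 1" "q \<noteq> 0"
  shows "psi q * euler_E q = (euler_E (q\<^sup>2))\<^sup>2"
proof -
  have q2: "norm (q\<^sup>2) < 1" and q4: "norm (q ^ 4) < 1" and q3: "norm (q ^ 3) < 1" 
    using norm_power_lt_one[OF assms(1), of 2] norm_power_lt_one[OF assms(1), of 3] norm_power_lt_one[OF assms(1), of 4] by simp_all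
  have tt: "theta_term (q ^ 3) q n = q powi (n * (2 * n + 1))" for n
  proof -
    have "even (n * (n + 1))" "even (n * (n - 1))" by auto
    then obtain x y where xy: "n * (n + 1) = 2 * x" "n * (n - 1) = 2 * y" by (meson evenE)
    have "3 * x + y = n * (2 * n + 1)" using xy by (simp add: algebra_simps)
    then show ?thesis unfolding theta_term_def xy powi_of_power using assms by (simp flip: power_int_add)
  qed
  have prd: "q ^ 3 * q = q ^ 4" by (simp add: eval_nat_numeral)
  have a: "q ^ 3 \<noteq> 0" using assms by simp
  have 1: "(\<lambda>n. \<Prod>k<n. (1 + q ^ 3 * (q ^ 4) ^ k) * (1 + q * (q ^ 4) ^ k)) \<longlonglongrightarrow> psi q / euler_E (q ^ 4)"
    using jacobi_triple_product(1)[OF a q3 assms(2,1)] unfolding tt psi_def prd by simp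
  \<comment> \<open>Each \<open>k\<close> on the left accounts for the two odd exponents
    \<open>4 k + 1\<close> and \<open>4 k + 3\<close>, hence \<open>n\<close> factors against
    \<open>2 n\<close>.\<close>
  have "(\<Prod>k<n. (1 + q ^ 3 * (q ^ 4) ^ k) * (1 + q * (q ^ 4) ^ k)) * (\<Prod>k<2*n. 1 - q ^ (2 * k + 1)) = (\<Prod>k<2*n. 1 - (q\<^sup>2) ^ (2 * k + 1))" for n
  proof (induction n)
    case (Suc n)
    have step: "(1 + q ^ 3 * (q ^ 4) ^ n) * (1 + q * (q ^ 4) ^ n) * ((1 - q ^ (2 * (2 * n) + 1)) * (1 - q ^ (2 * Suc (2 * n) + 1)))
       = (1 - (q\<^sup>2) ^ (2 * (2 * n) + 1)) * (1 - (q\<^sup>2) ^ (2 * Suc (2 * n) + 1))"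
    proof -
      have e: "q ^ (2 * (2 * n) + 1) = q * (q ^ 4) ^ n" "q ^ (2 * Suc (2 * n) + 1) = q ^ 3 * (q ^ 4) ^ n"
      proof -
        have "2 * (2 * n) + 1 = 4 * n + 1" "2 * Suc (2 * n) + 1 = 4 * n + 3" by simp_all
        then show "q ^ (2 * (2 * n) + 1) = q * (q ^ 4) ^ n" "q ^ (2 * Suc (2 * n) + 1) = q ^ 3 * (q ^ 4) ^ n"
          by (simp_all only: power_add power_mult power_one_right) (simp_all add: mult.commute)
      qed
      have sq: "(q\<^sup>2) ^ m = (q ^ m)\<^sup>2" for m by (simp add: power_mult[symmetric] mult.commute)
      show ?thesis unfolding sq e by (simp add: power2_eq_square algebra_simps)
    qed
    have two: "2 * Suc n = Suc (Suc (2 * n))" by simp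
    have comb: "x * s * (y * c * d) = z * c' * d'" if "s * (c * d) = c' * d'" "x * y = z" for x y z s c d c' d' :: complex
      unfolding that(2)[symmetric] using that(1) by (simp add: mult.assoc mult.left_commute)
    show ?case unfolding two prod.lessThan_Suc by (rule comb[OF step Suc])
  qed simp
  note prodeq = this
  have tw: "filterlim (\<lambda>n::nat. 2 * n) at_top at_top"
    by (intro filterlim_subseq strict_monoI) auto
  note L = filterlim_compose[OF odd_factors_tendsto[OF q2] tw] filterlim_compose[OF odd_factors_tendsto[OF assms(1)] tw]
  have "psi q / euler_E (q ^ 4) * (euler_E q / euler_E (q\<^sup>2)) = euler_E (q\<^sup>2) / euler_E ((q\<^sup>2)\<^sup>2)"
    by (rule LIMSEQ_unique[OF tendsto_mult[OF 1 L(2), unfolded prodeq] L(1)])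
  moreover have "(q\<^sup>2)\<^sup>2 = q ^ 4" by simp
  ultimately show ?thesis using euler_E_nonzero[OF q2] euler_E_nonzero[OF q4] by (simp add: field_simps power2_eq_square)
qed

section \<open>The form (3,2,5)\<close>

lemma infsum_partition3:
  fixes F :: "'a \<Rightarrow> complex"
  assumes "F summable_on UNIV" "A \<union> B \<union> C = UNIV" "A \<inter> B = {}" "(A \<union> B) \<inter> C = {}"
  shows "infsum F UNIV = infsum F A + infsum F B + infsum F C"
proof -
  have "F summable_on X" for X using assms(1) by (rule summable_on_subset_banach) simp
  then show ?thesis using assms by (metis infsum_Un_disjoint)
qed

lemma eight_times_pentagonal: "8 * (i * (3 * i + 1) div 2) = 4 * (i * (3 * i + 1 :: int))"
proof -
  have "even (i * (3 * i + 1))" by auto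
  then show ?thesis by (elim evenE) simp
qed

text \<open>Three times the exponent is \<open>\<alpha> (u + 6 k)^2 + \<beta> u^2\<close> with \<open>u = 2 l + 1\<close>. The terms with \<open>3\<close> dividing \<open>u\<close> cancel under
  \<open>u + 6 k \<mapsto> - (u + 6 k)\<close>; the others are two copies of a product of pentagonal series.\<close>

lemma twisted_theta_summable:
  fixes q :: complex
  assumes "norm q < 1" "0 < \<alpha>" "0 < \<beta>" "\<alpha> + \<beta> = 3 * (\<gamma>::int)"
  shows "(\<lambda>(k, l). (-1) powi k * q powi (\<gamma> * (2 * l + 1)\<^sup>2 + 4 * \<alpha> * k * (2 * l + 1) + 12 * \<alpha> * k\<^sup>2)) summable_on A"
proof -
  define e where "e = (\<lambda>k l. \<gamma> * (2 * l + 1)\<^sup>2 + 4 * \<alpha> * k * (2 * l + 1) + 12 * \<alpha> * k\<^sup>2)"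
  have e3: "3 * e k l = \<alpha> * (2 * l + 1 + 6 * k)\<^sup>2 + \<beta> * (2 * l + 1)\<^sup>2" for k l
  proof -
    have be: "\<beta> = 3 * \<gamma> - \<alpha>" using assms by simp
    show ?thesis unfolding e_def be by (simp add: power2_eq_square algebra_simps)
  qed
  have ge: "(2 * l + 1 + 6 * k)\<^sup>2 + (2 * l + 1)\<^sup>2 \<le> 3 * e k l" for k l
  proof -
    have "1 * (2 * l + 1 + 6 * k)\<^sup>2 \<le> \<alpha> * (2 * l + 1 + 6 * k)\<^sup>2" "1 * (2 * l + 1)\<^sup>2 \<le> \<beta> * (2 * l + 1)\<^sup>2"
      using assms by (intro mult_right_mono; simp)+
    then show ?thesis unfolding e3 by linarith
  qed
  have b1: "0 \<le> e k l" for k l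
    using order_trans[OF _ ge[of l k], of 0] by simp
  have b2: "\<bar>k\<bar> + \<bar>l\<bar> \<le> e k l + 2" for k l
  proof -
    have "\<bar>2 * l + 1 + 6 * k\<bar> \<le> (2 * l + 1 + 6 * k)\<^sup>2" by (rule int_abs_le_square)
    moreover have "2 * \<bar>2 * l + 1\<bar> \<le> (2 * l + 1)\<^sup>2 + 1"
    proof -
      have "0 \<le> (\<bar>2 * l + 1\<bar> - 1)\<^sup>2" by simp
      then show ?thesis by (simp add: power2_eq_square algebra_simps)
    qed
    moreover have "\<bar>k\<bar> + \<bar>l\<bar> \<le> E + 2"
      if "\<bar>2 * l + 1 + 6 * k\<bar> \<le> X" "2 * \<bar>2 * l + 1\<bar> \<le> Y + 1" "X + Y \<le> 3 * E" for X Y E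
    proof -
      have "6 * \<bar>k\<bar> \<le> \<bar>2 * l + 1 + 6 * k\<bar> + \<bar>2 * l + 1\<bar>" "2 * \<bar>l\<bar> \<le> \<bar>2 * l + 1\<bar> + 1" by linarith+
      then show ?thesis using that abs_ge_zero[of "2 * l + 1 + 6 * k"] by linarith
    qed
    ultimately show ?thesis using ge[of l k] by blast
  qed
  show ?thesis
    using theta_summable_2[OF assms(1) b1 b2, of "\<lambda>k l. (-1) powi k" A]
    by (simp add: e_def norm_power_int)
qed

lemma twisted_theta_product:
  fixes q :: complex and \<alpha> \<beta> \<gamma> :: nat
  assumes "norm q < 1" "q \<noteq> 0" "0 < \<alpha>" "0 < \<beta>" "\<alpha> + \<beta> = 3 * \<gamma>"
  shows "(\<Sum>\<^sub>\<infinity>(k, l). (-1) powi k * q powi (int \<gamma> * (2 * l + 1)\<^sup>2 + 4 * int \<alpha> * k * (2 * l + 1) + 12 * int \<alpha> * k\<^sup>2))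
     = 2 * q ^ \<gamma> * euler_E (q ^ (8 * \<alpha>)) * euler_E (q ^ (8 * \<beta>))"
proof -
  define e where "e = (\<lambda>k l. int \<gamma> * (2 * l + 1)\<^sup>2 + 4 * int \<alpha> * k * (2 * l + 1) + 12 * int \<alpha> * k\<^sup>2)"
  define F where "F = (\<lambda>(k, l). (-1) powi k * q powi e k l)"
  have sm: "F summable_on A" for A
    unfolding F_def e_def using assms by (intro twisted_theta_summable[where \<beta> = "int \<beta>"]) auto
  have be: "int \<beta> = 3 * int \<gamma> - int \<alpha>" using assms by simp
  have part: "infsum F UNIV = infsum F {(k, l). l mod 3 = 0} + infsum F {(k, l). l mod 3 = 1} + infsum F {(k, l). l mod 3 = 2}"
  proof (rule infsum_partition3[OF sm])
    have "l mod 3 = 0 \<or> l mod 3 = 1 \<or> l mod 3 = 2" for l :: int by presburger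
    then show "{(k, l). l mod 3 = 0} \<union> {(k, l). l mod 3 = 1} \<union> {(k, l). l mod 3 = 2} = (UNIV :: (int \<times> int) set)" by auto
  qed auto
  have sgn_diff: "(-1) powi (i - j) = (-1) powi i * ((-1) powi j :: complex)" for i j :: int
    by (simp add: power_int_minus_left)
  have p\<alpha>: "norm (q ^ (8 * \<alpha>)) < 1" "q ^ (8 * \<alpha>) \<noteq> 0" and p\<beta>: "norm (q ^ (8 * \<beta>)) < 1" "q ^ (8 * \<beta>) \<noteq> 0"
    using norm_power_lt_one[OF assms(1)] assms by auto
  define G where "G = (\<lambda>(i, j). q powi int \<gamma> * (((-1) powi i * (q ^ (8 * \<alpha>)) powi (i * (3 * i + 1) div 2)) * ((-1) powi j * (q ^ (8 * \<beta>)) powi (j * (3 * j + 1) div 2))))"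
  have G: "infsum G UNIV = q ^ \<gamma> * (euler_E (q ^ (8 * \<alpha>)) * euler_E (q ^ (8 * \<beta>)))"
    using infsum_Times_mult(1)[OF pentagonal_number_theorem(2)[OF p\<alpha>] pentagonal_number_theorem(2)[OF p\<beta>]]
    unfolding pentagonal_number_theorem(1)[OF p\<alpha>] pentagonal_number_theorem(1)[OF p\<beta>]
    by (simp add: G_def case_prod_unfold infsum_cmult_right')
  have Ge: "G (i, j) = (-1) powi i * (-1) powi j * q powi (int \<gamma> + 4 * int \<alpha> * (i * (3 * i + 1)) + 4 * int \<beta> * (j * (3 * j + 1)))" for i j
  proof -
    have "int (8 * \<alpha>) * (i * (3 * i + 1) div 2) = 4 * int \<alpha> * (i * (3 * i + 1))"
      "int (8 * \<beta>) * (j * (3 * j + 1) div 2) = 4 * int \<beta> * (j * (3 * j + 1))"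
      using eight_times_pentagonal[of i] eight_times_pentagonal[of j] by (simp_all add: algebra_simps)
    then show ?thesis unfolding G_def prod.case powi_of_power by (simp only:) (use assms in \<open>simp add: power_int_add\<close>)
  qed
  \<comment> \<open>Here \<open>l = 3 j\<close> and \<open>k = i - j\<close>, so
    \<open>u = 6 j + 1\<close> and \<open>u + 6 k = 6 i + 1\<close>; one third of \<alpha> (6 i +
    1)^2 + \<beta> (6 j + 1)^2 is the exponent of \<open>G\<close>.\<close>
  have 0: "infsum G UNIV = infsum F {(k, l). l mod 3 = 0}"
  proof (rule infsum_reindex_bij_witness[where j = "\<lambda>(i, j). (i - j, 3 * j)" and i = "\<lambda>(k, l). (k + l div 3, l div 3)"], goal_cases)
    case (5 a)
    have "e (i - j) (3 * j) = int \<gamma> + 4 * int \<alpha> * (i * (3 * i + 1)) + 4 * int \<beta> * (j * (3 * j + 1))" for i j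
      unfolding e_def be by (simp add: power2_eq_square algebra_simps)
    then show ?case by (cases a) (simp add: F_def Ge sgn_diff)
  qed auto
  \<comment> \<open>The same with both squares taken at negative arguments:
    \<open>u = - (6 j + 1)\<close> and \<open>u + 6 k = - (6 i + 1)\<close>.\<close>
  have 2: "infsum G UNIV = infsum F {(k, l). l mod 3 = 2}"
  proof (rule infsum_reindex_bij_witness[where j = "\<lambda>(i, j). (j - i, - 3 * j - 1)" and i = "\<lambda>(k, l). (- ((l + 1) div 3) - k, - ((l + 1) div 3))"], goal_cases)
    case (5 a)
    have "e (j - i) (- 3 * j - 1) = int \<gamma> + 4 * int \<alpha> * (i * (3 * i + 1)) + 4 * int \<beta> * (j * (3 * j + 1))" for i j
      unfolding e_def be by (simp add: power2_eq_square algebra_simps)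
    then show ?case by (cases a) (simp add: F_def Ge sgn_diff)
  qed (auto, presburger+)
  \<comment> \<open>Now \<open>u = 2 l + 1\<close> is an odd multiple of 3, and
    \<open>k \<mapsto> - k - u / 3\<close> reverses \<open>u + 6 k\<close>. As \<open>u / 3\<close>
    is odd, the sign changes while the exponent does not, so the sum equals its own
    negative.\<close>
  have "infsum F {(k, l). l mod 3 = 1} = (\<Sum>\<^sub>\<infinity>z\<in>{(k, l). l mod 3 = 1}. - F z)"
  proof (rule infsum_reindex_bij_witness[where j = "\<lambda>(k, l). (- k - (2 * l + 1) div 3, l)" and i = "\<lambda>(k, l). (- k - (2 * l + 1) div 3, l)"], goal_cases)
    case (5 a)
    then obtain k m where a: "a = (k, 3 * m + 1)" by (cases a) (auto, metis mod_div_decomp mult.commute)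
    have d: "(2 * (3 * m + 1) + 1) div 3 = 2 * m + 1" by simp
    have "e (- k - (2 * m + 1)) (3 * m + 1) = e k (3 * m + 1)"
      unfolding e_def by (simp add: power2_eq_square algebra_simps)
    moreover have "(-1) powi (- k - (2 * m + 1)) = - ((-1) powi k :: complex)" by (simp add: power_int_minus_left)
    ultimately show ?case unfolding a F_def prod.case d by (simp only:) simp
  qed auto
  then have 1: "infsum F {(k, l). l mod 3 = 1} = 0" by (simp add: infsum_uminus)
  show ?thesis using part G 1 unfolding 0[symmetric] 2[symmetric] by (simp add: F_def e_def mult.assoc)
qed

definition quad325 :: "int \<Rightarrow> int \<Rightarrow> int" where
  "quad325 n m = 3 * n\<^sup>2 + 2 * n * m + 5 * m\<^sup>2"

lemma form_theta_325: "form_theta 3 2 5 q = (\<Sum>\<^sub>\<infinity>(n, m). q powi quad325 n m)"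
  by (simp add: form_theta_def quad325_def)

lemma quad325_bounds: "0 \<le> quad325 n m" "\<bar>n\<bar> + \<bar>m\<bar> \<le> quad325 n m"
proof -
  have "quad325 n m = (n + m)\<^sup>2 + 2 * n\<^sup>2 + 4 * m\<^sup>2" by (simp add: quad325_def power2_eq_square algebra_simps)
  moreover have "\<bar>n\<bar> \<le> n\<^sup>2" "\<bar>m\<bar> \<le> m\<^sup>2" "0 \<le> (n + m)\<^sup>2" by (simp_all add: int_abs_le_square)
  ultimately show "\<bar>n\<bar> + \<bar>m\<bar> \<le> quad325 n m" by linarith
  then show "0 \<le> quad325 n m" by linarith
qed

lemma quad325_summable:
  fixes q :: complex
  assumes "norm q < 1" "\<And>n m. norm (s n m) \<le> 1"
  shows "(\<lambda>(n, m). s n m * q powi quad325 n m) summable_on A"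
  using theta_summable_2[of q quad325 0 s A] assms quad325_bounds by simp

lemma even_quad325: "even (quad325 n m) \<longleftrightarrow> even (n + m)"
  by (simp add: quad325_def)

definition form_odd :: "complex \<Rightarrow> complex" where
  "form_odd q = (\<Sum>\<^sub>\<infinity>(n, m)\<in>{(n, m). odd (n + m)}. q powi quad325 n m)"

text \<open>In the class group of discriminant -56, cyclic of order four, the ramified prime above 2
  has order two and carries the class of \<open>(3,2,5)\<close> to its inverse, which is the same
  form up to orientation. Hence this similarity of the form onto its vectors of even value.\<close>

lemma quad325_even_sublattice: "quad325 (x - y) (- x - y) = 2 * quad325 x y"
  by (simp add: quad325_def power2_eq_square algebra_simps)

lemma form_theta_325_dissection:
  assumes "norm q < 1"
  shows "form_theta 3 2 5 q = form_theta 3 2 5 (q\<^sup>2) + form_odd q"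
proof -
  have "(\<Sum>\<^sub>\<infinity>(n, m)\<in>{(n, m). even (n + m)}. q powi quad325 n m) = form_theta 3 2 5 (q\<^sup>2)"
    unfolding form_theta_325 powi_of_power
    by (rule sym, rule infsum_reindex_bij_witness[where j = "\<lambda>(x, y). (x - y, - x - y)" and i = "\<lambda>(n, m). ((n - m) div 2, (- n - m) div 2)"])
      (auto simp: quad325_even_sublattice, presburger+)
  moreover have "(\<lambda>(n, m). q powi quad325 n m) summable_on UNIV"
    using quad325_summable[OF assms, of "\<lambda>_ _. 1"] by simp
  ultimately show ?thesis
    using infsum_split[of "\<lambda>(n, m). q powi quad325 n m" "\<lambda>(n, m). even (n + m)"]
    by (simp add: form_theta_325 form_odd_def case_prod_unfold)
qed

text \<open>On the even sublattice \<open>n = x - y\<close> has the parity of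
  \<open>quad325 x y\<close>, so the sign can be absorbed into the base.\<close>

lemma form_theta_325_minus:
  "(\<Sum>\<^sub>\<infinity>(n, m)\<in>{(n, m). even (n + m)}. (-1) powi n * q powi (2 * quad325 n m)) = form_theta 3 2 5 (- (q ^ 4))"
  unfolding form_theta_325 power_int_minus_left powi_of_power
  by (rule sym, rule infsum_reindex_bij_witness[where j = "\<lambda>(x, y). (x - y, - x - y)" and i = "\<lambda>(n, m). ((n - m) div 2, (- n - m) div 2)"])
    (auto simp: quad325_even_sublattice even_quad325, presburger+)

text \<open>\<open>twist5\<close> and \<open>twist3\<close> run over the two cosets on which
  \<open>quad325\<close> is odd, with a sign that makes each a product of pentagonal series. The
  names give the smallest exponent.\<close>

definition twist5 :: "complex \<Rightarrow> complex" where
  "twist5 q = (\<Sum>\<^sub>\<infinity>(k, l). (-1) powi k * q powi quad325 (2 * k) (2 * l + 1))"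

definition twist3 :: "complex \<Rightarrow> complex" where
  "twist3 q = (\<Sum>\<^sub>\<infinity>(k, l). (-1) powi l * q powi quad325 (2 * k + 1) (2 * l))"

lemma twist5_product:
  assumes "norm q < 1" "q \<noteq> 0"
  shows "twist5 q = 2 * q ^ 5 * euler_E (q ^ 8) * euler_E (q ^ 112)"
proof -
  have "quad325 (2 * k) (2 * l + 1) = 5 * (2 * l + 1)\<^sup>2 + 4 * k * (2 * l + 1) + 12 * k\<^sup>2" for k l
    by (simp add: quad325_def power2_eq_square algebra_simps)
  then show ?thesis unfolding twist5_def using twisted_theta_product[OF assms, of 1 14 5] by simp
qed

lemma twist3_product:
  assumes "norm q < 1" "q \<noteq> 0"
  shows "twist3 q = 2 * q ^ 3 * euler_E (q ^ 16) * euler_E (q ^ 56)"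
proof -
  \<comment> \<open>The exponent \<open>3 U^2 + 4 l U + 20 l^2\<close> with
    \<open>U = 2 k + 1\<close> does not yet have the shape \<open>4 \<alpha>\<close>,
    \<open>12 \<alpha>\<close>. The shear \<open>u = U - 4 l\<close> makes it
    \<open>3 u^2 + 28 l u + 84 l^2\<close>, so \<alpha> is 7.\<close>
  have "twist3 q = (\<Sum>\<^sub>\<infinity>(k, l). (-1) powi k * q powi (int 3 * (2 * l + 1)\<^sup>2 + 4 * int 7 * k * (2 * l + 1) + 12 * int 7 * k\<^sup>2))"
    unfolding twist3_def
    by (rule infsum_reindex_bij_witness[where j = "\<lambda>(k, l). (l, k - 2 * l)" and i = "\<lambda>(l, k). (k + 2 * l, l)"])
      (auto simp: quad325_def power2_eq_square algebra_simps)
  then show ?thesis using twisted_theta_product[OF assms, of 7 2 3] by simp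
qed

lemma half_sum_diff:
  assumes "even (s - d)"
  shows "(s + d) div 2 + (s - d) div 2 = s" "(s + d) div 2 - (s - d) div 2 = (d::int)"
  using assms by presburger+

lemma half_sum_diff_odd:
  assumes "odd (s - d)"
  shows "(s + d - 1) div 2 + (s - d - 1) div 2 + 1 = s" "(s + d - 1) div 2 - (s - d - 1) div 2 = (d::int)"
  using assms by presburger+

text \<open>Parallelogram law: substitute \<open>s = (x + y) / 2\<close>, \<open>d = (x - y) / 2\<close> in the double sum over \<open>x\<close>, \<open>y\<close>. Exactly one of
  \<open>s\<close>, \<open>d\<close> lies in the even sublattice.\<close>

lemma twist_squares:
  assumes "norm q < 1" "q \<noteq> 0"
  shows "(twist3 q)\<^sup>2 + (twist5 q)\<^sup>2 = 2 * form_theta 3 2 5 (- (q ^ 4)) * form_odd (q\<^sup>2)"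
proof -
  define Ev where "Ev = {(n::int, m::int). even (n + m)}"
  define Od where "Od = {(n::int, m::int). odd (n + m)}"
  define G where "G = (\<lambda>(v, v'). case v of (n, m) \<Rightarrow> case v' of (n', m') \<Rightarrow>
      ((-1) powi n * q powi (2 * quad325 n m)) * q powi (2 * quad325 n' m'))"
  \<comment> \<open>A pair from \<open>Ev\<close> and \<open>Od\<close> agrees in parity in exactly
    one coordinate. Agreement in the first one marks the half sums and half differences coming from
    \<open>twist5\<close>, agreement in the second those from \<open>twist3\<close>.\<close>
  define M5 where "M5 = {(v, v'). v \<in> Ev \<and> v' \<in> Od \<and> even (fst v - fst v')}"
  define M3 where "M3 = {(v, v'). v \<in> Ev \<and> v' \<in> Od \<and> odd (fst v - fst v')}"
  have q2: "norm (q\<^sup>2) < 1" using norm_power_lt_one[OF assms(1), of 2] by simp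
  have smE: "(\<lambda>(n, m). (-1) powi n * q powi (2 * quad325 n m)) summable_on A" for A
    using quad325_summable[OF q2, of "\<lambda>n m. (-1) powi n" A] by (simp add: powi_of_power norm_power_int)
  have smO: "(\<lambda>(n, m). q powi (2 * quad325 n m)) summable_on A" for A
    using quad325_summable[OF q2, of "\<lambda>n m. 1" A] by (simp add: powi_of_power)
  have G: "(G has_sum form_theta 3 2 5 (- (q ^ 4)) * form_odd (q\<^sup>2)) (Ev \<times> Od)"
  proof -
    have "((\<lambda>(n, m). (-1) powi n * q powi (2 * quad325 n m)) has_sum form_theta 3 2 5 (- (q ^ 4))) Ev"
      unfolding Ev_def form_theta_325_minus[symmetric] by (rule has_sum_infsum[OF smE])
    moreover have "((\<lambda>(n, m). q powi (2 * quad325 n m)) has_sum form_odd (q\<^sup>2)) Od"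
      using has_sum_infsum[OF smO] by (simp add: Od_def form_odd_def powi_of_power)
    ultimately show ?thesis
      using has_sum_Times_mult by (fastforce simp: G_def case_prod_unfold)
  qed
  have M: "infsum G M5 + infsum G M3 = form_theta 3 2 5 (- (q ^ 4)) * form_odd (q\<^sup>2)"
  proof -
    have "M5 \<union> M3 = Ev \<times> Od" "M5 \<inter> M3 = {}" by (auto simp: M5_def M3_def)
    moreover have "G summable_on A" if "A \<subseteq> Ev \<times> Od" for A
      using has_sum_imp_summable[OF G] that by (rule summable_on_subset_banach)
    then have "G summable_on M5" "G summable_on M3" using \<open>M5 \<union> M3 = Ev \<times> Od\<close> by blast+
    ultimately show ?thesis using infsumI[OF G] infsum_Un_disjoint[of G M5 M3] by simp
  qed
  have s1: "(-1) powi (i + j) = (-1) powi i * ((-1) powi j :: complex)" "(-1) powi (i - j) = (-1) powi i * ((-1) powi j :: complex)" for i j :: int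
    by (simp_all add: power_int_minus_left)
  have par: "2 * quad325 (k + k') (l + l' + 1) + 2 * quad325 (k - k') (l - l') = quad325 (2 * k) (2 * l + 1) + quad325 (2 * k') (2 * l' + 1)"
     "2 * quad325 (k + k' + 1) (l + l') + 2 * quad325 (k - k') (l - l') = quad325 (2 * k + 1) (2 * l) + quad325 (2 * k' + 1) (2 * l')" for k k' l l'
    by (simp_all add: quad325_def power2_eq_square algebra_simps)
  define F5 where "F5 = (\<lambda>((k, l), (k', l')). ((-1) powi k * q powi quad325 (2 * k) (2 * l + 1)) * ((-1) powi k' * q powi quad325 (2 * k') (2 * l' + 1)))"
  define F3 where "F3 = (\<lambda>((k, l), (k', l')). ((-1) powi l * q powi quad325 (2 * k + 1) (2 * l)) * ((-1) powi l' * q powi quad325 (2 * k' + 1) (2 * l')))"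
  have pa: "q powi x * q powi y = q powi (x + y)" for x y using assms by (simp add: power_int_add)
  have reorder: "(x * u) * (y * v) = (x * y) * (u * v)" for x y u v :: complex by simp
  have F5e: "F5 ((k, l), (k', l')) = (-1) powi (k + k') * (q powi (2 * quad325 (k + k') (l + l' + 1)) * q powi (2 * quad325 (k - k') (l - l')))" for k l k' l'
    unfolding F5_def prod.case reorder pa par(1) s1 ..
  have F3e: "F3 ((k, l), (k', l')) = (-1) powi (l + l') * (q powi (2 * quad325 (k + k' + 1) (l + l')) * q powi (2 * quad325 (k - k') (l - l')))" for k l k' l'
    unfolding F3_def prod.case reorder pa par(2) s1 ..
  have sm5: "(\<lambda>(k, l). (-1) powi k * q powi quad325 (2 * k) (2 * l + 1)) summable_on UNIV"
  proof -
    have "\<bar>k\<bar> + \<bar>l\<bar> \<le> quad325 (2 * k) (2 * l + 1) + 1" for k l using quad325_bounds(2)[of "2 * k" "2 * l + 1"] by linarith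
    then show ?thesis
      using theta_summable_2[OF assms(1), of "\<lambda>k l. quad325 (2 * k) (2 * l + 1)" 1 "\<lambda>k l. (-1) powi k"] quad325_bounds(1) by (simp add: norm_power_int)
  qed
  have sm3: "(\<lambda>(k, l). (-1) powi l * q powi quad325 (2 * k + 1) (2 * l)) summable_on UNIV"
  proof -
    have "\<bar>k\<bar> + \<bar>l\<bar> \<le> quad325 (2 * k + 1) (2 * l) + 1" for k l using quad325_bounds(2)[of "2 * k + 1" "2 * l"] by linarith
    then show ?thesis
      using theta_summable_2[OF assms(1), of "\<lambda>k l. quad325 (2 * k + 1) (2 * l)" 1 "\<lambda>k l. (-1) powi l"] quad325_bounds(1) by (simp add: norm_power_int)
  qed
  have T5: "(twist5 q)\<^sup>2 = infsum F5 UNIV" "F5 summable_on UNIV"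
    using infsum_Times_mult[OF sm5 sm5] by (simp_all add: twist5_def F5_def power2_eq_square case_prod_unfold)
  have T3: "(twist3 q)\<^sup>2 = infsum F3 UNIV" "F3 summable_on UNIV"
    using infsum_Times_mult[OF sm3 sm3] by (simp_all add: twist3_def F3_def power2_eq_square case_prod_unfold)
  define H where "H = (\<lambda>(s, d). case s of (n, m) \<Rightarrow> case d of (n', m') \<Rightarrow>
      (-1) powi n * (q powi (2 * quad325 n m) * q powi (2 * quad325 n' m')))"
  define H' where "H' = (\<lambda>(s, d). case s of (n, m) \<Rightarrow> case d of (n', m') \<Rightarrow>
      (-1) powi m * (q powi (2 * quad325 n m) * q powi (2 * quad325 n' m')))"
  define W5 where "W5 = {((n::int, m::int), (n'::int, m'::int)). even (n - n') \<and> odd (m - m')}"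
  define W3 where "W3 = {((n::int, m::int), (n'::int, m'::int)). odd (n - n') \<and> even (m - m')}"
  have W5: "infsum F5 UNIV = infsum H W5"
    by (rule infsum_reindex_bij_witness[where j = "\<lambda>((k, l), (k', l')). ((k + k', l + l' + 1), (k - k', l - l'))"
        and i = "\<lambda>((s, s'), (d, d')). (((s + d) div 2, (s' + d' - 1) div 2), ((s - d) div 2, (s' - d' - 1) div 2))"])
      (auto simp: F5e H_def W5_def half_sum_diff half_sum_diff_odd)
  have W3: "infsum F3 UNIV = infsum H' W3"
    by (rule infsum_reindex_bij_witness[where j = "\<lambda>((k, l), (k', l')). ((k + k' + 1, l + l'), (k - k', l - l'))"
        and i = "\<lambda>((s, s'), (d, d')). (((s + d - 1) div 2, (s' + d') div 2), ((s - d - 1) div 2, (s' - d') div 2))"])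
      (auto simp: F3e H'_def W3_def half_sum_diff half_sum_diff_odd)
  \<comment> \<open>The exponent is symmetric in \<open>s\<close> and \<open>d\<close>, and the sign
    is read off a coordinate in which they have equal parity. Exchanging them therefore identifies
    the part with \<open>s\<close> outside \<open>Ev\<close> with the part inside, which explains
    the factor 2.\<close>
  have "infsum F A = 2 * infsum G N"
    if F: "F summable_on A" and sub: "A \<inter> {(s, d). s \<in> Ev} = N" "A \<inter> {(s, d). s \<notin> Ev} = prod.swap ` N"
      and eq: "\<And>z. z \<in> N \<Longrightarrow> F z = G z" "\<And>z. z \<in> N \<Longrightarrow> F (prod.swap z) = G z"
    for F :: "(int \<times> int) \<times> (int \<times> int) \<Rightarrow> complex" and A N
  proof -
    have "infsum F A = infsum F (A \<inter> {(s, d). s \<in> Ev}) + infsum F (A \<inter> {(s, d). s \<notin> Ev})"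
    proof -
      have "A = (A \<inter> {(s, d). s \<in> Ev}) \<union> (A \<inter> {(s, d). s \<notin> Ev})" by auto
      moreover have "F summable_on B" if "B \<subseteq> A" for B using F that by (rule summable_on_subset_banach)
      ultimately show ?thesis
        by (subst infsum_Un_disjoint[symmetric]) auto
    qed
    also have "infsum F (A \<inter> {(s, d). s \<in> Ev}) = infsum G N"
      unfolding sub by (rule infsum_cong) (rule eq(1))
    also have "infsum F (A \<inter> {(s, d). s \<notin> Ev}) = infsum G N"
    proof -
      have "infsum F (prod.swap ` N) = infsum (F \<circ> prod.swap) N" by (rule infsum_reindex) (auto simp: inj_on_def)
      also have "\<dots> = infsum G N" by (rule infsum_cong) (simp only: comp_apply eq(2))
      finally show ?thesis unfolding sub .
    qed
    finally show ?thesis by simp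
  qed
  note double = this
  have sm: "H summable_on UNIV" "H' summable_on UNIV"
  proof -
    have smE': "(\<lambda>(n, m). (-1) powi m * q powi (2 * quad325 n m)) summable_on UNIV"
      using quad325_summable[OF q2, of "\<lambda>n m. (-1) powi m"] by (simp add: powi_of_power norm_power_int)
    show "H summable_on UNIV" "H' summable_on UNIV"
      using infsum_Times_mult(2)[OF smE smO] infsum_Times_mult(2)[OF smE' smO]
      by (simp_all add: H_def H'_def case_prod_unfold mult.assoc)
  qed
  have "infsum H W5 = 2 * infsum G M5"
  proof (rule double)
    show "H summable_on W5" using sm(1) by (rule summable_on_subset_banach) simp
    show "W5 \<inter> {(s, d). s \<in> Ev} = M5" by (auto simp: W5_def Ev_def Od_def M5_def)
    show "W5 \<inter> {(s, d). s \<notin> Ev} = prod.swap ` M5" by (force simp: W5_def Ev_def Od_def M5_def image_iff)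
    show "H z = G z" for z by (simp add: H_def G_def case_prod_unfold mult.assoc)
    show "H (prod.swap z) = G z" if "z \<in> M5" for z
      using that by (auto simp: H_def G_def M5_def power_int_minus_left split: if_splits)
  qed
  then have "(twist5 q)\<^sup>2 = 2 * infsum G M5" using T5 W5 by simp
  moreover have "infsum H' W3 = 2 * infsum G M3"
  proof (rule double)
    show "H' summable_on W3" using sm(2) by (rule summable_on_subset_banach) simp
    show "W3 \<inter> {(s, d). s \<in> Ev} = M3" by (auto simp: W3_def Ev_def Od_def M3_def)
    show "W3 \<inter> {(s, d). s \<notin> Ev} = prod.swap ` M3" by (force simp: W3_def Ev_def Od_def M3_def image_iff)
    show "H' z = G z" if "z \<in> M3" for z
      using that by (auto simp: H'_def G_def M3_def Ev_def power_int_minus_left split: if_splits)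
    show "H' (prod.swap z) = G z" if "z \<in> M3" for z
      using that by (auto simp: H'_def G_def M3_def Ev_def Od_def power_int_minus_left split: if_splits)
  qed
  then have "(twist3 q)\<^sup>2 = 2 * infsum G M3" using T3 W3 by simp
  ultimately show ?thesis using M[symmetric] by (simp add: mult.assoc)
qed

section \<open>Parametrisation near the origin\<close>

lemma recursion_325:
  assumes "norm q < 1" "q \<noteq> 0"
  shows "form_theta 3 2 5 (- (q\<^sup>2)) * (form_theta 3 2 5 q - form_theta 3 2 5 (q\<^sup>2))
     = 2 * q ^ 3 * ((euler_E (q ^ 8))\<^sup>2 * (euler_E (q ^ 28))\<^sup>2 + q\<^sup>2 * (euler_E (q ^ 4))\<^sup>2 * (euler_E (q ^ 56))\<^sup>2)"
proof -
  \<comment> \<open>The identity for the twists lives at a square root of \<open>q\<close>: there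
    the prefactors \<open>x^3\<close> and \<open>x^5\<close> get squared and everything else is a
    power of \<open>x^2\<close>.\<close>
  define x where "x = csqrt q"
  have x: "q = x\<^sup>2" "x \<noteq> 0" using assms by (simp_all add: x_def)
  have "(norm x)\<^sup>2 < 1" using assms(1) unfolding x(1) by (simp add: norm_power)
  then have x1: "norm x < 1" using power2_less_imp_less[of "norm x" 1] by simp
  have "2 * form_theta 3 2 5 (- (x ^ 4)) * form_odd (x\<^sup>2)
      = (2 * x ^ 3 * euler_E (x ^ 16) * euler_E (x ^ 56))\<^sup>2 + (2 * x ^ 5 * euler_E (x ^ 8) * euler_E (x ^ 112))\<^sup>2"
    using twist_squares[OF x1 x(2)] twist3_product[OF x1 x(2)] twist5_product[OF x1 x(2)] by simp
  moreover have "form_odd q = form_theta 3 2 5 q - form_theta 3 2 5 (q\<^sup>2)"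
    using form_theta_325_dissection[OF assms(1)] by simp
  ultimately have "2 * (form_theta 3 2 5 (- (q\<^sup>2)) * (form_theta 3 2 5 q - form_theta 3 2 5 (q\<^sup>2)))
     = 2 * (2 * q ^ 3 * ((euler_E (q ^ 8))\<^sup>2 * (euler_E (q ^ 28))\<^sup>2 + q\<^sup>2 * (euler_E (q ^ 4))\<^sup>2 * (euler_E (q ^ 56))\<^sup>2))"
    unfolding x(1) by (simp add: power_mult_distrib algebra_simps flip: power_mult power_add)
  then show ?thesis by simp
qed

text \<open>In terms of the moduli \<open>\<alpha>\<close>, \<open>\<beta>\<close> of \<open>q^2\<close> and \<open>q^14\<close>, \<open>th_t\<close> is \<open>(\<alpha> \<beta>) powr (1/8)\<close>, \<open>th_a\<close> and \<open>th_b\<close> are the square roots of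
  \<open>\<alpha>\<close> and \<open>\<beta>\<close>, and \<open>th_s\<close> is the branch of \<open>sqrt (1 - th_r^2)\<close> that tends to \<open>1\<close>.\<close>

definition th_w :: "complex \<Rightarrow> complex" where
  "th_w q = phi (q\<^sup>2) * phi (q ^ 14)"

definition th_t :: "complex \<Rightarrow> complex" where
  "th_t q = 2 * q\<^sup>2 * psi (q\<^sup>2) * psi (q ^ 14) / th_w q"

text \<open>The odd part of \<open>phi(q) phi(q^7)\<close>, normalised by \<open>th_w\<close>. It is
  the second coordinate of the genus one curve over the \<open>t\<close>-line.\<close>

definition th_r :: "complex \<Rightarrow> complex" where
  "th_r q = (phi q * phi (q ^ 7) - phi (- q) * phi (- (q ^ 7))) / (2 * th_w q)"

definition th_s :: "complex \<Rightarrow> complex" where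
  "th_s q = 2 * th_w (q\<^sup>2) / th_w q - (1 - th_t q + (th_t q)\<^sup>2)"

definition th_a :: "complex \<Rightarrow> complex" where
  "th_a q = 4 * q * (psi (q ^ 4))\<^sup>2 * (phi (q ^ 14))\<^sup>2 / (th_w q)\<^sup>2"

definition th_b :: "complex \<Rightarrow> complex" where
  "th_b q = 4 * q ^ 7 * (psi (q ^ 28))\<^sup>2 * (phi (q\<^sup>2))\<^sup>2 / (th_w q)\<^sup>2"

definition th_A :: "complex \<Rightarrow> complex" where
  "th_A q = phi q * phi (q ^ 14)"

definition th_B :: "complex \<Rightarrow> complex" where
  "th_B q = phi (q\<^sup>2) * phi (q ^ 7)"

text \<open>The series of \<open>(1,0,14)\<close> minus that of \<open>(2,0,7)\<close>. Its square
  is a polynomial in \<open>t\<close> and \<open>r\<close> times \<open>w^2\<close>, so it is one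
  further square root over the curve.\<close>

definition th_D :: "complex \<Rightarrow> complex" where
  "th_D q = th_A q - th_B q"

section \<open>Leading terms at the origin\<close>

lemma isCont_phi_0: "isCont phi 0" and isCont_psi_0: "isCont psi 0"
  using phi_holomorphic psi_holomorphic
  by (auto intro!: continuous_on_interior[where S = "ball 0 1"] holomorphic_on_imp_continuous_on)

lemma tendsto_phi:
  assumes "(f \<longlongrightarrow> 0) F" shows "((\<lambda>x. phi (f x)) \<longlongrightarrow> 1) F"
  using isCont_tendsto_compose[OF isCont_phi_0 assms] by (simp add: phi_0)

lemma tendsto_psi:
  assumes "(f \<longlongrightarrow> 0) F" shows "((\<lambda>x. psi (f x)) \<longlongrightarrow> 1) F"
  using isCont_tendsto_compose[OF isCont_psi_0 assms] by (simp add: psi_0)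

lemma tendsto_power_0: "0 < n \<Longrightarrow> ((\<lambda>q::complex. q ^ n) \<longlongrightarrow> 0) (at 0)"
  using tendsto_power[OF tendsto_ident_at[of "0::complex" UNIV], of n] by (simp add: zero_power)

lemma eventually_punctured_unit_disc: "\<forall>\<^sub>F q in at (0::complex). q \<noteq> 0 \<and> norm q < 1"
  by (auto simp: eventually_at intro!: exI[of _ 1])

lemma filterlim_power_at_0: "0 < n \<Longrightarrow> filterlim (\<lambda>q::complex. q ^ n) (at 0) (at 0)"
  using tendsto_power_0[of n] eventually_mono[OF eventually_punctured_unit_disc, of "\<lambda>q. q ^ n \<noteq> 0"]
  by (auto simp: filterlim_at)

lemma filterlim_minus_at_0: "filterlim (\<lambda>q::complex. - q) (at 0) (at 0)"
  using tendsto_minus[OF tendsto_ident_at[of 0 UNIV]] eventually_mono[OF eventually_punctured_unit_disc, of "\<lambda>q. - q \<noteq> 0"]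
  by (auto simp: filterlim_at)

lemmas th_tendsto = tendsto_phi tendsto_psi tendsto_power_0 tendsto_minus[of _ 0, simplified]

lemma eventually_at_0_power:
  assumes "\<forall>\<^sub>F q in at (0::complex). P q" "0 < n"
  shows "\<forall>\<^sub>F q in at 0. P (q ^ n)"
  using filterlim_power_at_0[OF assms(2)] assms(1) by (simp add: filterlim_iff)

lemma eventually_at_0_minus:
  assumes "\<forall>\<^sub>F q in at (0::complex). P q"
  shows "\<forall>\<^sub>F q in at 0. P (- q)"
  using filterlim_minus_at_0 assms by (simp add: filterlim_iff)

lemma th_w_tendsto: "(th_w \<longlongrightarrow> 1) (at 0)"
  unfolding th_w_def[abs_def] by (auto intro!: tendsto_eq_intros th_tendsto)

lemma th_t_tendsto: "((\<lambda>q. th_t q / q\<^sup>2) \<longlongrightarrow> 2) (at 0)"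
proof -
  have "((\<lambda>q. 2 * psi (q\<^sup>2) * psi (q ^ 14) / th_w q) \<longlongrightarrow> 2) (at 0)"
    by (auto intro!: tendsto_eq_intros th_tendsto th_w_tendsto)
  moreover have "\<forall>\<^sub>F q in at 0. 2 * psi (q\<^sup>2) * psi (q ^ 14) / th_w q = th_t q / q\<^sup>2"
    using eventually_neq_at_within[of 0 0 UNIV] by eventually_elim (simp add: th_t_def)
  ultimately show ?thesis by (rule Lim_transform_eventually)
qed

lemma th_r_tendsto: "((\<lambda>q. th_r q / q) \<longlongrightarrow> 2) (at 0)"
proof -
  have "((\<lambda>q. (2 * psi (q ^ 8) * phi (q ^ 28) + 2 * q ^ 6 * phi (q ^ 4) * psi (q ^ 56)) / th_w q) \<longlongrightarrow> 2) (at 0)"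
    by (auto intro!: tendsto_eq_intros th_tendsto th_w_tendsto)
  moreover have "\<forall>\<^sub>F q in at 0. (2 * psi (q ^ 8) * phi (q ^ 28) + 2 * q ^ 6 * phi (q ^ 4) * psi (q ^ 56)) / th_w q = th_r q / q"
    using eventually_punctured_unit_disc
  proof eventually_elim
    case (elim q)
    then have q: "norm q < 1" "q \<noteq> 0" by auto
    have q7: "norm (q ^ 7) < 1" using norm_power_lt_one[OF q(1), of 7] by simp
    have 1: "phi q = phi (q ^ 4) + 2 * q * psi (q ^ 8)" "phi (- q) = phi (q ^ 4) - 2 * q * psi (q ^ 8)"
      using phi_dissection[of q] phi_dissection[of "- q"] q by auto
    have 2: "phi (q ^ 7) = phi (q ^ 28) + 2 * q ^ 7 * psi (q ^ 56)" "phi (- (q ^ 7)) = phi (q ^ 28) - 2 * q ^ 7 * psi (q ^ 56)"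
      using phi_dissection[of "q ^ 7"] phi_dissection[of "- (q ^ 7)"] q q7 by (auto simp flip: power_mult)
    have "phi q * phi (q ^ 7) - phi (- q) * phi (- (q ^ 7)) = 2 * q * (2 * psi (q ^ 8) * phi (q ^ 28) + 2 * q ^ 6 * phi (q ^ 4) * psi (q ^ 56))"
      unfolding 1 2 by (simp add: algebra_simps eval_nat_numeral)
    then show ?case using q by (simp add: th_r_def)
  qed
  ultimately show ?thesis by (rule Lim_transform_eventually)
qed

lemma tendsto_0_if_quotient:
  fixes f g :: "complex \<Rightarrow> complex"
  assumes "((\<lambda>q. f q / q ^ n) \<longlongrightarrow> l) (at 0)" "m < n"
  shows "((\<lambda>q. f q / q ^ m) \<longlongrightarrow> 0) (at 0)"
proof -
  have "((\<lambda>q. f q / q ^ n * q ^ (n - m)) \<longlongrightarrow> l * 0) (at 0)"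
    using assms by (intro tendsto_mult tendsto_power_0) auto
  moreover have "\<forall>\<^sub>F q in at 0. f q / q ^ n * q ^ (n - m) = f q / q ^ m"
    using eventually_neq_at_within[of 0 0 UNIV] by eventually_elim (use assms(2) in \<open>simp add: power_diff\<close>)
  ultimately show ?thesis by (auto dest: Lim_transform_eventually)
qed

lemma th_D_tendsto: "((\<lambda>q. th_D q / q) \<longlongrightarrow> 2) (at 0)"
proof -
  \<comment> \<open>Only \<open>phi q\<close> contributes to the linear term of \<open>th_D\<close>;
    every other factor is \<open>phi\<close> at a higher power and differs from 1 by
    \<open>o(q)\<close>.\<close>
  have d: "((\<lambda>q. (phi (q ^ n) - 1) / q) \<longlongrightarrow> 0) (at 0)" if "1 < n" for n
  proof -
    obtain c where "(phi has_field_derivative c) (at 0)"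
      using phi_holomorphic by (metis open_ball centre_in_ball zero_less_one holomorphic_on_open)
    then have "((\<lambda>x. (phi x - 1) / x) \<longlongrightarrow> c) (at 0)"
      by (simp add: has_field_derivative_iff phi_0)
    moreover have "filterlim (\<lambda>q::complex. q ^ n) (at 0) (at 0)"
      using that by (intro filterlim_power_at_0) simp
    ultimately have "((\<lambda>q. (phi (q ^ n) - 1) / q ^ n) \<longlongrightarrow> c) (at 0)"
      by (rule filterlim_compose)
    from tendsto_0_if_quotient[OF this that] show ?thesis by simp
  qed
  have "((\<lambda>q. 2 * psi (q ^ 8) * phi (q ^ 14) + (phi (q ^ 4) - 1) / q * phi (q ^ 14) + (phi (q ^ 14) - 1) / q
       - (phi (q\<^sup>2) - 1) / q * phi (q ^ 7) - (phi (q ^ 7) - 1) / q) \<longlongrightarrow> 2 * 1 * 1 + 0 * 1 + 0 - 0 * 1 - 0) (at 0)"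
    by (intro tendsto_diff tendsto_add tendsto_mult tendsto_const th_tendsto d) simp_all
  moreover have "\<forall>\<^sub>F q in at 0. 2 * psi (q ^ 8) * phi (q ^ 14) + (phi (q ^ 4) - 1) / q * phi (q ^ 14) + (phi (q ^ 14) - 1) / q
       - (phi (q\<^sup>2) - 1) / q * phi (q ^ 7) - (phi (q ^ 7) - 1) / q = th_D q / q"
    using eventually_punctured_unit_disc
  proof eventually_elim
    case (elim q)
    then have q: "norm q < 1" "q \<noteq> 0" by auto
    show ?case unfolding th_D_def th_A_def th_B_def phi_dissection[OF q] using q by (simp add: field_simps)
  qed
  ultimately show ?thesis by (auto dest: Lim_transform_eventually)
qed

text \<open>The divisors of the algebraic part collected once. Nonvanishing of \<open>th_r\<close>
  separates the two roots in \<open>reg_phi7\<close>; that of \<open>th_D\<close> is the denominator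
  of the closed form.\<close>

definition regular :: "complex \<Rightarrow> bool" where
  "regular q \<longleftrightarrow> q \<noteq> 0 \<and> norm q < 1 \<and> th_r q \<noteq> 0 \<and> th_D q \<noteq> 0 \<and>
     (\<forall>k>0. phi (q ^ k) \<noteq> 0 \<and> phi (- (q ^ k)) \<noteq> 0 \<and> psi (q ^ k) \<noteq> 0)"

lemma eventually_nonzero_quotient:
  fixes f g :: "complex \<Rightarrow> complex"
  assumes "((\<lambda>q. f q / g q) \<longlongrightarrow> l) F" "l \<noteq> 0"
  shows "\<forall>\<^sub>F q in F. f q \<noteq> 0"
  using tendsto_imp_eventually_ne[OF assms] by eventually_elim auto

lemma eventually_regular: "\<forall>\<^sub>F q in at 0. regular q"
proof -
  have "\<forall>\<^sub>F x in nhds 0. phi x \<noteq> 0" "\<forall>\<^sub>F x in nhds 0. psi x \<noteq> 0"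
    using isCont_phi_0 isCont_psi_0 tendsto_imp_eventually_ne[of phi 1 "nhds 0" 0] tendsto_imp_eventually_ne[of psi 1 "nhds 0" 0]
    by (auto simp: continuous_at tendsto_nhds_iff phi_0 psi_0)
  then have "\<forall>\<^sub>F x in nhds 0. phi x \<noteq> 0 \<and> psi x \<noteq> 0" by eventually_elim auto
  then obtain e where e: "e > 0" "\<And>x. norm x < e \<Longrightarrow> phi x \<noteq> 0 \<and> psi x \<noteq> 0"
    by (auto simp: eventually_nhds_metric dist_norm)
  have "\<forall>\<^sub>F q in at 0. norm q < e" using e by (auto simp: eventually_at dist_norm)
  moreover have "\<forall>\<^sub>F q in at 0. th_r q \<noteq> 0" "\<forall>\<^sub>F q in at 0. th_D q \<noteq> 0"
    by (rule eventually_nonzero_quotient[OF th_r_tendsto] eventually_nonzero_quotient[OF th_D_tendsto]; simp)+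
  ultimately show ?thesis
    using eventually_punctured_unit_disc
  proof eventually_elim
    case (elim q)
    have "norm (q ^ k) < e" if "k > 0" for k
    proof -
      have "norm q ^ k \<le> norm q ^ 1" using elim that by (intro power_decreasing) auto
      then show ?thesis using elim by (simp add: norm_power)
    qed
    then show ?case using elim e(2) by (auto simp: regular_def norm_minus_cancel)
  qed
qed

section \<open>Algebraic relations over the parameter t\<close>

context
  fixes q :: complex
  assumes reg: "regular q"
begin

lemma reg_q: "q \<noteq> 0" "norm q < 1" "0 < k \<Longrightarrow> norm (q ^ k) < 1"
  using reg norm_power_lt_one[of q k] by (auto simp: regular_def)

lemma reg_nz: "0 < k \<Longrightarrow> phi (q ^ k) \<noteq> 0" "0 < k \<Longrightarrow> phi (- (q ^ k)) \<noteq> 0" "0 < k \<Longrightarrow> psi (q ^ k) \<noteq> 0"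
  using reg by (auto simp: regular_def)

lemma reg_w: "th_w q \<noteq> 0"
  using reg_nz(1)[of 2] reg_nz(1)[of 14] by (simp add: th_w_def)

lemma reg_t: "th_t q * th_w q = 2 * q\<^sup>2 * psi (q\<^sup>2) * psi (q ^ 14)" "th_t q \<noteq> 0"
  using reg_w reg_q(1) reg_nz(3)[of 2] reg_nz(3)[of 14] by (simp_all add: th_t_def)

text \<open>The degree seven identity at \<open>q^2\<close>, divided by \<open>w\<close>. With
  \<alpha>, \<beta> the moduli of \<open>q^2\<close> and \<open>q^14\<close> it is Guetzlaff's
  modular equation: the eighth roots of \<alpha> \<beta> and of (1 - \<alpha>) (1 - \<beta>) add up
  to 1.\<close>

lemma reg_t_compl: "(1 - th_t q) * th_w q = phi (- (q ^ 4)) * phi (- (q ^ 28))" "1 - th_t q \<noteq> 0"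
proof -
  have "th_w q = 2 * q\<^sup>2 * psi (q\<^sup>2) * psi (q ^ 14) + phi (- (q ^ 4)) * phi (- (q ^ 28))"
    using degree_seven_identity[of "q\<^sup>2"] reg_q(1) reg_q(3)[of 2] by (simp add: th_w_def flip: power_mult)
  then show *: "(1 - th_t q) * th_w q = phi (- (q ^ 4)) * phi (- (q ^ 28))"
    using reg_t by (simp add: algebra_simps)
  show "1 - th_t q \<noteq> 0"
  proof
    assume "1 - th_t q = 0"
    then have "phi (- (q ^ 4)) * phi (- (q ^ 28)) = 0" using * by simp
    then show False using reg_nz(2)[of 4] reg_nz(2)[of 28] by simp
  qed
qed

lemma reg_kappa: "(1 - th_t q)\<^sup>2 * th_w q = phi (- (q\<^sup>2)) * phi (- (q ^ 14))"
proof -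
  have "(phi (- (q ^ 4)))\<^sup>2 = phi (q\<^sup>2) * phi (- (q\<^sup>2))" "(phi (- (q ^ 28)))\<^sup>2 = phi (q ^ 14) * phi (- (q ^ 14))"
    using phi_mult_phi_minus[of "q\<^sup>2"] phi_mult_phi_minus[of "q ^ 14"] reg_q(1) reg_q(3)[of 2] reg_q(3)[of 14]
    by (simp_all flip: power_mult)
  then have "((1 - th_t q) * th_w q)\<^sup>2 = th_w q * (phi (- (q\<^sup>2)) * phi (- (q ^ 14)))"
    unfolding reg_t_compl by (simp add: power_mult_distrib th_w_def)
  then have "th_w q * ((1 - th_t q)\<^sup>2 * th_w q) = th_w q * (phi (- (q\<^sup>2)) * phi (- (q ^ 14)))"
    by (simp add: power2_eq_square mult_ac)
  then show ?thesis using reg_w by simp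
qed

lemma reg_minus: "th_w (- q) = th_w q" "th_t (- q) = th_t q" "th_r (- q) = - th_r q" "th_s (- q) = th_s q"
  by (simp_all add: th_w_def th_t_def th_s_def) (simp add: th_r_def th_w_def minus_divide_left)

text \<open>Squaring the degree seven identity and using \<open>psi_square\<close> shows that the
  products at \<open>q\<close> and at \<open>- q\<close> both solve
  \<open>(Y - (1 - t)^2 w)^2 = 2 Y t w\<close>. They differ because \<open>r\<close> is nonzero, so
  their sum is read off the quadratic; their product then gives the equation of the curve.\<close>

lemma reg_phi7:
  "phi q * phi (q ^ 7) = (1 - th_t q + (th_t q)\<^sup>2 + th_r q) * th_w q"
  "phi (- q) * phi (- (q ^ 7)) = (1 - th_t q + (th_t q)\<^sup>2 - th_r q) * th_w q"
  "(th_r q)\<^sup>2 = th_t q * (2 - 3 * th_t q + 2 * (th_t q)\<^sup>2)"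
proof -
  define t r w y y' where "t = th_t q" and "r = th_r q" and "w = th_w q"
    and "y = phi q * phi (q ^ 7)" and "y' = phi (- q) * phi (- (q ^ 7))"
  have w: "w \<noteq> 0" using reg_w by (simp add: w_def)
  have root: "(phi x * phi (x ^ 7) - (1 - t)\<^sup>2 * w)\<^sup>2 = 2 * (phi x * phi (x ^ 7)) * t * w"
    if x: "x = q \<or> x = - q" for x
  proof -
    have x2: "x\<^sup>2 = q\<^sup>2" "x ^ 14 = q ^ 14" "x \<noteq> 0" "norm x < 1" "norm (x ^ 7) < 1" using x reg_q(1,2) reg_q(3)[of 7] by auto
    have "phi x * phi (x ^ 7) - (1 - t)\<^sup>2 * w = 2 * x * psi x * psi (x ^ 7)"
      using degree_seven_identity[OF x2(4,3)] reg_kappa unfolding x2 by (simp add: t_def w_def)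
    then have "(phi x * phi (x ^ 7) - (1 - t)\<^sup>2 * w)\<^sup>2 = 4 * x\<^sup>2 * (psi x)\<^sup>2 * (psi (x ^ 7))\<^sup>2"
      by (simp add: power_mult_distrib)
    also have "\<dots> = 2 * (phi x * phi (x ^ 7)) * (2 * x\<^sup>2 * psi (x\<^sup>2) * psi (x ^ 14))"
      using psi_square[OF x2(4,3)] psi_square[OF x2(5)] x2(3) by (simp flip: power_mult)
    also have "2 * x\<^sup>2 * psi (x\<^sup>2) * psi (x ^ 14) = t * w" unfolding x2 reg_t(1)[symmetric] by (simp add: t_def w_def)
    finally show ?thesis by simp
  qed
  have e1: "(y - (1 - t)\<^sup>2 * w)\<^sup>2 = 2 * y * t * w" using root[of q] by (simp add: y_def)
  have e2: "(y' - (1 - t)\<^sup>2 * w)\<^sup>2 = 2 * y' * t * w" using root[of "- q"] by (simp add: y'_def)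
  have r: "r = (y - y') / (2 * w)" by (simp add: r_def th_r_def y_def y'_def w_def)
  have "r \<noteq> 0" using reg by (simp add: regular_def r_def)
  then have ne: "y - y' \<noteq> 0" using r by auto
  have "(y - y') * (y + y' - 2 * (1 - t)\<^sup>2 * w - 2 * t * w) = 0" using e1 e2 by algebra
  then have "y + y' - 2 * (1 - t)\<^sup>2 * w - 2 * t * w = 0" using ne by (simp only: mult_eq_0_iff) blast
  then have sum: "y + y' = 2 * (1 - t + t\<^sup>2) * w" by algebra
  have dif: "y - y' = 2 * r * w" using r w by simp
  show 1: "phi q * phi (q ^ 7) = (1 - th_t q + (th_t q)\<^sup>2 + th_r q) * th_w q"
    using sum dif unfolding y_def[symmetric] t_def[symmetric] r_def[symmetric] w_def[symmetric] by algebra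
  show 2: "phi (- q) * phi (- (q ^ 7)) = (1 - th_t q + (th_t q)\<^sup>2 - th_r q) * th_w q"
    using sum dif unfolding y'_def[symmetric] t_def[symmetric] r_def[symmetric] w_def[symmetric] by algebra
  have "phi q * phi (- q) = (phi (- (q\<^sup>2)))\<^sup>2" "phi (q ^ 7) * phi (- (q ^ 7)) = (phi (- (q ^ 14)))\<^sup>2"
    using phi_mult_phi_minus[of q] phi_mult_phi_minus[of "q ^ 7"] reg_q(1,2) reg_q(3)[of 7] by (simp_all flip: power_mult)
  then have "y * y' = ((1 - t)\<^sup>2 * w)\<^sup>2"
    unfolding y_def y'_def t_def w_def reg_kappa by (simp add: power2_eq_square mult_ac)
  then have "(1 - t + t\<^sup>2 + r) * (1 - t + t\<^sup>2 - r) * w\<^sup>2 = (1 - t) ^ 4 * w\<^sup>2"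
    using 1 2 unfolding y_def[symmetric] y'_def[symmetric] t_def[symmetric] r_def[symmetric] w_def[symmetric]
    by (simp add: power2_eq_square eval_nat_numeral mult_ac)
  then have "(1 - t + t\<^sup>2 + r) * (1 - t + t\<^sup>2 - r) = (1 - t) ^ 4" using w by simp
  then show "(th_r q)\<^sup>2 = th_t q * (2 - 3 * th_t q + 2 * (th_t q)\<^sup>2)"
    unfolding t_def[symmetric] r_def[symmetric] by algebra
qed

lemma reg_t_square: "(th_t q)\<^sup>2 * th_w q = 4 * q ^ 4 * psi (q ^ 4) * psi (q ^ 28)"
proof -
  have "(psi (q\<^sup>2))\<^sup>2 = phi (q\<^sup>2) * psi (q ^ 4)" "(psi (q ^ 14))\<^sup>2 = phi (q ^ 14) * psi (q ^ 28)"
    using psi_square[of "q\<^sup>2"] psi_square[of "q ^ 14"] reg_q(1) reg_q(3)[of 2] reg_q(3)[of 14] by (simp_all flip: power_mult)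
  then have "(th_t q * th_w q)\<^sup>2 = th_w q * (4 * q ^ 4 * psi (q ^ 4) * psi (q ^ 28))"
    unfolding reg_t(1) by (simp add: power_mult_distrib th_w_def mult_ac flip: power_mult)
  then have "th_w q * ((th_t q)\<^sup>2 * th_w q) = th_w q * (4 * q ^ 4 * psi (q ^ 4) * psi (q ^ 28))"
    by (simp add: power2_eq_square mult_ac)
  then show ?thesis using reg_w by simp
qed

text \<open>\<open>A^2\<close>, \<open>B^2\<close> and \<open>A B\<close> are all known, so
  \<open>(1 + a) (1 + b)\<close> is a square in \<open>t\<close> and \<open>r\<close>. With
  \<open>a b = t^4\<close> this gives \<open>a + b\<close>, and with it the square of
  \<open>A - B\<close>.\<close>

lemma reg_AB:
  "(th_A q)\<^sup>2 = (th_w q)\<^sup>2 * (1 + th_a q)" "(th_B q)\<^sup>2 = (th_w q)\<^sup>2 * (1 + th_b q)"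
  "th_A q * th_B q = (th_w q)\<^sup>2 * (1 - th_t q + (th_t q)\<^sup>2 + th_r q)"
  "th_a q * th_b q = (th_t q) ^ 4"
  "th_a q + th_b q = 2 * (1 - th_t q + (th_t q)\<^sup>2) * th_r q"
  "(th_D q)\<^sup>2 = 2 * th_t q * (1 - th_t q) * (1 - th_r q) * (th_w q)\<^sup>2"
proof -
  have "(phi q)\<^sup>2 = (phi (q\<^sup>2))\<^sup>2 + 4 * q * (psi (q ^ 4))\<^sup>2"
    "(phi (q ^ 7))\<^sup>2 = (phi (q ^ 14))\<^sup>2 + 4 * q ^ 7 * (psi (q ^ 28))\<^sup>2"
    using phi_square[of q] phi_square[of "q ^ 7"] reg_q(1,2) reg_q(3)[of 7] by (simp_all flip: power_mult)
  then show A: "(th_A q)\<^sup>2 = (th_w q)\<^sup>2 * (1 + th_a q)" and B: "(th_B q)\<^sup>2 = (th_w q)\<^sup>2 * (1 + th_b q)"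
    using reg_w by (simp_all add: th_A_def th_B_def th_a_def th_b_def field_simps power_mult_distrib th_w_def[of q])
  show AB: "th_A q * th_B q = (th_w q)\<^sup>2 * (1 - th_t q + (th_t q)\<^sup>2 + th_r q)"
  proof -
    have "th_A q * th_B q = th_w q * (phi q * phi (q ^ 7))" by (simp add: th_A_def th_B_def th_w_def mult_ac)
    then show ?thesis unfolding reg_phi7(1) by (simp add: power2_eq_square mult_ac)
  qed
  have "th_a q * th_b q * (th_w q)\<^sup>2 = ((th_t q)\<^sup>2 * th_w q)\<^sup>2"
    unfolding reg_t_square using reg_w
    by (simp add: th_a_def th_b_def field_simps power_mult_distrib th_w_def[of q] eval_nat_numeral)
  then show ab: "th_a q * th_b q = (th_t q) ^ 4"
    using reg_w by (simp add: power_mult_distrib flip: power_mult)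
  have "(th_w q) ^ 4 * ((1 + th_a q) * (1 + th_b q)) = (th_w q) ^ 4 * (1 - th_t q + (th_t q)\<^sup>2 + th_r q)\<^sup>2"
    using A B AB by algebra
  then have "(1 + th_a q) * (1 + th_b q) = (1 - th_t q + (th_t q)\<^sup>2 + th_r q)\<^sup>2" using reg_w by simp
  then show apb: "th_a q + th_b q = 2 * (1 - th_t q + (th_t q)\<^sup>2) * th_r q"
    using ab reg_phi7(3) by algebra
  show "(th_D q)\<^sup>2 = 2 * th_t q * (1 - th_t q) * (1 - th_r q) * (th_w q)\<^sup>2"
    unfolding th_D_def using A B AB apb by algebra
qed

end

text \<open>The passage from \<open>q\<close> to \<open>q^2\<close>. \<open>reg_phi7\<close> at
  \<open>q^2\<close> is compared with \<open>reg_kappa\<close> at \<open>q\<close>, which makes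
  \<rho> a root of a quadratic over \<open>t\<close>. Its discriminant is governed by
  \<open>(1 - t + t^2)^2 - t^4 = 1 - r^2\<close>, the origin of \<open>th_s\<close>.\<close>

lemma reg_next:
  assumes q: "regular q" and q2: "regular (q\<^sup>2)"
  defines "\<rho> \<equiv> th_w (q\<^sup>2) / th_w q"
  shows "\<rho> \<noteq> 0" "th_s q = 2 * \<rho> - (1 - th_t q + (th_t q)\<^sup>2)"
    "th_t (q\<^sup>2) = (th_t q)\<^sup>2 / (2 * \<rho>)" "th_r (q\<^sup>2) = th_t q * (2 - th_t q) / (2 * \<rho>)"
    "4 * \<rho>\<^sup>2 - 4 * \<rho> * (1 - th_t q + (th_t q)\<^sup>2) + (th_t q) ^ 4 = 0"
    "(th_s q)\<^sup>2 = 1 - (th_r q)\<^sup>2"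
proof -
  define t r w t2 r2 w2 where "t = th_t q" and "r = th_r q" and "w = th_w q"
    and "t2 = th_t (q\<^sup>2)" and "r2 = th_r (q\<^sup>2)" and "w2 = th_w (q\<^sup>2)"
  have w: "w \<noteq> 0" "w2 \<noteq> 0" using reg_w[OF q] reg_w[OF q2] by (simp_all add: w_def w2_def)
  then show rho: "\<rho> \<noteq> 0" by (simp add: \<rho>_def w_def w2_def)
  show s: "th_s q = 2 * \<rho> - (1 - th_t q + (th_t q)\<^sup>2)" by (simp add: th_s_def \<rho>_def)
  have w2: "w2 = \<rho> * w" using w by (simp add: \<rho>_def w_def w2_def)
  have "t2 * w2 = t\<^sup>2 * w / 2"
    using reg_t(1)[OF q2] reg_t_square[OF q] by (simp add: t2_def w2_def t_def w_def flip: power_mult)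
  then have "t2 * (2 * \<rho>) = t\<^sup>2" using w unfolding w2 by (simp add: field_simps)
  then have t2: "t2 = t\<^sup>2 / (2 * \<rho>)" using rho by (simp add: field_simps)
  then show "th_t (q\<^sup>2) = (th_t q)\<^sup>2 / (2 * \<rho>)" by (simp add: t2_def t_def)
  have "w = (1 - t2 + t2\<^sup>2 + r2) * w2" "(1 - t)\<^sup>2 * w = (1 - t2 + t2\<^sup>2 - r2) * w2"
    using reg_phi7(1,2)[OF q2] reg_kappa[OF q]
    by (simp_all add: t_def w_def t2_def r2_def w2_def th_w_def[of q] flip: power_mult)
  then have e: "1 = (1 - t2 + t2\<^sup>2 + r2) * \<rho>" "(1 - t)\<^sup>2 = (1 - t2 + t2\<^sup>2 - r2) * \<rho>"
    using w unfolding w2 by auto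
  then have "r2 * (2 * \<rho>) = t * (2 - t)" by algebra
  then have r2: "r2 = t * (2 - t) / (2 * \<rho>)" using rho by (simp add: field_simps)
  then show "th_r (q\<^sup>2) = th_t q * (2 - th_t q) / (2 * \<rho>)" by (simp add: r2_def t_def)
  have "2 * ((1 - t2 + t2\<^sup>2) * \<rho>) = 1 + (1 - t)\<^sup>2" using e by algebra
  then have "4 * \<rho>\<^sup>2 - 4 * \<rho> * (1 - t + t\<^sup>2) + t ^ 4 = 0"
    using \<open>t2 * (2 * \<rho>) = t\<^sup>2\<close> by algebra
  then show quad: "4 * \<rho>\<^sup>2 - 4 * \<rho> * (1 - th_t q + (th_t q)\<^sup>2) + (th_t q) ^ 4 = 0" by (simp add: t_def)
  show "(th_s q)\<^sup>2 = 1 - (th_r q)\<^sup>2"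
    unfolding s using quad reg_phi7(3)[OF q] by algebra
qed

text \<open>The even part of \<open>phi q\<close> is \<open>phi (q ^ 4)\<close>, so the even part of
  \<open>th_D\<close> is a difference of the same kind at \<open>q^2\<close>. The minus sign appears
  because the two diagonal forms exchange roles.\<close>

lemma th_D_next:
  assumes "regular q"
  shows "th_D (q\<^sup>2) = - (th_D q + th_D (- q)) / 2"
proof -
  have 1: "phi q + phi (- q) = 2 * phi (q ^ 4)" "phi (q ^ 7) + phi (- (q ^ 7)) = 2 * phi (q ^ 28)"
    using phi_dissection[of q] phi_dissection[of "- q"] phi_dissection[of "q ^ 7"] phi_dissection[of "- (q ^ 7)"]
      reg_q(1,2)[OF assms] reg_q(3)[OF assms, of 7] by (simp_all flip: power_mult)
  have "th_D q + th_D (- q) = (phi q + phi (- q)) * phi (q ^ 14) - phi (q\<^sup>2) * (phi (q ^ 7) + phi (- (q ^ 7)))"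
    by (simp add: th_D_def th_A_def th_B_def algebra_simps)
  also have "\<dots> = - 2 * th_D (q\<^sup>2)"
    unfolding 1 by (simp add: th_D_def th_A_def th_B_def algebra_simps flip: power_mult)
  finally show ?thesis by simp
qed

section \<open>Euler products and the claimed quotient near the origin\<close>

lemma euler_E_0: "euler_E 0 = 1"
  by (simp add: euler_E_def)

text \<open>The pentagonal series is a theta series with nonnegative exponents, so
  \<open>theta_holomorphic\<close> applies; the point \<open>0\<close> is checked by hand.\<close>

lemma euler_E_holomorphic: "euler_E holomorphic_on ball 0 1"
proof -
  have nn: "0 \<le> n * (3 * n + 1) div 2" for n :: int
  proof -
    have "0 \<le> n * (3 * n + 1)" by (cases "n \<ge> 0") (auto intro: mult_nonpos_nonpos)
    then show ?thesis by simp
  qed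
  have pos: "n * (3 * n + 1) div 2 \<noteq> 0" if "n \<noteq> 0" for n :: int
  proof -
    have "n * (3 * n + 1) \<noteq> 0 \<and> n * (3 * n + 1) \<noteq> 1"
    proof
      show "n * (3 * n + 1) \<noteq> 0" using that by (simp, presburger?)
      have "even (n * (3 * n + 1))" by auto
      then show "n * (3 * n + 1) \<noteq> 1" by (metis odd_one)
    qed
    moreover have "0 \<le> n * (3 * n + 1)" by (cases "n \<ge> 0") (auto intro: mult_nonpos_nonpos)
    ultimately show ?thesis by linarith
  qed
  have sm: "(\<lambda>n. (-1) powi n * q powi (n * (3 * n + 1) div 2)) summable_on UNIV" if "norm q < 1" for q :: complex
  proof -
    have "\<bar>n\<bar> \<le> n * (3 * n + 1) div 2 + 1" for n :: int
    proof -
      have "2 * \<bar>n\<bar> \<le> n * (3 * n + 1) + 2" using int_abs_le_square[of n] by (simp add: algebra_simps power2_eq_square)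
      then show ?thesis by linarith
    qed
    then show ?thesis
      using theta_summable_1[OF that, of "\<lambda>n. n * (3 * n + 1) div 2" 1 "\<lambda>n. (-1) powi n"] nn by (simp add: norm_power_int)
  qed
  have "(\<Sum>\<^sub>\<infinity>n. (-1) powi n * q powi (n * (3 * n + 1) div 2)) = euler_E q" if "q \<in> ball 0 1" for q
  proof (cases "q = 0")
    case True
    then show ?thesis using pos by (subst infsum_single_nonzero[of 0]) (auto simp: euler_E_0)
  next
    case False
    then show ?thesis using pentagonal_number_theorem(1) that by simp
  qed
  then show ?thesis
    using theta_holomorphic[of "\<lambda>n::int. n * (3 * n + 1) div 2" "\<lambda>n. (-1) powi n", OF nn sm]
    by (rule holomorphic_transform[rotated])
qed

lemma tendsto_euler_E:
  assumes "(f \<longlongrightarrow> 0) F" shows "((\<lambda>x. euler_E (f x)) \<longlongrightarrow> 1) F"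
proof -
  have "isCont euler_E 0"
    using euler_E_holomorphic by (auto intro!: continuous_on_interior[where S = "ball 0 1"] holomorphic_on_imp_continuous_on)
  from isCont_tendsto_compose[OF this assms] show ?thesis by (simp add: euler_E_0)
qed

lemma euler_E_phi_psi:
  assumes "norm q < 1" "q \<noteq> 0"
  shows "euler_E q * euler_E (q\<^sup>2) = phi (- q) * psi q"
    and "(euler_E q) ^ 3 = (phi (- q))\<^sup>2 * psi q" and "(euler_E (q\<^sup>2)) ^ 3 = phi (- q) * (psi q)\<^sup>2"
proof -
  define x y where "x = euler_E q" and "y = euler_E (q\<^sup>2)"
  have nz: "x \<noteq> 0" "y \<noteq> 0" using euler_E_nonzero assms norm_power_lt_one[OF assms(1), of 2] by (simp_all add: x_def y_def)
  have e: "phi (- q) = x\<^sup>2 / y" "psi q = y\<^sup>2 / x"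
    using phi_minus_product[OF assms] psi_product[OF assms] nz by (simp_all add: x_def y_def field_simps)
  show "euler_E q * euler_E (q\<^sup>2) = phi (- q) * psi q" 
    "(euler_E q) ^ 3 = (phi (- q))\<^sup>2 * psi q" "(euler_E (q\<^sup>2)) ^ 3 = phi (- q) * (psi q)\<^sup>2"
    unfolding e x_def[symmetric] y_def[symmetric] using nz by (simp_all add: field_simps eval_nat_numeral)
qed

definition th_h :: "complex \<Rightarrow> complex" where
  "th_h q = q * (((euler_E (q ^ 28))\<^sup>2 * (euler_E (q\<^sup>2))\<^sup>2) / ((euler_E (q ^ 14))\<^sup>2 * (euler_E (q ^ 4))\<^sup>2))"

text \<open>Chosen so that \<open>D (A - C) = w^2 (a + c)\<close> and
  \<open>D (B + C) = - w^2 (b + c)\<close> for the candidate \<open>C\<close>. The claimed quotient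
  thereby becomes \<open>- (a + c) / (b + c)\<close>.\<close>

definition th_c :: "complex \<Rightarrow> complex" where
  "th_c q = 2 * th_t q * (1 - th_t q)\<^sup>2 - (2 - th_t q) * th_r q"

lemma th_h_tendsto: "((\<lambda>q. th_h q / q ^ 1) \<longlongrightarrow> 1) (at 0)"
proof -
  have "((\<lambda>q. ((euler_E (q ^ 28))\<^sup>2 * (euler_E (q\<^sup>2))\<^sup>2) / ((euler_E (q ^ 14))\<^sup>2 * (euler_E (q ^ 4))\<^sup>2)) \<longlongrightarrow> (1\<^sup>2 * 1\<^sup>2) / (1\<^sup>2 * 1\<^sup>2)) (at 0)"
    by (intro tendsto_divide tendsto_mult tendsto_power tendsto_euler_E tendsto_power_0) auto
  moreover have "\<forall>\<^sub>F q in at 0. ((euler_E (q ^ 28))\<^sup>2 * (euler_E (q\<^sup>2))\<^sup>2) / ((euler_E (q ^ 14))\<^sup>2 * (euler_E (q ^ 4))\<^sup>2) = th_h q / q ^ 1"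
    using eventually_punctured_unit_disc by eventually_elim (simp add: th_h_def)
  ultimately show ?thesis by (auto dest: Lim_transform_eventually)
qed

text \<open>The Euler products are only accessible through their cubes, which are monomials in \<open>phi\<close> and \<open>psi\<close>.\<close>

lemma th_h_cube:
  assumes "regular q"
  shows "(th_h q) ^ 3 * ((1 - th_t q) ^ 4 * (th_t q)\<^sup>2) = (1 - (th_a q)\<^sup>2) * th_b q"
proof -
  note rq = reg_q[OF assms] and w = reg_w[OF assms]
  have q0: "q \<noteq> 0" using rq by simp
  define f1 f2 p1 p2 F1 F2 P1 P2 where "f1 = phi (- (q\<^sup>2))" and "f2 = phi (- (q ^ 14))"
    and "p1 = psi (q\<^sup>2)" and "p2 = psi (q ^ 14)"
    and "F1 = phi (q\<^sup>2)" and "F2 = phi (q ^ 14)" and "P1 = psi (q ^ 4)" and "P2 = psi (q ^ 28)"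
  have nz: "f1 \<noteq> 0" "f2 \<noteq> 0" "p1 \<noteq> 0" "p2 \<noteq> 0" "F1 \<noteq> 0" "F2 \<noteq> 0"
    using reg_nz[OF assms] by (simp_all add: f1_def f2_def p1_def p2_def F1_def F2_def)
  have 1: "(euler_E (q\<^sup>2)) ^ 3 = f1\<^sup>2 * p1" "(euler_E (q ^ 4)) ^ 3 = f1 * p1\<^sup>2"
    "(euler_E (q ^ 14)) ^ 3 = f2\<^sup>2 * p2" "(euler_E (q ^ 28)) ^ 3 = f2 * p2\<^sup>2"
    using euler_E_phi_psi(2,3)[of "q\<^sup>2"] euler_E_phi_psi(2,3)[of "q ^ 14"] q0 rq(3)[of 2] rq(3)[of 14]
    by (simp_all add: f1_def f2_def p1_def p2_def flip: power_mult)
  have cb: "(x\<^sup>2) ^ 3 = (x ^ 3)\<^sup>2" for x :: complex by (simp flip: power_mult)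
  have "(th_h q) ^ 3 = q ^ 3 * (((f2 * p2\<^sup>2)\<^sup>2 * (f1\<^sup>2 * p1)\<^sup>2) / ((f2\<^sup>2 * p2)\<^sup>2 * (f1 * p1\<^sup>2)\<^sup>2))"
    unfolding th_h_def power_mult_distrib[of _ _ 3] power_divide cb 1 ..
  also have "\<dots> = q ^ 3 * (f1\<^sup>2 * p2\<^sup>2) / (f2\<^sup>2 * p1\<^sup>2)"
    using nz by (simp add: field_simps eval_nat_numeral)
  finally have h3: "(th_h q) ^ 3 = q ^ 3 * (f1\<^sup>2 * p2\<^sup>2) / (f2\<^sup>2 * p1\<^sup>2)" .
  have kap: "(1 - th_t q)\<^sup>2 = f1 * f2 / (F1 * F2)"
    using reg_kappa[OF assms] nz by (simp add: f1_def f2_def F1_def F2_def th_w_def field_simps)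
  have tt: "th_t q = 2 * q\<^sup>2 * p1 * p2 / (F1 * F2)"
    by (simp add: th_t_def th_w_def p1_def p2_def F1_def F2_def)
  have pp: "p2\<^sup>2 = F2 * P2" "p1\<^sup>2 = F1 * P1"
    using psi_square[of "q\<^sup>2"] psi_square[of "q ^ 14"] q0 rq(3)[of 2] rq(3)[of 14]
    by (simp_all add: p1_def p2_def F1_def F2_def P1_def P2_def flip: power_mult)
  have aa: "th_a q = 4 * q * P1\<^sup>2 / F1\<^sup>2" "th_b q = 4 * q ^ 7 * P2\<^sup>2 / F2\<^sup>2"
    using nz by (simp_all add: th_a_def th_b_def th_w_def P1_def P2_def F1_def F2_def power_mult_distrib)
  \<comment> \<open>Jacobi's quartic identity at \<open>q^2\<close>; divided by
    \<open>F1 ^ 4\<close> it says that \<open>1 - a^2\<close> is \<open>(f1 / F1)^4\<close>.\<close>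
  have f4: "f1 ^ 4 = F1 ^ 4 - 16 * q\<^sup>2 * P1 ^ 4"
  proof -
    have "F1\<^sup>2 = (phi (q ^ 4))\<^sup>2 + 4 * q\<^sup>2 * (psi (q ^ 8))\<^sup>2" "f1\<^sup>2 = (phi (q ^ 4))\<^sup>2 - 4 * q\<^sup>2 * (psi (q ^ 8))\<^sup>2"
      using phi_square[of "q\<^sup>2"] phi_square[of "- (q\<^sup>2)"] q0 rq(3)[of 2] by (simp_all add: F1_def f1_def flip: power_mult)
    moreover have "P1\<^sup>2 = phi (q ^ 4) * psi (q ^ 8)"
      using psi_square[of "q ^ 4"] q0 rq(3)[of 4] by (simp add: P1_def flip: power_mult)
    ultimately show ?thesis by algebra
  qed
  have "(1 - th_t q) ^ 4 = (f1 * f2 / (F1 * F2))\<^sup>2" unfolding kap[symmetric] by (simp flip: power_mult)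
  then have "(th_h q) ^ 3 * ((1 - th_t q) ^ 4 * (th_t q)\<^sup>2)
     = q ^ 3 * (f1\<^sup>2 * p2\<^sup>2) / (f2\<^sup>2 * p1\<^sup>2) * ((f1 * f2 / (F1 * F2))\<^sup>2 * (2 * q\<^sup>2 * p1 * p2 / (F1 * F2))\<^sup>2)"
    unfolding h3 tt by simp
  also have "\<dots> = 4 * q ^ 7 * f1 ^ 4 * (p2\<^sup>2)\<^sup>2 / (F1 * F2) ^ 4"
    using nz by (simp add: field_simps eval_nat_numeral)
  also have "\<dots> = 4 * q ^ 7 * (F1 ^ 4 - 16 * q\<^sup>2 * P1 ^ 4) * (F2 * P2)\<^sup>2 / (F1 * F2) ^ 4"
    unfolding pp f4 ..
  also have "\<dots> = (1 - (th_a q)\<^sup>2) * th_b q"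
    unfolding aa using nz by (simp add: field_simps eval_nat_numeral)
  finally show ?thesis .
qed

text \<open>Consequences of \<open>a b = t^4\<close>, the value of \<open>a + b\<close> and the
  curve equation. The first two remove \<open>a\<close> and \<open>b\<close> from symmetric
  expressions; the third says that \<open>- (a + c) / (b + c)\<close> has the cube of
  \<open>th_h\<close>.\<close>

lemma th_c_identities:
  assumes "regular q"
  shows "(th_a q + th_c q) * (th_b q + th_c q) = 4 * th_t q * (1 - th_t q) ^ 3 * (2 * th_t q * (1 - th_t q) - (1 + th_t q) * th_r q)"
    and "(th_b q - th_a q)\<^sup>2 = 4 * th_t q * (1 - th_t q)\<^sup>2 * (2 - th_t q + (th_t q)\<^sup>2) * (1 - th_t q + 2 * (th_t q)\<^sup>2)"
    and "(th_a q + th_c q) ^ 3 * ((1 - th_t q) ^ 4 * (th_t q)\<^sup>2) = - ((th_b q + th_c q) ^ 3 * ((1 - (th_a q)\<^sup>2) * th_b q))"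
proof -
  note f = reg_AB(4,5)[OF assms] reg_phi7(3)[OF assms]
  show "(th_a q + th_c q) * (th_b q + th_c q) = 4 * th_t q * (1 - th_t q) ^ 3 * (2 * th_t q * (1 - th_t q) - (1 + th_t q) * th_r q)"
    unfolding th_c_def using f by algebra
  show "(th_b q - th_a q)\<^sup>2 = 4 * th_t q * (1 - th_t q)\<^sup>2 * (2 - th_t q + (th_t q)\<^sup>2) * (1 - th_t q + 2 * (th_t q)\<^sup>2)"
    using f by algebra
  show "(th_a q + th_c q) ^ 3 * ((1 - th_t q) ^ 4 * (th_t q)\<^sup>2) = - ((th_b q + th_c q) ^ 3 * ((1 - (th_a q)\<^sup>2) * th_b q))"
    unfolding th_c_def using f by algebra
qed

text \<open>With a common leading term \<open>l q^n\<close>, the sum \<open>f + g\<close> has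
  leading term \<open>2 l q^n\<close> and cannot vanish near \<open>0\<close>, so only
  \<open>f - g\<close> can.\<close>

lemma eventually_eq_if_squares_eq:
  fixes f g :: "complex \<Rightarrow> complex"
  assumes "\<forall>\<^sub>F q in at 0. (f q)\<^sup>2 = (g q)\<^sup>2"
    and "((\<lambda>q. f q / q ^ n) \<longlongrightarrow> l) (at 0)" "((\<lambda>q. g q / q ^ n) \<longlongrightarrow> l) (at 0)" "l \<noteq> 0"
  shows "\<forall>\<^sub>F q in at 0. f q = g q"
proof -
  have "((\<lambda>q. (f q + g q) / q ^ n) \<longlongrightarrow> l + l) (at 0)"
    using tendsto_add[OF assms(2,3)] by (simp add: add_divide_distrib)
  then have "\<forall>\<^sub>F q in at 0. f q + g q \<noteq> 0" by (rule eventually_nonzero_quotient) (use assms(4) in simp)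
  with assms(1) show ?thesis
  proof eventually_elim
    case (elim q)
    have "(f q - g q) * (f q + g q) = 0" using elim(1) by algebra
    with elim(2) show ?case by simp
  qed
qed

text \<open>The cofactor \<open>f^2 + f g + g^2\<close> has leading coefficient
  \<open>3 l^2\<close>, which excludes the other cube roots of unity.\<close>

lemma eventually_eq_if_cubes_eq:
  fixes f g :: "complex \<Rightarrow> complex"
  assumes "\<forall>\<^sub>F q in at 0. (f q) ^ 3 = (g q) ^ 3"
    and "((\<lambda>q. f q / q ^ n) \<longlongrightarrow> l) (at 0)" "((\<lambda>q. g q / q ^ n) \<longlongrightarrow> l) (at 0)" "l \<noteq> 0"
  shows "\<forall>\<^sub>F q in at 0. f q = g q"
proof -
  have "((\<lambda>q. (f q / q ^ n) * (f q / q ^ n) + (f q / q ^ n) * (g q / q ^ n) + (g q / q ^ n) * (g q / q ^ n)) \<longlongrightarrow> l * l + l * l + l * l) (at 0)"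
    by (intro tendsto_add tendsto_mult assms)
  then have "((\<lambda>q. (f q * f q + f q * g q + g q * g q) / (q ^ n * q ^ n)) \<longlongrightarrow> 3 * (l * l)) (at 0)"
    by (simp add: add_divide_distrib)
  then have "\<forall>\<^sub>F q in at 0. f q * f q + f q * g q + g q * g q \<noteq> 0" by (rule eventually_nonzero_quotient) (use assms(4) in simp)
  with assms(1) show ?thesis
  proof eventually_elim
    case (elim q)
    have "(f q - g q) * (f q * f q + f q * g q + g q * g q) = 0" using elim(1) by algebra
    with elim(2) show ?case by simp
  qed
qed

lemma th_small_tendsto:
  "(th_t \<longlongrightarrow> 0) (at 0)" "((\<lambda>q. th_t q / q) \<longlongrightarrow> 0) (at 0)" "(th_r \<longlongrightarrow> 0) (at 0)" "(th_s \<longlongrightarrow> 1) (at 0)"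
  "((\<lambda>q. th_b q / q) \<longlongrightarrow> 0) (at 0)"
proof -
  show t: "(th_t \<longlongrightarrow> 0) (at 0)" using tendsto_0_if_quotient[OF th_t_tendsto, of 0] by simp
  show "((\<lambda>q. th_t q / q) \<longlongrightarrow> 0) (at 0)" using tendsto_0_if_quotient[OF th_t_tendsto, of 1] by simp
  show "(th_r \<longlongrightarrow> 0) (at 0)" using tendsto_0_if_quotient[of th_r 1 2 0] th_r_tendsto by simp
  have "((\<lambda>q. 2 * th_w (q ^ 2) / th_w q - (1 - th_t q + (th_t q)\<^sup>2)) \<longlongrightarrow> 2 * 1 / 1 - (1 - 0 + 0\<^sup>2)) (at 0)"
    by (intro tendsto_diff tendsto_divide tendsto_mult tendsto_add tendsto_power tendsto_const th_w_tendsto t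
        filterlim_compose[OF th_w_tendsto filterlim_power_at_0]) auto
  then show "(th_s \<longlongrightarrow> 1) (at 0)" by (simp add: th_s_def[abs_def])
  have "((\<lambda>q. 4 * q ^ 6 * (psi (q ^ 28))\<^sup>2 * (phi (q\<^sup>2))\<^sup>2 / (th_w q)\<^sup>2) \<longlongrightarrow> 4 * 0 * 1\<^sup>2 * 1\<^sup>2 / 1\<^sup>2) (at 0)"
    by (intro tendsto_divide tendsto_mult tendsto_power tendsto_const th_w_tendsto th_tendsto) auto
  moreover have "\<forall>\<^sub>F q in at 0. 4 * q ^ 6 * (psi (q ^ 28))\<^sup>2 * (phi (q\<^sup>2))\<^sup>2 / (th_w q)\<^sup>2 = th_b q / q"
    using eventually_punctured_unit_disc by eventually_elim (simp add: th_b_def eval_nat_numeral)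
  ultimately show "((\<lambda>q. th_b q / q) \<longlongrightarrow> 0) (at 0)" by (auto dest: Lim_transform_eventually)
qed

lemma th_bc_tendsto: "((\<lambda>q. (th_b q + th_c q) / q) \<longlongrightarrow> - 4) (at 0)"
proof -
  have "((\<lambda>q. th_b q / q + (2 * (th_t q / q) * (1 - th_t q)\<^sup>2 - (2 - th_t q) * (th_r q / q))) \<longlongrightarrow>
      0 + (2 * 0 * (1 - 0)\<^sup>2 - (2 - 0) * 2)) (at 0)"
    by (intro tendsto_add tendsto_diff tendsto_mult tendsto_power tendsto_const th_small_tendsto th_r_tendsto)
  moreover have "th_b q / q + (2 * (th_t q / q) * (1 - th_t q)\<^sup>2 - (2 - th_t q) * (th_r q / q)) = (th_b q + th_c q) / q" for q
    by (simp add: th_c_def add_divide_distrib diff_divide_distrib)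
  ultimately show ?thesis by simp
qed

lemma th_h_eventually: "\<forall>\<^sub>F q in at 0. th_b q + th_c q \<noteq> 0 \<and> th_h q * (th_b q + th_c q) = - (th_a q + th_c q)"
proof -
  define k where "k q = - ((th_a q + th_c q) / (th_b q + th_c q))" for q
  have bc: "\<forall>\<^sub>F q in at 0. th_b q + th_c q \<noteq> 0"
    by (rule eventually_nonzero_quotient[OF th_bc_tendsto]) simp
  \<comment> \<open>The linear terms \<open>4 q\<close> of \<open>a\<close> and \<open>- 4 q\<close>
    of \<open>c\<close> cancel, so the order of \<open>a + c\<close> cannot be read off its
    summands. Expanding the fraction by \<open>b + c\<close> brings in
    \<open>(a + c) (b + c)\<close>, whose factored form shows order 3.\<close>
  have "((\<lambda>q. - (4 * (th_t q / q\<^sup>2) * (1 - th_t q) ^ 3 * (2 * (th_t q / q) * (1 - th_t q) - (1 + th_t q) * (th_r q / q)))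
      / ((th_b q + th_c q) / q)\<^sup>2) \<longlongrightarrow>
      - (4 * 2 * (1 - 0) ^ 3 * (2 * 0 * (1 - 0) - (1 + 0) * 2)) / (- 4)\<^sup>2) (at 0)"
    by (intro tendsto_divide tendsto_minus tendsto_add tendsto_diff tendsto_mult tendsto_power tendsto_const
        th_small_tendsto th_r_tendsto th_t_tendsto th_bc_tendsto) auto
  moreover have "\<forall>\<^sub>F q in at 0. - (4 * (th_t q / q\<^sup>2) * (1 - th_t q) ^ 3 * (2 * (th_t q / q) * (1 - th_t q) - (1 + th_t q) * (th_r q / q)))
      / ((th_b q + th_c q) / q)\<^sup>2 = k q / q ^ 1"
    using eventually_regular bc
  proof eventually_elim
    case (elim q)
    have q0: "q \<noteq> 0" using reg_q(1)[OF elim(1)] .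
    define X Y where "X = th_b q + th_c q" and "Y = th_a q + th_c q"
    have X: "X \<noteq> 0" using elim by (simp add: X_def)
    have "k q = - (Y * X) / X\<^sup>2" unfolding k_def X_def[symmetric] Y_def[symmetric] using X by (simp add: power2_eq_square)
    also have "Y * X = 4 * th_t q * (1 - th_t q) ^ 3 * (2 * th_t q * (1 - th_t q) - (1 + th_t q) * th_r q)"
      unfolding X_def Y_def by (rule th_c_identities(1)[OF elim(1)])
    finally have k: "k q = - (4 * th_t q * (1 - th_t q) ^ 3 * (2 * th_t q * (1 - th_t q) - (1 + th_t q) * th_r q)) / X\<^sup>2" .
    have "2 * (th_t q / q) * (1 - th_t q) - (1 + th_t q) * (th_r q / q) = (2 * th_t q * (1 - th_t q) - (1 + th_t q) * th_r q) / q"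
      by (simp add: diff_divide_distrib)
    then show ?case unfolding X_def[symmetric] k using X q0 by (simp add: power_divide power2_eq_square)
  qed
  ultimately have klim: "((\<lambda>q. k q / q ^ 1) \<longlongrightarrow> 1) (at 0)" by (auto dest: Lim_transform_eventually)
  have "\<forall>\<^sub>F q in at 0. (th_h q) ^ 3 = (k q) ^ 3"
    using eventually_regular bc
  proof eventually_elim
    case (elim q)
    define X Y Z where "X = th_b q + th_c q" and "Y = th_a q + th_c q" and "Z = (1 - th_t q) ^ 4 * (th_t q)\<^sup>2"
    have nz: "X \<noteq> 0" "Z \<noteq> 0" using elim reg_t(2)[OF elim(1)] reg_t_compl(2)[OF elim(1)] by (auto simp: X_def Z_def)
    have "(th_h q) ^ 3 * Z * X ^ 3 = - (Y ^ 3 * Z)"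
      using th_c_identities(3)[OF elim(1)] th_h_cube[OF elim(1)] by (simp add: X_def Y_def Z_def)
    then have "Z * ((th_h q) ^ 3 * X ^ 3) = Z * (- (Y ^ 3))" by (simp add: mult_ac)
    then have "(th_h q) ^ 3 * X ^ 3 = - (Y ^ 3)" using mult_left_cancel[OF nz(2)] by blast
    then have "(th_h q) ^ 3 = - (Y ^ 3) / X ^ 3" using nz by (simp add: field_simps)
    then show ?case unfolding k_def X_def[symmetric] Y_def[symmetric] by (simp add: power_divide)
  qed
  from eventually_eq_if_cubes_eq[OF this th_h_tendsto klim]
  have "\<forall>\<^sub>F q in at 0. th_h q = k q" by simp
  with bc show ?thesis by eventually_elim (simp add: k_def)
qed

section \<open>The closed form satisfies the recursion\<close>

lemma th_D_minus_tendsto: "((\<lambda>q. th_D (- q) / q) \<longlongrightarrow> - 2) (at 0)"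
  using tendsto_minus[OF filterlim_compose[OF th_D_tendsto filterlim_minus_at_0]] by simp

text \<open>Passing to \<open>- q\<close> changes only the sign of \<open>r\<close> in
  \<open>th_D\<close> squared, so the squared product contains \<open>1 - r^2 = s^2\<close>. The
  leading term \<open>- 4 q^2\<close> fixes the sign of the root.\<close>

lemma th_D_mult_minus:
  "\<forall>\<^sub>F q in at 0. th_D q * th_D (- q) = - 2 * th_t q * (1 - th_t q) * th_s q * (th_w q)\<^sup>2"
proof (rule eventually_eq_if_squares_eq)
  show "\<forall>\<^sub>F q in at 0. (th_D q * th_D (- q))\<^sup>2 = (- 2 * th_t q * (1 - th_t q) * th_s q * (th_w q)\<^sup>2)\<^sup>2"
    using eventually_regular eventually_at_0_minus[OF eventually_regular] eventually_at_0_power[OF eventually_regular, of 2, simplified]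
  proof eventually_elim
    case (elim q)
    have "(th_D q)\<^sup>2 = 2 * th_t q * (1 - th_t q) * (1 - th_r q) * (th_w q)\<^sup>2"
      "(th_D (- q))\<^sup>2 = 2 * th_t q * (1 - th_t q) * (1 + th_r q) * (th_w q)\<^sup>2"
      using reg_AB(6)[OF elim(1)] reg_AB(6)[OF elim(2)] reg_minus[OF elim(1)] by simp_all
    then show ?case using reg_next(6)[OF elim(1,3)] by algebra
  qed
  have "((\<lambda>q. (th_D q / q) * (th_D (- q) / q)) \<longlongrightarrow> 2 * (- 2)) (at 0)"
    by (intro tendsto_mult th_D_tendsto th_D_minus_tendsto)
  then show "((\<lambda>q. (th_D q * th_D (- q)) / q ^ 2) \<longlongrightarrow> - 4) (at 0)" by (simp add: power2_eq_square)
  have "((\<lambda>q. - 2 * (th_t q / q\<^sup>2) * (1 - th_t q) * th_s q * (th_w q)\<^sup>2) \<longlongrightarrow> - 2 * 2 * (1 - 0) * 1 * 1\<^sup>2) (at 0)"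
    by (intro tendsto_mult tendsto_diff tendsto_power tendsto_const th_t_tendsto th_small_tendsto th_w_tendsto)
  then show "((\<lambda>q. (- 2 * th_t q * (1 - th_t q) * th_s q * (th_w q)\<^sup>2) / q ^ 2) \<longlongrightarrow> - 4) (at 0)" by simp
qed simp

text \<open>The closed form of \<open>(3,2,5)\<close> near the origin.\<close>

definition th_C :: "complex \<Rightarrow> complex" where
  "th_C q = (th_w q)\<^sup>2 * (1 - th_t q) * (th_r q - th_t q + 2 * (th_t q)\<^sup>2) / th_D q"

lemma th_C_tendsto: "(th_C \<longlongrightarrow> 1) (at 0)"
proof -
  have "((\<lambda>q. (th_w q)\<^sup>2 * (1 - th_t q) * (th_r q / q - th_t q / q + 2 * (th_t q * (th_t q / q))) / (th_D q / q)) \<longlongrightarrow>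
      1\<^sup>2 * (1 - 0) * (2 - 0 + 2 * (0 * 0)) / 2) (at 0)"
    by (intro tendsto_divide tendsto_add tendsto_diff tendsto_mult tendsto_power tendsto_const
        th_small_tendsto th_r_tendsto th_w_tendsto th_D_tendsto) auto
  moreover have "\<forall>\<^sub>F q in at 0. (th_w q)\<^sup>2 * (1 - th_t q) * (th_r q / q - th_t q / q + 2 * (th_t q * (th_t q / q))) / (th_D q / q) = th_C q"
    using eventually_punctured_unit_disc
  proof eventually_elim
    case (elim q)
    have "th_r q / q - th_t q / q + 2 * (th_t q * (th_t q / q)) = (th_r q - th_t q + 2 * (th_t q)\<^sup>2) / q"
      by (simp add: add_divide_distrib diff_divide_distrib power2_eq_square)
    then show ?case using elim by (simp add: th_C_def)
  qed
  ultimately show ?thesis by (auto dest: Lim_transform_eventually)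
qed

text \<open>The candidate reproduces the dissection of \<open>C\<close>: its even part is its value
  at \<open>q^2\<close>. Fractions over \<open>D\<close> and \<open>D'\<close> are combined by
  multiplying with \<open>D + D' = - 2 D2\<close>, which leaves only \<open>D^2\<close>,
  \<open>D'^2\<close> and \<open>D D'\<close>, all of them known.\<close>

lemma th_C_step:
  assumes reg: "regular q" "regular (- q)" "regular (q\<^sup>2)"
    and DD: "th_D q * th_D (- q) = - 2 * th_t q * (1 - th_t q) * th_s q * (th_w q)\<^sup>2"
  shows "th_C q + th_C (- q) = 2 * th_C (q\<^sup>2)"
    and "th_D (q\<^sup>2) * (th_C q - th_C (q\<^sup>2)) = (th_w q)\<^sup>2 * th_r q * (th_s q - 1 + th_t q) / 2"
proof -
  define t r w s D D' D2 where "t = th_t q" and "r = th_r q" and "w = th_w q" and "s = th_s q"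
    and "D = th_D q" and "D' = th_D (- q)" and "D2 = th_D (q\<^sup>2)"
  define \<rho> where "\<rho> = th_w (q\<^sup>2) / th_w q"
  have nz: "w \<noteq> 0" "t \<noteq> 0" "1 - t \<noteq> 0" "D \<noteq> 0" "D' \<noteq> 0" "D2 \<noteq> 0"
    using reg_w[OF reg(1)] reg_t(2)[OF reg(1)] reg_t_compl(2)[OF reg(1)] reg
    by (auto simp: w_def t_def D_def D'_def D2_def regular_def)
  note nx = reg_next[OF reg(1,3), folded \<rho>_def t_def r_def s_def]
  have rho: "\<rho> \<noteq> 0" and s: "s = 2 * \<rho> - (1 - t + t\<^sup>2)" and quad: "4 * \<rho>\<^sup>2 - 4 * \<rho> * (1 - t + t\<^sup>2) + t ^ 4 = 0"
    and ss: "s\<^sup>2 = 1 - r\<^sup>2" using nx by auto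
  have rr: "r\<^sup>2 = t * (2 - 3 * t + 2 * t\<^sup>2)" using reg_phi7(3)[OF reg(1)] by (simp add: r_def t_def)
  have dd: "D\<^sup>2 = 2 * t * (1 - t) * (1 - r) * w\<^sup>2" "D'\<^sup>2 = 2 * t * (1 - t) * (1 + r) * w\<^sup>2"
    "D * D' = - 2 * t * (1 - t) * s * w\<^sup>2"
    using reg_AB(6)[OF reg(1)] reg_AB(6)[OF reg(2)] reg_minus[OF reg(1)] DD
    by (simp_all add: D_def D'_def t_def r_def w_def s_def)
  then have snz: "s \<noteq> 0" using nz by auto
  have D2: "D2 = - (D + D') / 2" using th_D_next[OF reg(1)] by (simp add: D_def D'_def D2_def)
  define N N' where "N = (1 - t) * (r - t + 2 * t\<^sup>2)" and "N' = (1 - t) * (- r - t + 2 * t\<^sup>2)"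
  have C: "th_C q = w\<^sup>2 * N / D" "th_C (- q) = w\<^sup>2 * N' / D'"
    using reg_minus[OF reg(1)] by (simp_all add: th_C_def N_def N'_def w_def t_def r_def D_def D'_def mult.assoc)
  have C2: "th_C (q\<^sup>2) = w\<^sup>2 * (t * (2 * \<rho> - 2 * t + t\<^sup>2)) / (2 * D2)"
  proof -
    define t2 r2 where "t2 = th_t (q\<^sup>2)" and "r2 = th_r (q\<^sup>2)"
    have t2: "2 * \<rho> * t2 = t\<^sup>2" and r2: "2 * \<rho> * r2 = t * (2 - t)" using nx rho by (auto simp: t2_def r2_def)
    have "th_w (q\<^sup>2) = \<rho> * w" using nz by (simp add: \<rho>_def w_def)
    then have "th_C (q\<^sup>2) = w\<^sup>2 * (\<rho>\<^sup>2 * ((1 - t2) * (r2 - t2 + 2 * t2\<^sup>2))) / D2"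
      by (simp add: th_C_def t2_def r2_def D2_def power_mult_distrib mult_ac)
    also have "\<rho>\<^sup>2 * ((1 - t2) * (r2 - t2 + 2 * t2\<^sup>2)) = t * (2 * \<rho> - 2 * t + t\<^sup>2) / 2"
    proof -
      \<comment> \<open>\<open>t2\<close> and \<open>r2\<close> have denominator
        \<open>2 \<rho>\<close> and the expression is cubic in them; once cleared, the quadratic
        equation for \<rho> reduces it to lower degree.\<close>
      have "8 * \<rho> ^ 3 * ((1 - t2) * (r2 - t2 + 2 * t2\<^sup>2)) = 2 * (2 * \<rho> - 2 * \<rho> * t2) * (\<rho> * (2 * \<rho> * r2) - \<rho> * (2 * \<rho> * t2) + (2 * \<rho> * t2)\<^sup>2)"
        by (simp add: power2_eq_square eval_nat_numeral algebra_simps)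
      also have "\<dots> = 2 * (2 * \<rho> - t\<^sup>2) * (\<rho> * (t * (2 - t)) - \<rho> * t\<^sup>2 + (t\<^sup>2)\<^sup>2)" unfolding t2 r2 ..
      also have "\<dots> = 8 * \<rho> * (t * (2 * \<rho> - 2 * t + t\<^sup>2) / 2)" using quad by algebra
      finally have "8 * \<rho> * (\<rho>\<^sup>2 * ((1 - t2) * (r2 - t2 + 2 * t2\<^sup>2))) = 8 * \<rho> * (t * (2 * \<rho> - 2 * t + t\<^sup>2) / 2)"
        by (simp add: power2_eq_square eval_nat_numeral mult_ac)
      moreover have "8 * \<rho> \<noteq> 0" using rho by simp
      ultimately show ?thesis using mult_left_cancel by blast
    qed
    finally show ?thesis by simp
  qed
  have plus: "(N * D' + N' * D) * (D + D') = 4 * t\<^sup>2 * (1 - t) * w\<^sup>2 * s * (2 * \<rho> - 2 * t + t\<^sup>2)"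
  proof -
    have "(N * D' + N' * D) * (D + D') = (N + N') * (D * D') + N' * D\<^sup>2 + N * D'\<^sup>2" by algebra
    also have "\<dots> = 2 * t * (1 - t) * w\<^sup>2 * (- (N + N') * s + N' * (1 - r) + N * (1 + r))" unfolding dd by algebra
    also have "- (N + N') * s + N' * (1 - r) + N * (1 + r) = 2 * t * s * (2 * \<rho> - 2 * t + t\<^sup>2)"
      unfolding N_def N'_def using rr ss s by algebra
    finally show ?thesis by algebra
  qed
  have minus: "(N * D' - N' * D) * (D + D') = 4 * t * (1 - t) * w\<^sup>2 * r * s * (s - 1 + t)"
  proof -
    have "(N * D' - N' * D) * (D + D') = (N - N') * (D * D') - N' * D\<^sup>2 + N * D'\<^sup>2" by algebra
    also have "\<dots> = 2 * t * (1 - t) * w\<^sup>2 * (- (N - N') * s - N' * (1 - r) + N * (1 + r))" unfolding dd by algebra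
    also have "- (N - N') * s - N' * (1 - r) + N * (1 + r) = 2 * r * s * (s - 1 + t)"
      unfolding N_def N'_def using rr ss by algebra
    finally show ?thesis by algebra
  qed
  have DpD: "D + D' \<noteq> 0"
  proof
    assume e: "D + D' = 0"
    have "D2 = 0" unfolding D2 e by simp
    with nz(6) show False ..
  qed
  have "(th_C q + th_C (- q)) * ((D * D') * (D + D')) = w\<^sup>2 * ((N * D' + N' * D) * (D + D'))"
    unfolding C using nz by (simp add: field_simps)
  also have "\<dots> = 2 * th_C (q\<^sup>2) * ((D * D') * (D + D'))"
  proof -
    have "th_C (q\<^sup>2) * (2 * D2) = w\<^sup>2 * (t * (2 * \<rho> - 2 * t + t\<^sup>2))" unfolding C2 using nz by simp
    then have "th_C (q\<^sup>2) * (D + D') = - w\<^sup>2 * (t * (2 * \<rho> - 2 * t + t\<^sup>2))"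
    proof -
      have "2 * D2 = - (D + D')" unfolding D2 by simp
      then show ?thesis using \<open>th_C (q\<^sup>2) * (2 * D2) = w\<^sup>2 * (t * (2 * \<rho> - 2 * t + t\<^sup>2))\<close> by algebra
    qed
    then show ?thesis unfolding plus dd(3) by algebra
  qed
  finally show sum: "th_C q + th_C (- q) = 2 * th_C (q\<^sup>2)" using nz DpD mult_right_cancel[of "(D * D') * (D + D')"] by auto
  have "th_C q * D = w\<^sup>2 * N" "th_C (- q) * D' = w\<^sup>2 * N'" unfolding C using nz by simp_all
  moreover have "2 * D2 = - (D + D')" unfolding D2 by simp
  ultimately have "D2 * (th_C q - th_C (q\<^sup>2)) * (D * D') = - w\<^sup>2 * ((N * D' - N' * D) * (D + D')) / 4"
    using sum by algebra
  also have "\<dots> = (w\<^sup>2 * r * (s - 1 + t) / 2) * (D * D')" unfolding minus dd(3) by algebra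
  finally have "D2 * (th_C q - th_C (q\<^sup>2)) = w\<^sup>2 * r * (s - 1 + t) / 2"
    using mult_right_cancel[of "D * D'"] nz(4,5) no_zero_divisors by blast
  then show "th_D (q\<^sup>2) * (th_C q - th_C (q\<^sup>2)) = (th_w q)\<^sup>2 * th_r q * (th_s q - 1 + th_t q) / 2"
    by (simp add: D2_def w_def r_def s_def t_def)
qed

definition th_S :: "complex \<Rightarrow> complex" where
  "th_S q = 2 * q ^ 3 * ((euler_E (q ^ 8))\<^sup>2 * (euler_E (q ^ 28))\<^sup>2 + q\<^sup>2 * (euler_E (q ^ 4))\<^sup>2 * (euler_E (q ^ 56))\<^sup>2)"

text \<open>For \<open>h = - (a + c) / (b + c)\<close> one has
  \<open>(1 + h)^2 / h = - (b - a)^2 / ((a + c) (b + c))\<close>, and here \<open>a\<close>,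
  \<open>b\<close> can be eliminated. The quotient is invariant under
  \<open>h \<mapsto> 1 / h\<close>.\<close>

lemma th_h_symmetric:
  assumes reg: "regular q" and h: "th_b q + th_c q \<noteq> 0" "th_h q * (th_b q + th_c q) = - (th_a q + th_c q)"
  shows "(1 + th_h q)\<^sup>2 * ((1 - th_t q) * ((1 + th_t q) * th_r q - 2 * th_t q * (1 - th_t q)))
    = th_h q * ((2 - th_t q + (th_t q)\<^sup>2) * (1 - th_t q + 2 * (th_t q)\<^sup>2))"
proof -
  define X h t r a b c where "X = th_b q + th_c q" and "h = th_h q" and "t = th_t q" and "r = th_r q"
    and "a = th_a q" and "b = th_b q" and "c = th_c q"
  have 1: "(1 + h) * (b + c) = b - a" "h * (b + c)\<^sup>2 = - ((a + c) * (b + c))"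
    using h(2) unfolding h_def[symmetric] a_def[symmetric] b_def[symmetric] c_def[symmetric] by algebra+
  have 2: "(a + c) * (b + c) = 4 * t * (1 - t) ^ 3 * (2 * t * (1 - t) - (1 + t) * r)"
    "(b - a)\<^sup>2 = 4 * t * (1 - t)\<^sup>2 * (2 - t + t\<^sup>2) * (1 - t + 2 * t\<^sup>2)"
    using th_c_identities(1,2)[OF reg] by (simp_all add: t_def r_def a_def b_def c_def)
  have "(b + c)\<^sup>2 * ((1 + h)\<^sup>2 * ((1 - t) * ((1 + t) * r - 2 * t * (1 - t))))
      = (b - a)\<^sup>2 * ((1 - t) * ((1 + t) * r - 2 * t * (1 - t)))"
    using 1(1) by algebra
  also have "\<dots> = - (4 * t * (1 - t) ^ 3 * (2 * t * (1 - t) - (1 + t) * r)) * ((2 - t + t\<^sup>2) * (1 - t + 2 * t\<^sup>2))"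
    unfolding 2(2) by algebra
  also have "\<dots> = (b + c)\<^sup>2 * (h * ((2 - t + t\<^sup>2) * (1 - t + 2 * t\<^sup>2)))"
    unfolding 2(1)[symmetric] using 1(2) by algebra
  finally show ?thesis using h(1) by (simp add: h_def t_def r_def b_def c_def)
qed

text \<open>The two summands of \<open>th_S\<close> are \<open>s\<close> and \<open>h s\<close> with
  \<open>h\<close> the claimed quotient at \<open>q^2\<close>, so the square is
  \<open>s (h s)\<close> times \<open>(1 + h)^2 / h\<close>. The product of the summands consists of
  adjacent pairs of Euler products, which are \<open>phi\<close> times \<open>psi\<close> without
  any cube root.\<close>

lemma th_S_square:
  assumes reg: "regular q" "regular (q\<^sup>2)"
    and h: "th_b (q\<^sup>2) + th_c (q\<^sup>2) \<noteq> 0" "th_h (q\<^sup>2) * (th_b (q\<^sup>2) + th_c (q\<^sup>2)) = - (th_a (q\<^sup>2) + th_c (q\<^sup>2))"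
  defines "t2 \<equiv> th_t (q\<^sup>2)" and "r2 \<equiv> th_r (q\<^sup>2)"
  shows "4 * (th_S q)\<^sup>2 * ((1 - t2) * ((1 + t2) * r2 - 2 * t2 * (1 - t2)))
    = (th_w q) ^ 4 * (1 - th_t q)\<^sup>2 * (th_t q) ^ 4 * ((2 - t2 + t2\<^sup>2) * (1 - t2 + 2 * t2\<^sup>2))"
proof -
  note rq = reg_q[OF reg(1)]
  define h s where "h = th_h (q\<^sup>2)" and "s = 2 * q ^ 3 * ((euler_E (q ^ 8))\<^sup>2 * (euler_E (q ^ 28))\<^sup>2)"
  have Enz: "euler_E (q ^ k) \<noteq> 0" if "0 < k" for k using euler_E_nonzero[OF rq(3)[OF that]] .
  have h_eq: "h = q\<^sup>2 * (((euler_E (q ^ 56))\<^sup>2 * (euler_E (q ^ 4))\<^sup>2) / ((euler_E (q ^ 28))\<^sup>2 * (euler_E (q ^ 8))\<^sup>2))"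
    by (simp add: h_def th_h_def flip: power_mult)
  have hs: "h * s = 2 * q ^ 5 * ((euler_E (q ^ 4))\<^sup>2 * (euler_E (q ^ 56))\<^sup>2)"
  proof -
    have "q\<^sup>2 * ((x * y) / (z * v)) * (2 * q ^ 3 * (v * z)) = 2 * q ^ 5 * (y * x)" if "z \<noteq> 0" "v \<noteq> 0" for x y z v
      using that by (simp add: field_simps power_add[symmetric])
    then show ?thesis unfolding h_eq s_def using Enz[of 8] Enz[of 28] by simp
  qed
  have h0: "h \<noteq> 0" using hs Enz[of 4] Enz[of 56] rq(1) by auto
  have S: "th_S q = s * (1 + h)"
  proof -
    have "th_S q = s + 2 * q ^ 5 * ((euler_E (q ^ 4))\<^sup>2 * (euler_E (q ^ 56))\<^sup>2)"
      by (simp add: th_S_def s_def algebra_simps power_add[symmetric])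
    then show ?thesis unfolding hs[symmetric] by (simp add: algebra_simps)
  qed
  have "euler_E (q ^ 4) * euler_E (q ^ 8) = phi (- (q ^ 4)) * psi (q ^ 4)" "euler_E (q ^ 28) * euler_E (q ^ 56) = phi (- (q ^ 28)) * psi (q ^ 28)"
    using euler_E_phi_psi(1)[of "q ^ 4"] euler_E_phi_psi(1)[of "q ^ 28"] rq(1) rq(3)[of 4] rq(3)[of 28] by (simp_all flip: power_mult)
  moreover have "s * (h * s) = (2 * q ^ 4 * ((euler_E (q ^ 4) * euler_E (q ^ 8)) * (euler_E (q ^ 28) * euler_E (q ^ 56))))\<^sup>2"
    unfolding hs unfolding s_def by algebra
  ultimately have "4 * (s * (h * s)) = ((phi (- (q ^ 4)) * phi (- (q ^ 28))) * (4 * q ^ 4 * psi (q ^ 4) * psi (q ^ 28)))\<^sup>2"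
    by (simp add: power2_eq_square)
  also have "\<dots> = (((1 - th_t q) * th_w q) * ((th_t q)\<^sup>2 * th_w q))\<^sup>2"
    unfolding reg_t_compl(1)[OF reg(1)] reg_t_square[OF reg(1)] ..
  also have "\<dots> = (th_w q) ^ 4 * (1 - th_t q)\<^sup>2 * (th_t q) ^ 4" by algebra
  finally have ssh: "4 * (s * (h * s)) = (th_w q) ^ 4 * (1 - th_t q)\<^sup>2 * (th_t q) ^ 4" .
  have "h * (4 * (th_S q)\<^sup>2 * ((1 - t2) * ((1 + t2) * r2 - 2 * t2 * (1 - t2))))
     = 4 * (s * (h * s)) * ((1 + h)\<^sup>2 * ((1 - t2) * ((1 + t2) * r2 - 2 * t2 * (1 - t2))))"
    unfolding S by algebra
  also have "\<dots> = h * ((th_w q) ^ 4 * (1 - th_t q)\<^sup>2 * (th_t q) ^ 4 * ((2 - t2 + t2\<^sup>2) * (1 - t2 + 2 * t2\<^sup>2)))"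
    unfolding ssh th_h_symmetric[OF reg(2) h, folded t2_def r2_def h_def] by simp
  finally show ?thesis using h0 by simp
qed

lemma th_C_recursion: "\<forall>\<^sub>F q in at 0. th_C (- (q\<^sup>2)) * (th_C q - th_C (q\<^sup>2)) = th_S q"
proof -
  \<comment> \<open>The left side with \<open>th_D\<close> removed: its value at
    \<open>- q^2\<close> is traded for that at \<open>q^2\<close> by \<open>th_D_mult_minus\<close>,
    and the latter cancels against \<open>th_C_step\<close>.\<close>
  define T where "T q = (th_w q)\<^sup>2 * th_r q * (th_s q - 1 + th_t q) * (th_r (q\<^sup>2) + th_t (q\<^sup>2) - 2 * (th_t (q\<^sup>2))\<^sup>2)
      / (4 * th_t (q\<^sup>2) * th_s (q\<^sup>2))" for q
  define U where "U q = 2 * (th_w (q\<^sup>2) / th_w q)" for q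
  have p2: "filterlim (\<lambda>q::complex. q\<^sup>2) (at 0) (at 0)" using filterlim_power_at_0[of 2] by simp
  have Ulim: "(U \<longlongrightarrow> 2) (at 0)"
  proof -
    have "(U \<longlongrightarrow> 2 * (1 / 1)) (at 0)"
      unfolding U_def by (intro tendsto_mult tendsto_divide tendsto_const th_w_tendsto filterlim_compose[OF th_w_tendsto p2]) auto
    then show ?thesis by simp
  qed
  have s_nz: "\<forall>\<^sub>F q in at 0. th_s q \<noteq> 0" using tendsto_imp_eventually_ne[OF th_small_tendsto(4)] by simp
  have nz1: "\<forall>\<^sub>F q in at 0. th_s q + 1 - th_t q \<noteq> 0"
  proof -
    have "((\<lambda>q. th_s q + 1 - th_t q) \<longlongrightarrow> 1 + 1 - 0) (at 0)" by (intro tendsto_diff tendsto_add tendsto_const th_small_tendsto)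
    then show ?thesis by (rule tendsto_imp_eventually_ne) simp
  qed
  \<comment> \<open>Up to a factor \<open>t / U^2\<close> this is
    \<open>(1 + t2) r2 - 2 t2 (1 - t2)\<close>, the coefficient of \<open>th_S\<close> squared that
    has to be cancelled.\<close>
  have nz2: "\<forall>\<^sub>F q in at 0. (2 - 3 * th_t q) * U q + 2 * (th_t q)\<^sup>2 + (th_t q) ^ 3 \<noteq> 0"
  proof -
    have "((\<lambda>q. (2 - 3 * th_t q) * U q + 2 * (th_t q)\<^sup>2 + (th_t q) ^ 3) \<longlongrightarrow> (2 - 3 * 0) * 2 + 2 * 0\<^sup>2 + 0 ^ 3) (at 0)"
      by (intro tendsto_diff tendsto_add tendsto_mult tendsto_power tendsto_const th_small_tendsto Ulim)
    then show ?thesis by (rule tendsto_imp_eventually_ne) simp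
  qed
  have C_eq: "\<forall>\<^sub>F q in at 0. th_C (- (q\<^sup>2)) * (th_C q - th_C (q\<^sup>2)) = T q"
    using eventually_regular eventually_at_0_minus[OF eventually_regular] eventually_at_0_power[OF eventually_regular, of 2, simplified]
      th_D_mult_minus eventually_at_0_power[OF th_D_mult_minus, of 2, simplified] eventually_at_0_power[OF s_nz, of 2, simplified]
      eventually_at_0_power[OF eventually_at_0_minus[OF eventually_regular], of 2, simplified]
  proof eventually_elim
    case (elim q)
    define t2 r2 s2 w2 D2 D2' where "t2 = th_t (q\<^sup>2)" and "r2 = th_r (q\<^sup>2)" and "s2 = th_s (q\<^sup>2)" and "w2 = th_w (q\<^sup>2)"
      and "D2 = th_D (q\<^sup>2)" and "D2' = th_D (- (q\<^sup>2))"
    have nz: "w2 \<noteq> 0" "t2 \<noteq> 0" "1 - t2 \<noteq> 0" "s2 \<noteq> 0" "D2 \<noteq> 0" "D2' \<noteq> 0"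
      using reg_w[OF elim(3)] reg_t(2)[OF elim(3)] reg_t_compl(2)[OF elim(3)] elim(3,6,7)
      by (auto simp: w2_def t2_def s2_def D2_def D2'_def regular_def)
    have DD: "D2 * D2' = - 2 * t2 * (1 - t2) * s2 * w2\<^sup>2" using elim(5) by (simp add: D2_def D2'_def t2_def s2_def w2_def)
    have "th_C (- (q\<^sup>2)) = w2\<^sup>2 * (1 - t2) * (- r2 - t2 + 2 * t2\<^sup>2) / D2'"
      using reg_minus[OF elim(3)] by (simp add: th_C_def w2_def t2_def r2_def D2'_def)
    also have "\<dots> = w2\<^sup>2 * (1 - t2) * (- r2 - t2 + 2 * t2\<^sup>2) * D2 / (D2 * D2')" using nz by simp
    also have "\<dots> = (r2 + t2 - 2 * t2\<^sup>2) / (2 * t2 * s2) * D2" unfolding DD using nz by (simp add: field_simps)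
    finally have "th_C (- (q\<^sup>2)) * (th_C q - th_C (q\<^sup>2)) = (r2 + t2 - 2 * t2\<^sup>2) / (2 * t2 * s2) * (D2 * (th_C q - th_C (q\<^sup>2)))"
      by simp
    also have "\<dots> = T q"
      unfolding D2_def th_C_step(2)[OF elim(1-4)] by (simp add: T_def r2_def t2_def s2_def mult_ac)
    finally show ?case .
  qed
  have "\<forall>\<^sub>F q in at 0. T q = th_S q"
  proof (rule eventually_eq_if_squares_eq)
    show "\<forall>\<^sub>F q in at 0. (T q)\<^sup>2 = (th_S q)\<^sup>2"
      using eventually_regular eventually_at_0_power[OF eventually_regular, of 2, simplified] 
        eventually_at_0_power[OF eventually_at_0_power[OF eventually_regular, of 2, simplified], of 2, simplified] nz2
        eventually_at_0_power[OF s_nz, of 2, simplified] eventually_at_0_power[OF th_h_eventually, of 2, simplified]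
    proof eventually_elim
      case (elim q)
      define t r w s t2 r2 s2 u where "t = th_t q" and "r = th_r q" and "w = th_w q" and "s = th_s q"
        and "t2 = th_t (q\<^sup>2)" and "r2 = th_r (q\<^sup>2)" and "s2 = th_s (q\<^sup>2)" and "u = U q"
      have nz: "w \<noteq> 0" "t \<noteq> 0" "1 - t \<noteq> 0" "t2 \<noteq> 0" "1 - t2 \<noteq> 0" "s2 \<noteq> 0"
        using reg_w[OF elim(1)] reg_t(2)[OF elim(1)] reg_t_compl(2)[OF elim(1)] reg_t(2)[OF elim(2)] reg_t_compl(2)[OF elim(2)] elim(5)
        by (auto simp: w_def t_def t2_def s2_def)
      note nx = reg_next[OF elim(1,2)]
      have u: "u = 2 * (th_w (q\<^sup>2) / th_w q)" by (simp add: u_def U_def)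
      have u0: "u \<noteq> 0" using nx(1) unfolding u by simp
      have t2: "t2 = t\<^sup>2 / u" and r2: "r2 = t * (2 - t) / u" and s: "s = u - (1 - t + t\<^sup>2)"
        using nx(2-4) unfolding u by (simp_all add: t2_def r2_def t_def s_def)
      have quad: "u\<^sup>2 - 2 * u * (1 - t + t\<^sup>2) + t ^ 4 = 0"
        using nx(5) unfolding u t_def by (simp add: power2_eq_square)
      have rr: "r\<^sup>2 = t * (2 - 3 * t + 2 * t\<^sup>2)" using reg_phi7(3)[OF elim(1)] by (simp add: r_def t_def)
      have ss2: "s2\<^sup>2 = 1 - r2\<^sup>2" using reg_next(6)[OF elim(2), simplified] elim(3) by (simp add: s2_def r2_def flip: power_mult)
      have u1: "u - t\<^sup>2 \<noteq> 0" using nz(5) u0 unfolding t2 by (simp add: field_simps)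
      have u2: "u\<^sup>2 - t\<^sup>2 * (2 - t)\<^sup>2 = u\<^sup>2 * s2\<^sup>2" unfolding ss2 r2 using u0 by (simp add: field_simps power2_eq_square)
      have u3: "(2 - 3 * t) * u + 2 * t\<^sup>2 + t ^ 3 \<noteq> 0" using elim(4) by (simp add: t_def u_def)
      have T: "T q = w\<^sup>2 * r * (u - 2 + 2 * t - t\<^sup>2) * (u - t ^ 3) / (2 * t * u * s2)"
      proof -
        have "r2 + t2 - 2 * t2\<^sup>2 = 2 * t * (u - t ^ 3) / u\<^sup>2" unfolding r2 t2 using u0 by (simp add: field_simps eval_nat_numeral)
        then have "T q = w\<^sup>2 * r * (u - 2 + 2 * t - t\<^sup>2) * (2 * t * (u - t ^ 3) / u\<^sup>2) / (4 * (t\<^sup>2 / u) * s2)"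
          unfolding T_def w_def[symmetric] r_def[symmetric] s_def[symmetric] t_def[symmetric] r2_def[symmetric] s2_def[symmetric] t2_def[symmetric]
          unfolding s t2[symmetric] by (simp add: algebra_simps)
        moreover have "W * A * (2 * t * B / u\<^sup>2) / (4 * (t\<^sup>2 / u) * s2) = W * A * B / (2 * t * u * s2)" for W A B
          using u0 nz by (simp add: field_simps power2_eq_square)
        ultimately show ?thesis by (simp only:)
      qed
      have E1: "(T q)\<^sup>2 * (4 * t\<^sup>2 * (u\<^sup>2 - t\<^sup>2 * (2 - t)\<^sup>2)) = w ^ 4 * r\<^sup>2 * (u - 2 + 2 * t - t\<^sup>2)\<^sup>2 * (u - t ^ 3)\<^sup>2"
      proof -
        have "(W * r * A * B / (2 * t * u * s2))\<^sup>2 * (4 * t\<^sup>2 * (u\<^sup>2 * s2\<^sup>2)) = W\<^sup>2 * r\<^sup>2 * A\<^sup>2 * B\<^sup>2" for W A B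
          using u0 nz by (simp add: field_simps power_mult_distrib)
        moreover have "(w\<^sup>2)\<^sup>2 = w ^ 4" by simp
        ultimately show ?thesis unfolding T u2 by simp
      qed
      have E2: "(th_S q)\<^sup>2 * (4 * u * (u - t\<^sup>2) * ((2 - 3 * t) * u + 2 * t\<^sup>2 + t ^ 3))
          = w ^ 4 * (1 - t)\<^sup>2 * t ^ 3 * (2 * u\<^sup>2 - t\<^sup>2 * u + t ^ 4) * (u\<^sup>2 - t\<^sup>2 * u + 2 * t ^ 4)"
      proof -
        have m: "u * t2 = t\<^sup>2" "u * r2 = t * (2 - t)" using u0 by (simp_all add: t2 r2)
        have "4 * (th_S q)\<^sup>2 * ((1 - t2) * ((1 + t2) * r2 - 2 * t2 * (1 - t2)))
            = w ^ 4 * (1 - t)\<^sup>2 * t ^ 4 * ((2 - t2 + t2\<^sup>2) * (1 - t2 + 2 * t2\<^sup>2))"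
          using th_S_square[OF elim(1,2)] elim(6) by (simp add: t2_def r2_def w_def t_def)
        then have "u ^ 4 * (4 * (th_S q)\<^sup>2 * ((1 - t2) * ((1 + t2) * r2 - 2 * t2 * (1 - t2))))
            = u ^ 4 * (w ^ 4 * (1 - t)\<^sup>2 * t ^ 4 * ((2 - t2 + t2\<^sup>2) * (1 - t2 + 2 * t2\<^sup>2)))" by simp
        then have "t * ((th_S q)\<^sup>2 * (4 * u * (u - t\<^sup>2) * ((2 - 3 * t) * u + 2 * t\<^sup>2 + t ^ 3)))
          = t * (w ^ 4 * (1 - t)\<^sup>2 * t ^ 3 * (2 * u\<^sup>2 - t\<^sup>2 * u + t ^ 4) * (u\<^sup>2 - t\<^sup>2 * u + 2 * t ^ 4))"
          using m by algebra
        then show ?thesis using nz by simp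
      qed
      \<comment> \<open>The place where candidate and Euler products meet: a polynomial identity in
        \<open>t\<close> and \<open>u = 2 \<rho>\<close> modulo the quadratic equation of
        \<open>u\<close>.\<close>
      have E3: "(2 - 3 * t + 2 * t\<^sup>2) * (u - 2 + 2 * t - t\<^sup>2)\<^sup>2 * (u - t ^ 3)\<^sup>2 * (u * (u - t\<^sup>2) * ((2 - 3 * t) * u + 2 * t\<^sup>2 + t ^ 3))
          = (1 - t)\<^sup>2 * t ^ 4 * (2 * u\<^sup>2 - t\<^sup>2 * u + t ^ 4) * (u\<^sup>2 - t\<^sup>2 * u + 2 * t ^ 4) * (u\<^sup>2 - t\<^sup>2 * (2 - t)\<^sup>2)"
        using quad by algebra
      define X Y where "X = 4 * t\<^sup>2 * (u\<^sup>2 - t\<^sup>2 * (2 - t)\<^sup>2)" and "Y = 4 * u * (u - t\<^sup>2) * ((2 - 3 * t) * u + 2 * t\<^sup>2 + t ^ 3)"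
      have XY: "X \<noteq> 0" "Y \<noteq> 0" using nz u0 u1 u3 unfolding X_def Y_def u2 by auto
      have "((T q)\<^sup>2 * X) * Y = ((th_S q)\<^sup>2 * Y) * X"
      proof -
        have "((T q)\<^sup>2 * X) * Y = 4 * w ^ 4 * t * ((2 - 3 * t + 2 * t\<^sup>2) * (u - 2 + 2 * t - t\<^sup>2)\<^sup>2 * (u - t ^ 3)\<^sup>2 * (u * (u - t\<^sup>2) * ((2 - 3 * t) * u + 2 * t\<^sup>2 + t ^ 3)))"
          unfolding X_def E1 rr Y_def by simp
        also have "\<dots> = ((th_S q)\<^sup>2 * Y) * X" unfolding E3 X_def Y_def E2 by algebra
        finally show ?thesis .
      qed
      then show ?case using XY by simp
    qed
    have "((\<lambda>q. (th_w q)\<^sup>2 * (th_r q / q) * (U q / 2) * (1 - th_t q) * (th_r (q\<^sup>2) / q\<^sup>2 + th_t (q\<^sup>2) / q\<^sup>2 - 2 * (th_t (q\<^sup>2) * (th_t (q\<^sup>2) / q\<^sup>2)))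
         / ((th_s q + 1 - th_t q) * th_s (q\<^sup>2))) \<longlongrightarrow> 1\<^sup>2 * 2 * (2 / 2) * (1 - 0) * (2 + 0 - 2 * (0 * 0)) / ((1 + 1 - 0) * 1)) (at 0)"
      by (intro tendsto_divide tendsto_mult tendsto_add tendsto_diff tendsto_power tendsto_const th_w_tendsto th_r_tendsto
          Ulim th_small_tendsto filterlim_compose[OF th_r_tendsto p2] filterlim_compose[OF th_small_tendsto(2) p2]
          filterlim_compose[OF th_small_tendsto(1) p2] filterlim_compose[OF th_small_tendsto(4) p2]) auto
    moreover have "\<forall>\<^sub>F q in at 0. (th_w q)\<^sup>2 * (th_r q / q) * (U q / 2) * (1 - th_t q) * (th_r (q\<^sup>2) / q\<^sup>2 + th_t (q\<^sup>2) / q\<^sup>2 - 2 * (th_t (q\<^sup>2) * (th_t (q\<^sup>2) / q\<^sup>2)))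
         / ((th_s q + 1 - th_t q) * th_s (q\<^sup>2)) = T q / q ^ 3"
      using eventually_regular eventually_at_0_power[OF eventually_regular, of 2, simplified] nz1 eventually_at_0_power[OF s_nz, of 2, simplified]
    proof eventually_elim
      case (elim q)
      define t r w s t2 r2 s2 u where "t = th_t q" and "r = th_r q" and "w = th_w q" and "s = th_s q"
        and "t2 = th_t (q\<^sup>2)" and "r2 = th_r (q\<^sup>2)" and "s2 = th_s (q\<^sup>2)" and "u = U q"
      have q0: "q \<noteq> 0" using reg_q(1)[OF elim(1)] .
      have nz: "t2 \<noteq> 0" "s2 \<noteq> 0" "s + 1 - t \<noteq> 0" using reg_t(2)[OF elim(2)] elim(3,4) by (auto simp: t2_def s2_def s_def t_def)
      note nx = reg_next[OF elim(1,2)]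
      have "u * t2 = t\<^sup>2" using nx(1,3) by (simp add: u_def U_def t2_def t_def)
      moreover have "s\<^sup>2 = (1 - t) * (1 - t + 2 * t\<^sup>2)"
        using nx(6) reg_phi7(3)[OF elim(1)] unfolding s_def t_def by algebra
      \<comment> \<open>The limits of \<open>s\<close>, \<open>-1\<close> and \<open>t\<close>
        cancel in \<open>s - 1 + t\<close>, so it is rationalised by \<open>s + 1 - t\<close>. The
        factor \<open>t2\<close> of the result cancels the one in the denominator of
        \<open>T\<close>.\<close>
      ultimately have e: "(s - 1 + t) * (s + 1 - t) = 2 * (u * t2) * (1 - t)" by algebra
      have e': "s - 1 + t = 2 * (u * t2) * (1 - t) / (s + 1 - t)" using e nz(3) by (simp add: field_simps)
      have "T q = w\<^sup>2 * r * (2 * (u * t2) * (1 - t) / (s + 1 - t)) * (r2 + t2 - 2 * t2\<^sup>2) / (4 * t2 * s2)"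
        unfolding T_def w_def[symmetric] r_def[symmetric] s_def[symmetric] t_def[symmetric] r2_def[symmetric] s2_def[symmetric] t2_def[symmetric] e' ..
      also have "\<dots> = w\<^sup>2 * r * (u / 2) * (1 - t) * (r2 + t2 - 2 * t2\<^sup>2) / ((s + 1 - t) * s2)"
      proof -
        have "W * r * (2 * (u * t2) * A / B) * H / (4 * t2 * s2) = W * r * (u / 2) * A * H / (B * s2)" if "B \<noteq> 0" for W A B H
          using that nz by (simp add: field_simps)
        then show ?thesis using nz(3) .
      qed
      finally have T: "T q = w\<^sup>2 * r * (u / 2) * (1 - t) * (r2 + t2 - 2 * t2\<^sup>2) / ((s + 1 - t) * s2)" .
      have "r2 / q\<^sup>2 + t2 / q\<^sup>2 - 2 * (t2 * (t2 / q\<^sup>2)) = (r2 + t2 - 2 * t2\<^sup>2) / q\<^sup>2"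
        by (simp add: add_divide_distrib diff_divide_distrib power2_eq_square)
      then show ?case
        unfolding w_def[symmetric] r_def[symmetric] s_def[symmetric] t_def[symmetric] r2_def[symmetric] s2_def[symmetric] t2_def[symmetric] u_def[symmetric] T
        using q0 by (simp add: power3_eq_cube power2_eq_square)
    qed
    ultimately show "((\<lambda>q. T q / q ^ 3) \<longlongrightarrow> 2) (at 0)" by (auto dest: Lim_transform_eventually)
    have "((\<lambda>q. 2 * ((euler_E (q ^ 8))\<^sup>2 * (euler_E (q ^ 28))\<^sup>2 + q ^ 2 * (euler_E (q ^ 4))\<^sup>2 * (euler_E (q ^ 56))\<^sup>2)) \<longlongrightarrow> 2 * (1\<^sup>2 * 1\<^sup>2 + 0 * 1\<^sup>2 * 1\<^sup>2)) (at 0)"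
      by (intro tendsto_mult tendsto_add tendsto_power[of _ 1] tendsto_const tendsto_euler_E tendsto_power_0) auto
    moreover have "\<forall>\<^sub>F q in at 0. 2 * ((euler_E (q ^ 8))\<^sup>2 * (euler_E (q ^ 28))\<^sup>2 + q ^ 2 * (euler_E (q ^ 4))\<^sup>2 * (euler_E (q ^ 56))\<^sup>2) = th_S q / q ^ 3"
      using eventually_punctured_unit_disc by eventually_elim (simp add: th_S_def)
    ultimately show "((\<lambda>q. th_S q / q ^ 3) \<longlongrightarrow> 2) (at 0)" by (auto dest: Lim_transform_eventually)
  qed simp
  with C_eq show ?thesis by eventually_elim simp
qed

section \<open>Uniqueness for the recursion and analytic continuation\<close>

text \<open>The difference \<open>d\<close> of two solutions satisfies
  \<open>d(q) = d(q^2) - S(q) / (x y) d(- q^2)\<close> with \<open>x\<close>, \<open>y\<close> the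
  solutions at \<open>- q^2\<close>. Iteration moves the arguments to \<open>0\<close>, where
  \<open>d\<close> tends to \<open>0\<close>; smallness of \<open>S\<close> keeps the accumulated
  factor finite.\<close>

lemma recursion_unique:
  fixes f g S :: "complex \<Rightarrow> complex"
  assumes rec: "\<forall>\<^sub>F q in at 0. f (- (q\<^sup>2)) * (f q - f (q\<^sup>2)) = S q" "\<forall>\<^sub>F q in at 0. g (- (q\<^sup>2)) * (g q - g (q\<^sup>2)) = S q"
    and lim: "(f \<longlongrightarrow> 1) (at 0)" "(g \<longlongrightarrow> 1) (at 0)" and S: "((\<lambda>q. S q / q) \<longlongrightarrow> 0) (at 0)"
  shows "\<forall>\<^sub>F q in at 0. f q = g q"
proof -
  define d where "d q = f q - g q" for q
  have half: "\<forall>\<^sub>F q in at 0. norm (k q) > 1 / 2" if "(k \<longlongrightarrow> 1) (at 0)" for k :: "complex \<Rightarrow> complex"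
    using order_tendstoD(1)[OF tendsto_norm[OF that], of "1/2"] by simp
  have m2: "\<forall>\<^sub>F q in at 0. P (- (q\<^sup>2))" if "\<forall>\<^sub>F q in at 0. P q" for P :: "complex \<Rightarrow> bool"
    using eventually_at_0_power[OF eventually_at_0_minus[OF that], of 2] by simp
  \<comment> \<open>The bound \<open>1/4\<close> is the square of the lower bound \<open>1/2\<close>
    for both solutions, so that \<open>S / (x y)\<close> has norm at most
    \<open>norm q\<close>.\<close>
  have Sb: "\<forall>\<^sub>F q in at 0. norm (S q / q) < 1 / 4"
    using order_tendstoD(2)[OF tendsto_norm[OF S], of "1/4"] by simp
  have step: "\<forall>\<^sub>F q in at 0. norm (d q) \<le> norm (d (q\<^sup>2)) + norm q * norm (d (- (q\<^sup>2)))"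
    using rec m2[OF half[OF lim(1)]] m2[OF half[OF lim(2)]] Sb eventually_punctured_unit_disc
  proof eventually_elim
    case (elim q)
    define x y where "x = f (- (q\<^sup>2))" and "y = g (- (q\<^sup>2))"
    have xy: "norm x > 1 / 2" "norm y > 1 / 2" using elim by (simp_all add: x_def y_def)
    then have nz: "x \<noteq> 0" "y \<noteq> 0" by auto
    have "f q = f (q\<^sup>2) + S q / x" "g q = g (q\<^sup>2) + S q / y"
      using elim(1,2) nz by (auto simp: x_def y_def field_simps)
    then have "d q = d (q\<^sup>2) + (S q / x - S q / y)" by (simp add: d_def)
    also have "S q / x - S q / y = - S q / (x * y) * d (- (q\<^sup>2))"
      using nz by (simp add: d_def x_def y_def field_simps)
    finally have "norm (d q) \<le> norm (d (q\<^sup>2)) + norm (S q / (x * y)) * norm (d (- (q\<^sup>2)))"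
      by (metis norm_triangle_ineq norm_mult minus_divide_left norm_minus_cancel)
    moreover have "norm (S q / (x * y)) \<le> norm q"
    proof -
      have "1 / 4 \<le> norm (x * y)" using xy mult_mono[of "1/2" "norm x" "1/2" "norm y"] by (simp add: norm_mult)
      moreover have "norm (S q) \<le> norm q * (1 / 4)" using elim by (simp add: norm_divide field_simps)
      moreover have "norm q * (1 / 4) \<le> norm q * norm (x * y)" using calculation(1) by (intro mult_left_mono) auto
      ultimately show ?thesis using nz by (simp add: norm_divide norm_mult field_simps)
    qed
    ultimately show ?case by (smt (verit) mult_right_mono norm_ge_zero)
  qed
  have "((\<lambda>q. f q - g q) \<longlongrightarrow> 1 - 1) (at 0)" by (intro tendsto_diff lim)
  then have dlim: "(d \<longlongrightarrow> 0) (at 0)" by (simp add: d_def[abs_def])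
  obtain e where e: "0 < e" "e \<le> 1" and st: "\<And>q. q \<noteq> 0 \<Longrightarrow> norm q < e \<Longrightarrow> norm (d q) \<le> norm (d (q\<^sup>2)) + norm q * norm (d (- (q\<^sup>2)))"
  proof -
    obtain e0 where "0 < e0" "\<And>q. q \<noteq> 0 \<Longrightarrow> norm q < e0 \<Longrightarrow> norm (d q) \<le> norm (d (q\<^sup>2)) + norm q * norm (d (- (q\<^sup>2)))"
      using step by (auto simp: eventually_at dist_norm)
    then show ?thesis using that[of "min e0 1"] by auto
  qed
  have "d q = 0" if q: "q \<noteq> 0" "norm q < e" for q
  proof -
    have "norm (d q) * (1 - norm q) \<le> \<eta>" if "\<eta> > 0" for \<eta> :: real
    proof -
      have "\<forall>\<^sub>F q in at 0. norm (d q) < \<eta>" using order_tendstoD(2)[OF tendsto_norm[OF dlim], of \<eta>] that by simp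
      then obtain \<delta> where \<delta>: "0 < \<delta>" "\<And>x. x \<noteq> 0 \<Longrightarrow> norm x < \<delta> \<Longrightarrow> norm (d x) < \<eta>"
        by (auto simp: eventually_at dist_norm)
      \<comment> \<open>The weight makes the induction close: with \<open>z = norm x\<close>, the
        growth factor \<open>1 + z\<close> is compensated by
        \<open>(1 - z) (1 + z) = 1 - z^2\<close>, the weight at both points of norm
        \<open>z^2\<close>.\<close>
      have main: "norm (d x) * (1 - norm x) \<le> \<eta>" if "x \<noteq> 0" "norm x < e" "norm x ^ (2 ^ n) < \<delta>" for x n
        using that
      proof (induction n arbitrary: x)
        case 0
        then have "norm (d x) < \<eta>" using \<delta>(2) by simp
        moreover have "norm (d x) * (1 - norm x) \<le> norm (d x) * 1" by (intro mult_left_mono) auto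
        ultimately show ?case by simp
      next
        case (Suc n)
        have x1: "norm x < 1" using Suc.prems e by simp
        have "norm (x\<^sup>2) \<le> norm x" using x1 mult_left_le[of "norm x" "norm x"] by (simp add: norm_mult power2_eq_square)
        then have x2: "norm (x\<^sup>2) < e" using Suc.prems by simp
        have "norm (x\<^sup>2) ^ (2 ^ n) < \<delta>" using Suc.prems by (simp add: norm_power flip: power_mult)
        then have "norm (d (x\<^sup>2)) * (1 - norm (x\<^sup>2)) \<le> \<eta>" "norm (d (- (x\<^sup>2))) * (1 - norm (- (x\<^sup>2))) \<le> \<eta>"
          using Suc.prems x2 by (intro Suc.IH; simp)+
        moreover define z where "z = norm x"
        ultimately have b: "norm (d (x\<^sup>2)) * (1 - z\<^sup>2) \<le> \<eta>" "norm (d (- (x\<^sup>2))) * (1 - z\<^sup>2) \<le> \<eta>"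
          by (simp_all add: norm_power)
        have z: "0 \<le> z" "z < 1" using x1 by (simp_all add: z_def)
        have "norm (d x) * (1 - z) \<le> (norm (d (x\<^sup>2)) + z * norm (d (- (x\<^sup>2)))) * (1 - z)"
          using st[of x] Suc.prems z by (intro mult_right_mono) (auto simp: z_def)
        then have "norm (d x) * (1 - z) * (1 + z) \<le> (norm (d (x\<^sup>2)) + z * norm (d (- (x\<^sup>2)))) * (1 - z) * (1 + z)"
          using z by (intro mult_right_mono) auto
        also have "\<dots> = norm (d (x\<^sup>2)) * (1 - z\<^sup>2) + z * (norm (d (- (x\<^sup>2))) * (1 - z\<^sup>2))"
          by (simp add: algebra_simps power2_eq_square)
        also have "\<dots> \<le> \<eta> + z * \<eta>" using b z by (intro add_mono mult_left_mono) auto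
        also have "\<dots> = \<eta> * (1 + z)" by (simp add: algebra_simps)
        finally have "norm (d x) * (1 - z) \<le> \<eta>" by (rule mult_right_le_imp_le) (use z in simp)
        then show ?case by (simp add: z_def)
      qed
      have "(\<lambda>n. norm q ^ n) \<longlonglongrightarrow> 0" using q e by (intro LIMSEQ_power_zero) auto
      then have "\<forall>\<^sub>F n in sequentially. norm q ^ n < \<delta>" using \<delta>(1) by (rule order_tendstoD)
      then obtain n where n: "norm q ^ n < \<delta>" by (auto simp: eventually_sequentially)
      have "norm q ^ (2 ^ n) \<le> norm q ^ n" using q e by (intro power_decreasing) auto
      then show ?thesis using n q by (intro main[of q n]) auto
    qed
    then have "norm (d q) * (1 - norm q) \<le> 0" by (metis dense_ge)
    moreover have "1 - norm q > 0" using q e by simp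
    ultimately show ?thesis by (simp add: mult_le_0_iff)
  qed
  then have "\<forall>\<^sub>F q in at 0. d q = 0" using e by (auto simp: eventually_at dist_norm intro!: exI[of _ e])
  then show ?thesis by (simp add: d_def)
qed

lemma form_theta_holomorphic:
  assumes "\<And>n m. 0 \<le> a * n\<^sup>2 + b * n * m + c * m\<^sup>2" "\<And>n m. \<bar>n\<bar> + \<bar>m\<bar> \<le> a * n\<^sup>2 + b * n * m + c * m\<^sup>2"
  shows "form_theta a b c holomorphic_on ball 0 1"
proof -
  have "(\<lambda>q. \<Sum>\<^sub>\<infinity>z. 1 * q powi (case z of (n, m) \<Rightarrow> a * n\<^sup>2 + b * n * m + c * m\<^sup>2)) holomorphic_on ball 0 1"
  proof (rule theta_holomorphic)
    fix q :: complex
    assume "norm q < 1"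
    from theta_summable_2[OF this, of "\<lambda>n m. a * n\<^sup>2 + b * n * m + c * m\<^sup>2" 0 "\<lambda>_ _. 1" UNIV]
    show "(\<lambda>z. 1 * q powi (case z of (n, m) \<Rightarrow> a * n\<^sup>2 + b * n * m + c * m\<^sup>2)) summable_on UNIV"
      using assms by (simp add: case_prod_unfold)
  qed (use assms in auto)
  then show ?thesis by (simp add: form_theta_def[abs_def] case_prod_unfold)
qed

lemma form_theta_325_holomorphic: "form_theta 3 2 5 holomorphic_on ball 0 1"
  using quad325_bounds by (intro form_theta_holomorphic) (simp_all add: quad325_def)

lemma form_theta_diagonal:
  fixes q :: complex and a c :: nat
  assumes "norm q < 1" "q \<noteq> 0" "0 < a" "0 < c"
  shows "form_theta (int a) 0 (int c) q = phi (q ^ a) * phi (q ^ c)"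
proof -
  have "norm (q ^ a) < 1" "norm (q ^ c) < 1" using norm_power_lt_one assms by auto
  from infsum_Times_mult(1)[OF phi_summable[OF this(1)] phi_summable[OF this(2)]]
  show ?thesis using assms by (simp add: form_theta_def phi_def powi_of_power power_int_add)
qed

lemma form_theta_diagonal_holomorphic:
  assumes "0 < a" "0 < c"
  shows "form_theta a 0 c holomorphic_on ball 0 1"
proof (rule form_theta_holomorphic)
  fix n m :: int
  have "1 * n\<^sup>2 \<le> a * n\<^sup>2" "1 * m\<^sup>2 \<le> c * m\<^sup>2" using assms by (intro mult_right_mono; simp)+
  then show "\<bar>n\<bar> + \<bar>m\<bar> \<le> a * n\<^sup>2 + 0 * n * m + c * m\<^sup>2"
    using int_abs_le_square[of n] int_abs_le_square[of m] by simp
  then show "0 \<le> a * n\<^sup>2 + 0 * n * m + c * m\<^sup>2" by linarith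
qed

lemma form_theta_325_eventually: "\<forall>\<^sub>F q in at 0. form_theta 3 2 5 q = th_C q"
proof (rule recursion_unique[OF _ th_C_recursion _ th_C_tendsto])
  show "\<forall>\<^sub>F q in at 0. form_theta 3 2 5 (- (q\<^sup>2)) * (form_theta 3 2 5 q - form_theta 3 2 5 (q\<^sup>2)) = th_S q"
    using eventually_punctured_unit_disc by eventually_elim (use recursion_325 in \<open>auto simp: th_S_def\<close>)
  have "isCont (form_theta 3 2 5) 0"
    using form_theta_325_holomorphic by (auto intro!: continuous_on_interior[where S = "ball 0 1"] holomorphic_on_imp_continuous_on)
  moreover have "form_theta 3 2 5 0 = 1"
  proof -
    have "quad325 n m = 0 \<longleftrightarrow> n = 0 \<and> m = 0" for n m using quad325_bounds(2)[of n m] by (auto simp: quad325_def[of 0 0])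
    then show ?thesis unfolding form_theta_325 by (subst infsum_single_nonzero[of "(0, 0)"]) (auto simp: quad325_def[of 0 0])
  qed
  ultimately show "(form_theta 3 2 5 \<longlongrightarrow> 1) (at 0)" by (simp add: continuous_at)
  have "((\<lambda>q. 2 * q ^ 2 * ((euler_E (q ^ 8))\<^sup>2 * (euler_E (q ^ 28))\<^sup>2 + q ^ 2 * (euler_E (q ^ 4))\<^sup>2 * (euler_E (q ^ 56))\<^sup>2)) \<longlongrightarrow> 2 * 0 * (1\<^sup>2 * 1\<^sup>2 + 0 * 1\<^sup>2 * 1\<^sup>2)) (at 0)"
    by (intro tendsto_mult tendsto_add tendsto_power[of _ 1] tendsto_const tendsto_euler_E tendsto_power_0) auto
  moreover have "\<forall>\<^sub>F q in at 0. 2 * q ^ 2 * ((euler_E (q ^ 8))\<^sup>2 * (euler_E (q ^ 28))\<^sup>2 + q ^ 2 * (euler_E (q ^ 4))\<^sup>2 * (euler_E (q ^ 56))\<^sup>2) = th_S q / q"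
    using eventually_punctured_unit_disc by eventually_elim (simp add: th_S_def power3_eq_cube power2_eq_square)
  ultimately show "((\<lambda>q. th_S q / q) \<longlongrightarrow> 0) (at 0)" by (auto dest: Lim_transform_eventually)
qed

text \<open>Multiplied by \<open>D = A - B\<close>, both \<open>A - C\<close> and
  \<open>B + C\<close> become polynomials in \<open>A^2\<close>, \<open>B^2\<close>,
  \<open>A B\<close> and the numerator of \<open>th_C\<close>, namely \<open>w^2 (a + c)\<close> and
  \<open>- w^2 (b + c)\<close>. Their ratio is \<open>th_h\<close>.\<close>

lemma theta_quotient_eventually:
  "\<forall>\<^sub>F q in at 0. th_A q - form_theta 3 2 5 q = th_h q * (th_B q + form_theta 3 2 5 q)"
  using form_theta_325_eventually eventually_regular th_h_eventually
proof eventually_elim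
  case (elim q)
  define t r w a b c A B D h where "t = th_t q" and "r = th_r q" and "w = th_w q" and "a = th_a q" and "b = th_b q"
    and "c = th_c q" and "A = th_A q" and "B = th_B q" and "D = th_D q" and "h = th_h q"
  have D: "D \<noteq> 0" "D = A - B" using elim(2) by (simp_all add: regular_def D_def A_def B_def th_D_def)
  have C: "th_C q * D = w\<^sup>2 * (1 - t) * (r - t + 2 * t\<^sup>2)" using D by (simp add: th_C_def D_def w_def t_def r_def)
  have AB: "A\<^sup>2 = w\<^sup>2 * (1 + a)" "B\<^sup>2 = w\<^sup>2 * (1 + b)" "A * B = w\<^sup>2 * (1 - t + t\<^sup>2 + r)"
    using reg_AB(1-3)[OF elim(2)] by (simp_all add: A_def B_def w_def a_def b_def t_def r_def)
  have c: "c = 2 * t * (1 - t)\<^sup>2 - (2 - t) * r" by (simp add: c_def th_c_def t_def r_def)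
  have h: "h * (b + c) = - (a + c)" using elim(3) by (simp add: h_def a_def b_def c_def)
  have "D * (A - th_C q) = w\<^sup>2 * (a + c)" unfolding c using AB C D(2) by algebra
  moreover have "D * (B + th_C q) = - w\<^sup>2 * (b + c)" unfolding c using AB C D(2) by algebra
  ultimately have "D * (A - th_C q) = D * (h * (B + th_C q))" using h by algebra
  then show ?case using D(1) unfolding elim(1) by (simp add: A_def B_def h_def)
qed

theorem theorem4p4:
  fixes q Q :: complex
  assumes "norm q < 1"
    and "Q = q ^ 7"
    and "form_theta 2 0 7 q + form_theta 3 2 5 q \<noteq> 0"
  shows "(form_theta 1 0 14 q - form_theta 3 2 5 q) / (form_theta 2 0 7 q + form_theta 3 2 5 q)
       = q * (((euler_E (Q ^ 4))\<^sup>2 * (euler_E (q ^ 2))\<^sup>2)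
              / ((euler_E (Q ^ 2))\<^sup>2 * (euler_E (q ^ 4))\<^sup>2))"
proof -
  \<comment> \<open>Cross-multiplied, both sides are holomorphic in the whole disc, even at zeros of
    the denominator of the claim.\<close>
  define F where "F x = (form_theta 1 0 14 x - form_theta 3 2 5 x) * ((euler_E (x ^ 14))\<^sup>2 * (euler_E (x ^ 4))\<^sup>2)" for x
  define G where "G x = x * (form_theta 2 0 7 x + form_theta 3 2 5 x) * ((euler_E (x ^ 28))\<^sup>2 * (euler_E (x\<^sup>2))\<^sup>2)" for x
  have "\<forall>\<^sub>F x in at 0. F x = G x"
    using theta_quotient_eventually eventually_punctured_unit_disc
  proof eventually_elim
    case (elim x)
    have "form_theta 1 0 14 x = th_A x" "form_theta 2 0 7 x = th_B x"
      using form_theta_diagonal[of x 1 14] form_theta_diagonal[of x 2 7] elim by (simp_all add: th_A_def th_B_def)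
    moreover have "euler_E (x ^ 14) \<noteq> 0" "euler_E (x ^ 4) \<noteq> 0"
      using euler_E_nonzero norm_power_lt_one elim by auto
    ultimately show ?case using elim(1) by (simp add: F_def G_def th_h_def)
  qed
  then obtain e where e: "0 < e" "\<And>x. x \<noteq> 0 \<Longrightarrow> norm x < e \<Longrightarrow> F x = G x"
    by (auto simp: eventually_at dist_norm)
  have hE: "(\<lambda>x. euler_E (x ^ k)) holomorphic_on ball 0 1" if "0 < k" for k
  proof -
    have "(euler_E \<circ> (\<lambda>x. x ^ k)) holomorphic_on ball 0 1"
      by (rule holomorphic_on_compose_gen[OF _ euler_E_holomorphic]) (use that norm_power_lt_one in \<open>auto intro!: holomorphic_intros\<close>)
    then show ?thesis by (simp add: o_def)
  qed
  have hF: "F holomorphic_on ball 0 1" and hG: "G holomorphic_on ball 0 1"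
    unfolding F_def[abs_def] G_def[abs_def]
    by (intro holomorphic_intros hE form_theta_diagonal_holomorphic form_theta_325_holomorphic; simp)+
  have FG: "F q = G q"
  \<comment> \<open>The local identity says nothing about the centre itself, so the open set is a
    punctured disc.\<close>
  proof (rule analytic_continuation_open[where s = "ball 0 (min e 1) - {0}" and s' = "ball 0 1" and f = F and g = G and z = q])
    have "(of_real (min e 1 / 2) :: complex) \<in> ball 0 (min e 1) - {0}" using e(1) by auto
    then show "ball 0 (min e 1) - {0 :: complex} \<noteq> {}" by blast
  qed (use e hF hG assms in auto)
  have "euler_E (q ^ 14) \<noteq> 0" "euler_E (q ^ 4) \<noteq> 0"
    using euler_E_nonzero norm_power_lt_one assms by auto
  moreover have "Q ^ 4 = q ^ 28" "Q ^ 2 = q ^ 14" by (simp_all add: assms(2) flip: power_mult)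
  ultimately show ?thesis using FG assms(3) by (simp add: F_def G_def field_simps)
qed

end
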